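(* Let $\mathsf X,\mathsf Y,\mathsf Z$ be separable Banach spaces, $T>0$, and let $X\subset\mathsf X$ and $Z\subset\mathsf Z$ be open and connected with $0\in Z$. Let $f\in C^3(X\times(0,T);\mathsf Y)$ be such that $f(\cdot,t):X\to\mathsf Y$ is a Fredholm map of index $0$ for every $t\in(0,T)$. Let $j\in C^2(X\times Z;\mathsf Y)$ satisfy $j(x,0)=0$ for every $x\in X$, and assume that for every $x\in X$, $t\in(0,T)$, $z\in Z$ and $v\in\mathsf X\setminus\{0\}$: (J1) $D_xf(x,t)+D_xj(x,z)$ is a Fredholm operator in $\mathcal L(\mathsf X;\mathsf Y)$; (J2) the map $\mathsf X\times\mathsf Z\to\mathsf Y$, $(\tilde v,\tilde z)\mapsto D_xf(x,t)[\tilde v]+D_xj(x,z)[\tilde v]+D^2_{xz}j(x,z)[v,\tilde z]$, is surjective. Then every open neighborhood $U$ of the origin in $\mathsf Y\times Z$ contains a residual subset $U_r$ such that for every $(y,z)\in U_r$ the map $$\tilde f:X\times(0,T)\to\mathsf Y,\qquad \tilde f(x,t):=f(x,t)+y+j(x,z),$$ satisfies the transversality conditions (i.e. (T1), (T2), (T3) hold for $\tilde f$ at every point of the singular set of $\tilde f$).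
   Context: A bounded linear operator $L\in\mathcal L(\mathsf X;\mathsf Y)$ is Fredholm if $\dim\mathsf N(L)$ and $\operatorname{codim}\mathsf R(L)$ are finite ($\mathsf N$ = kernel, $\mathsf R$ = range); its index is $\dim\mathsf N(L)-\operatorname{codim}\mathsf R(L)$. A $C^1$ map on a connected open set is a Fredholm map of index $k$ if its differential at every point is a Fredholm operator (of index $k$). $L^*\in\mathcal L(\mathsf Y^*;\mathsf X^* )$ is the adjoint of $L$. $D_x$, $D_x^2$ denote partial differentials with respect to the variable in $\mathsf X$, $D^2_{xz}j$ is the mixed second differential, and $\partial_t$ is the partial derivative in $t$. A set is nowhere dense if the interior of its closure is empty, meagre if it is contained in a countable union of nowhere dense sets, and residual if it is the complement of a meagre set (here: residual in $U$). For a $C^2$ map $h:X\times(0,T)\to\mathsf Y$ with $h(\cdot,t)$ Fredholm of index $0$ for every $t$, define the singular set $\mathcal S:=\{(x,t)\in X\times(0,T): h(x,t)=0,\ D_xh(x,t)\text{ is not invertible}\}$. Transversality conditions for $h$ at a point $(x_0,t_0)\in\mathcal S$: (T1) $\dim\mathsf N(D_xh(x_0,t_0))=1$; (T2) if $0\neq\ell^*\in\mathsf N(D_xh(x_0,t_0)^* )$, then ${}_{\mathsf Y^*}\langle\ell^*,\partial_th(x_0,t_0)\rangle_{\mathsf Y}\neq0$; (T3) if $0\neq v\in\mathsf N(D_xh(x_0,t_0))$ and $0\neq\ell^*\in\mathsf N(D_xh(x_0,t_0)^* )$, then ${}_{\mathsf Y^*}\langle\ell^*,D_x^2h(x_0,t_0)[v,v]\rangle_{\mathsf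 Y}\neq0$. $h$ satisfies the transversality conditions if they hold at every point of $\mathcal S$. *)

theory Defs
  imports "HOL-Analysis.Analysis"
begin

subsection \<open>Differentials and maps of class $C^k$\<close>

text \<open>The differential as an element of the normed space of bounded linear operators, so that it can
  be differentiated again. Like \<^const>\<open>frechet_derivative\<close> it is unspecified
  where the map is not differentiable.\<close>

definition frechet_diff ::
  "('a::real_normed_vector \<Rightarrow> 'b::real_normed_vector) \<Rightarrow> 'a \<Rightarrow> 'a \<Rightarrow>\<^sub>L 'b" where
  "frechet_diff f x = Blinfun (frechet_derivative f (at x))"

definition C1_on :: "'a set \<Rightarrow> ('a::real_normed_vector \<Rightarrow> 'b::real_normed_vector) \<Rightarrow> bool" where
  "C1_on S f \<longleftrightarrow> (\<forall>x\<in>S. f differentiable (at x)) \<and> continuous_on S (frechet_diff f)"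

definition C2_on :: "'a set \<Rightarrow> ('a::real_normed_vector \<Rightarrow> 'b::real_normed_vector) \<Rightarrow> bool" where
  "C2_on S f \<longleftrightarrow> C1_on S f \<and> C1_on S (frechet_diff f)"

definition C3_on :: "'a set \<Rightarrow> ('a::real_normed_vector \<Rightarrow> 'b::real_normed_vector) \<Rightarrow> bool" where
  "C3_on S f \<longleftrightarrow> C1_on S f \<and> C2_on S (frechet_diff f)"

text \<open>Partial differentials of a map on a product. They are iterated to the second order:
  \<open>partial_fst (partial_fst h) (x, t) v w\<close> is $D_x^2 h(x,t)[v,w]$, and
  \<open>partial_snd (partial_fst h) (x, z) w v\<close> is $D^2_{xz} h(x,z)[v,w]$,
  with \<open>v\<close> in the first and \<open>w\<close> in the second factor.\<close>

definition partial_fst ::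
  "('a::real_normed_vector \<times> 'c \<Rightarrow> 'b::real_normed_vector) \<Rightarrow> 'a \<times> 'c \<Rightarrow> 'a \<Rightarrow>\<^sub>L 'b" where
  "partial_fst h p = frechet_diff (\<lambda>x. h (x, snd p)) (fst p)"

definition partial_snd ::
  "('a \<times> 'c::real_normed_vector \<Rightarrow> 'b::real_normed_vector) \<Rightarrow> 'a \<times> 'c \<Rightarrow> 'c \<Rightarrow>\<^sub>L 'b" where
  "partial_snd h p = frechet_diff (\<lambda>z. h (fst p, z)) (snd p)"

definition partial_t :: "('a \<times> real \<Rightarrow> 'b::real_normed_vector) \<Rightarrow> 'a \<times> real \<Rightarrow> 'b" where
  "partial_t h p = vector_derivative (\<lambda>t. h (fst p, t)) (at (snd p))"


subsection \<open>Fredholm operators\<close>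

definition kernel :: "('a::real_normed_vector \<Rightarrow>\<^sub>L 'b::real_normed_vector) \<Rightarrow> 'a set" where
  "kernel L = {v. blinfun_apply L v = 0}"

definition fin_dim :: "'a::real_vector set \<Rightarrow> bool" where
  "fin_dim V \<longleftrightarrow> (\<exists>B. finite B \<and> span B = V)"

text \<open>The codimension of a subspace \<open>W\<close> is the dimension of an algebraic complement, that is, of a
  system of representatives of the quotient by \<open>W\<close>; it does not depend on the complement.
  As \<^const>\<open>dim\<close> is 0 on infinite-dimensional spaces, \<open>codim\<close> is meaningful only
  together with \<open>fin_codim\<close>.\<close>

definition complement_of :: "'a::real_vector set \<Rightarrow> 'a set \<Rightarrow> bool" where
  "complement_of W V \<longleftrightarrow>
     subspace V \<and> W \<inter> V = {0} \<and> (\<forall>y. \<exists>w\<in>W. \<exists>v\<in>V. y = w + v)"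

definition fin_codim :: "'a::real_vector set \<Rightarrow> bool" where
  "fin_codim W \<longleftrightarrow> (\<exists>V. complement_of W V \<and> fin_dim V)"

definition codim :: "'a::real_vector set \<Rightarrow> nat" where
  "codim W = dim (SOME V. complement_of W V)"

definition fredholm :: "('a::real_normed_vector \<Rightarrow>\<^sub>L 'b::real_normed_vector) \<Rightarrow> bool" where
  "fredholm L \<longleftrightarrow> fin_dim (kernel L) \<and> fin_codim (range (blinfun_apply L))"

definition fredholm_index :: "('a::real_normed_vector \<Rightarrow>\<^sub>L 'b::real_normed_vector) \<Rightarrow> int" where
  "fredholm_index L = int (dim (kernel L)) - int (codim (range (blinfun_apply L)))"

definition fredholm_map ::
  "'a set \<Rightarrow> ('a::real_normed_vector \<Rightarrow> 'b::real_normed_vector) \<Rightarrow> int \<Rightarrow> bool" where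
  "fredholm_map S g k \<longleftrightarrow> open S \<and> connected S \<and> C1_on S g \<and>
     (\<forall>x\<in>S. fredholm (frechet_diff g x) \<and> fredholm_index (frechet_diff g x) = k)"

definition invertible_blinfun ::
  "('a::real_normed_vector \<Rightarrow>\<^sub>L 'b::real_normed_vector) \<Rightarrow> bool" where
  "invertible_blinfun L \<longleftrightarrow> (\<exists>M. M o\<^sub>L L = id_blinfun \<and> L o\<^sub>L M = id_blinfun)"

lift_definition adjoint_blinfun ::
  "('a::real_normed_vector \<Rightarrow>\<^sub>L 'b::real_normed_vector) \<Rightarrow> ('b \<Rightarrow>\<^sub>L real) \<Rightarrow>\<^sub>L ('a \<Rightarrow>\<^sub>L real)"
  is "\<lambda>L l. l o\<^sub>L L"
  by (rule bounded_bilinear.bounded_linear_left[OF bounded_bilinear_blinfun_compose])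


subsection \<open>Transversality conditions\<close>

definition singular_set ::
  "'a set \<Rightarrow> real \<Rightarrow> ('a::real_normed_vector \<times> real \<Rightarrow> 'b::real_normed_vector) \<Rightarrow> ('a \<times> real) set" where
  "singular_set X T h =
     {p \<in> X \<times> {0<..<T}. h p = 0 \<and> \<not> invertible_blinfun (partial_fst h p)}"

definition transversal_T1 ::
  "('a::real_normed_vector \<times> real \<Rightarrow> 'b::real_normed_vector) \<Rightarrow> 'a \<times> real \<Rightarrow> bool" where
  "transversal_T1 h p \<longleftrightarrow> dim (kernel (partial_fst h p)) = 1"

definition transversal_T2 ::
  "('a::real_normed_vector \<times> real \<Rightarrow> 'b::real_normed_vector) \<Rightarrow> 'a \<times> real \<Rightarrow> bool" where
  "transversal_T2 h p \<longleftrightarrow>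
     (\<forall>l \<in> kernel (adjoint_blinfun (partial_fst h p)). l \<noteq> 0 \<longrightarrow>
        blinfun_apply l (partial_t h p) \<noteq> 0)"

definition transversal_T3 ::
  "('a::real_normed_vector \<times> real \<Rightarrow> 'b::real_normed_vector) \<Rightarrow> 'a \<times> real \<Rightarrow> bool" where
  "transversal_T3 h p \<longleftrightarrow>
     (\<forall>v \<in> kernel (partial_fst h p). \<forall>l \<in> kernel (adjoint_blinfun (partial_fst h p)).
        v \<noteq> 0 \<longrightarrow> l \<noteq> 0 \<longrightarrow>
        blinfun_apply l (blinfun_apply (blinfun_apply (partial_fst (partial_fst h) p) v) v) \<noteq> 0)"

definition transversality_conditions ::
  "'a set \<Rightarrow> real \<Rightarrow> ('a::real_normed_vector \<times> real \<Rightarrow> 'b::real_normed_vector) \<Rightarrow> bool" where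
  "transversality_conditions X T h \<longleftrightarrow>
     (\<forall>p \<in> singular_set X T h. transversal_T1 h p \<and> transversal_T2 h p \<and> transversal_T3 h p)"


subsection \<open>Baire category\<close>

definition nowhere_dense_in :: "'a topology \<Rightarrow> 'a set \<Rightarrow> bool" where
  "nowhere_dense_in \<tau> A \<longleftrightarrow> A \<subseteq> topspace \<tau> \<and> \<tau> interior_of (\<tau> closure_of A) = {}"

definition meagre_in :: "'a topology \<Rightarrow> 'a set \<Rightarrow> bool" where
  "meagre_in \<tau> A \<longleftrightarrow>
     (\<exists>\<N>. countable \<N> \<and> (\<forall>N\<in>\<N>. nowhere_dense_in \<tau> N) \<and> A \<subseteq> \<Union>\<N>)"

definition residual_in :: "'a topology \<Rightarrow> 'a set \<Rightarrow> bool" where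
  "residual_in \<tau> R \<longleftrightarrow> R \<subseteq> topspace \<tau> \<and> meagre_in \<tau> (topspace \<tau> - R)"

end

theory Submission
  imports Defs
begin

text \<open>Write $h(x,t) = f(x,t) + y + j(x,z)$ and $L = D_x h(x,t)$; connectedness of $Z$ and $j(\cdot,0)=0$
  give $L$ index 0. A point is singular iff some $(x,t,v)$ with $v \neq 0$ solves $h(x,t) = 0$, $Lv = 0$.
  Normalized by $\eta(v) = 1$, this is a system
  $\Phi(x,t,v;y,z) = 0$ with values in $\mathsf Y \times \mathsf Y \times R$ whose differential
  in $(x,t,v)$ has index 0, and if that differential is onto, then (T1)--(T3) hold at $(x,t)$. By (J2) the full
  differential, in $(y,z)$ as well, is onto at every zero.

  So the exceptional parameters are the critical values in the sense of Sard--Smale. The system is only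
  $C^1$, which suffices in index 0. Instead of an implicit function theorem, the
  zero set over a finite-dimensional slice of parameters is parametrized, in a bi-Lipschitz way, by finitely
  many functionals $\kappa_k$; at a critical zero the parameter is confined to first order to a hyperplane,
  and a count of grid points shows that critical values cannot fill a cube. Critical values of zeros near a
  given zero thus form a closed set without interior, and separability yields a countable cover.\<close>

subsection \<open>Augmented linear systems\<close>

text \<open>In the unknowns, the differential of Phi sends (x, t, w) to (L x + t a, B x + t b + L w,
  eta w), where a is the t-derivative of h and B x + t b the derivative of L v at fixed v. Both
  diagonal blocks L have index 0, and the unknown t balances the equation eta(v) = 1. The parameter
  y moves the first equation freely; z moves the second, and y can undo its effect on the first,
  which is how (J2) yields surjectivity. The obstacle is that the count must be finite-dimensional
  while the zeros live in infinite dimensions. Bordering by as many functionals kappa as parameter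
  directions p makes zeros over a slice Lipschitz functions of m coordinates. Cells of side r number
  about r^(-m), each meets about eps^(1-m) values of a grid of mesh 3 eps r, while a cube holds
  about (eps r)^(-m) of them. As the dimensions agree, r cancels and a factor eps is left over; so
  slabs of width o(r), that is C^1, are enough. In general no functional eta is nonzero on all
  kernel vectors, so the normalization is chosen near each zero and nearby vectors are rescaled to
  it.\<close>

text \<open>The operator $(e,a) \mapsto De + \sum_{i \in I} a_i q_i$, bordered by the functionals
  $\kappa_k$, $k \in K$. Families of real numbers indexed by \<open>I\<close> are not a normed space in
  HOL, so the bordered operator is handled through this sum.\<close>

definition aug ::
  "('e::real_normed_vector \<Rightarrow>\<^sub>L 'f::real_normed_vector) \<Rightarrow> 'i set \<Rightarrow> ('i \<Rightarrow> 'f) \<Rightarrow> 'e \<Rightarrow> ('i \<Rightarrow> real) \<Rightarrow> 'f" where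
  "aug D I q e a = D e + (\<Sum>i\<in>I. a i *\<^sub>R q i)"

definition annihilated :: "'k set \<Rightarrow> ('k \<Rightarrow> 'e::real_normed_vector \<Rightarrow>\<^sub>L real) \<Rightarrow> 'e \<Rightarrow> bool" where
  "annihilated K \<kappa> e \<longleftrightarrow> (\<forall>k\<in>K. \<kappa> k e = 0)"

definition size_aug :: "'i set \<Rightarrow> 'e::real_normed_vector \<Rightarrow> ('i \<Rightarrow> real) \<Rightarrow> real" where
  "size_aug I e a = norm e + (\<Sum>i\<in>I. \<bar>a i\<bar>)"

lemma size_aug_nonneg: "0 \<le> size_aug I e a"
  by (simp add: size_aug_def sum_nonneg)

lemma size_aug_triangle: "size_aug I (e + e') (\<lambda>i. a i + a' i) \<le> size_aug I e a + size_aug I e' a'"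
proof -
  have "(\<Sum>i\<in>I. \<bar>a i + a' i\<bar>) \<le> (\<Sum>i\<in>I. \<bar>a i\<bar> + \<bar>a' i\<bar>)"
    by (intro sum_mono) auto
  then show ?thesis
    using norm_triangle_ineq[of e e'] by (simp add: size_aug_def sum.distrib)
qed

lemma size_aug_scale: "size_aug I (c *\<^sub>R e) (\<lambda>i. c * a i) = \<bar>c\<bar> * size_aug I e a"
  by (simp add: size_aug_def distrib_left abs_mult sum_distrib_left)

lemma norm_le_size_aug: "norm e \<le> size_aug I e a"
  by (simp add: size_aug_def sum_nonneg)

lemma coord_le_size_aug: "finite I \<Longrightarrow> i \<in> I \<Longrightarrow> \<bar>a i\<bar> \<le> size_aug I e a"
  using member_le_sum[of i I "\<lambda>i. \<bar>a i\<bar>"] norm_ge_zero[of e]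
  by (simp add: size_aug_def add_increasing)

lemma aug_add: "aug D I q (e + e') (\<lambda>i. a i + a' i) = aug D I q e a + aug D I q e' a'"
  by (simp add: aug_def blinfun.add_right scaleR_add_left sum.distrib)

lemma aug_diff: "aug D I q (e - e') (\<lambda>i. a i - a' i) = aug D I q e a - aug D I q e' a'"
  by (simp add: aug_def blinfun.diff_right scaleR_diff_left sum_subtractf)

lemma aug_scale: "aug D I q (c *\<^sub>R e) (\<lambda>i. c * a i) = c *\<^sub>R aug D I q e a"
  by (simp add: aug_def blinfun.scaleR_right scaleR_add_right scaleR_sum_right)

lemma annihilated_add: "annihilated K \<kappa> e \<Longrightarrow> annihilated K \<kappa> e' \<Longrightarrow> annihilated K \<kappa> (e + e')"
  by (simp add: annihilated_def blinfun.add_right)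

lemma annihilated_scale: "annihilated K \<kappa> e \<Longrightarrow> annihilated K \<kappa> (c *\<^sub>R e)"
  by (simp add: annihilated_def blinfun.scaleR_right)

text \<open>The successive-approximation step of the open mapping theorem.\<close>

lemma aug_approx_solve:
  fixes D :: "'e::banach \<Rightarrow>\<^sub>L 'f::real_normed_vector" and q :: "'i \<Rightarrow> 'f" and \<kappa> :: "'k \<Rightarrow> 'e \<Rightarrow>\<^sub>L real"
  assumes I: "finite I" and C: "0 \<le> C"
    and app: "\<And>y. \<exists>e a. size_aug I e a \<le> C * norm y \<and>
                  norm (y - aug D I q e a) \<le> norm y / 2 \<and> annihilated K \<kappa> e"
  shows "\<exists>e a. aug D I q e a = y \<and> size_aug I e a \<le> 2 * C * norm y \<and> annihilated K \<kappa> e"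
proof -
  obtain E A where EA: "\<And>y. size_aug I (E y) (A y) \<le> C * norm y"
      "\<And>y. norm (y - aug D I q (E y) (A y)) \<le> norm y / 2" "\<And>y. annihilated K \<kappa> (E y)"
    using app by metis
  define r where "r n = ((\<lambda>y. y - aug D I q (E y) (A y)) ^^ n) y" for n
  have r0: "r 0 = y" and rS: "r (Suc n) = r n - aug D I q (E (r n)) (A (r n))" for n
    by (auto simp: r_def)
  have rb: "norm (r n) \<le> norm y * (1/2)^n" for n
  proof (induction n)
    case (Suc n)
    then show ?case using EA(2)[of "r n"] by (simp add: rS)
  qed (simp add: r0)
  have sb: "size_aug I (E (r n)) (A (r n)) \<le> C * norm y * (1/2)^n" for n
    using EA(1)[of "r n"] mult_left_mono[OF rb C, of n] by (simp add: mult.assoc)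
  have geo: "(\<lambda>n. C * norm y * (1/2)^n) sums (C * norm y * 2)"
    using sums_mult[OF geometric_sums[of "1/2::real"], of "C * norm y"] by simp
  have sumE: "summable (\<lambda>n. norm (E (r n)))"
    by (rule summable_comparison_test'[OF sums_summable[OF geo], where N=0])
       (simp only: real_norm_def abs_norm_cancel, rule order_trans[OF norm_le_size_aug sb])
  have sumA: "summable (\<lambda>n. \<bar>A (r n) i\<bar>)" if "i \<in> I" for i
    by (rule summable_comparison_test'[OF sums_summable[OF geo], where N=0])
       (simp only: real_norm_def abs_idempotent, rule order_trans[OF coord_le_size_aug[OF I that] sb])
  define e where "e = (\<Sum>n. E (r n))"
  define a where "a i = (\<Sum>n. A (r n) i)" for i
  have e: "(\<lambda>n. E (r n)) sums e"
    unfolding e_def by (rule summable_sums[OF summable_norm_cancel[OF sumE]])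
  have a: "(\<lambda>n. A (r n) i) sums a i" if "i \<in> I" for i
    unfolding a_def by (rule summable_sums[OF summable_rabs_cancel[OF sumA[OF that]]])
  have "(\<lambda>n. aug D I q (E (r n)) (A (r n))) sums aug D I q e a"
    unfolding aug_def
    by (intro sums_add sums_sum bounded_linear.sums[OF bounded_linear_scaleR_left]
        bounded_linear.sums[OF blinfun.bounded_linear_right] e a)
  moreover have "(\<lambda>n. aug D I q (E (r n)) (A (r n))) sums y"
  proof -
    have "(\<lambda>n. norm (r n)) \<longlonglongrightarrow> 0"
    proof (rule tendsto_sandwich[where f="\<lambda>_. 0" and h="\<lambda>n. norm y * (1/2)^n"])
      have "(\<lambda>n. norm y * (1/2)^n) \<longlonglongrightarrow> norm y * 0"
        by (intro tendsto_mult tendsto_const LIMSEQ_realpow_zero) auto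
      then show "(\<lambda>n. norm y * (1/2)^n) \<longlonglongrightarrow> 0" by simp
    qed (use rb in auto)
    then have "r \<longlonglongrightarrow> 0" by (simp add: tendsto_norm_zero_iff)
    then have "(\<lambda>n. r n - r (Suc n)) sums (r 0 - 0)"
      by (rule telescope_sums')
    then show ?thesis by (simp add: rS r0)
  qed
  ultimately have "aug D I q e a = y" by (rule sums_unique2)
  moreover have "size_aug I e a \<le> C * norm y * 2"
  proof -
    have "norm e + (\<Sum>i\<in>I. \<bar>a i\<bar>) \<le> (\<Sum>n. norm (E (r n))) + (\<Sum>i\<in>I. \<Sum>n. \<bar>A (r n) i\<bar>)"
      unfolding e_def a_def by (intro add_mono sum_mono summable_norm sumE summable_rabs sumA)
    also have "\<dots> = (\<Sum>n. size_aug I (E (r n)) (A (r n)))"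
    proof -
      have "(\<lambda>n. size_aug I (E (r n)) (A (r n))) sums
        ((\<Sum>n. norm (E (r n))) + (\<Sum>i\<in>I. \<Sum>n. \<bar>A (r n) i\<bar>))"
        unfolding size_aug_def by (intro sums_add sums_sum summable_sums sumE sumA)
      then show ?thesis by (simp add: sums_iff)
    qed
    also have "\<dots> \<le> C * norm y * 2"
    proof (rule sums_le[OF sb summable_sums geo])
      show "summable (\<lambda>n. size_aug I (E (r n)) (A (r n)))"
        by (rule summable_comparison_test'[OF sums_summable[OF geo], where N=0])
           (simp only: real_norm_def abs_of_nonneg[OF size_aug_nonneg], rule sb)
    qed
    finally show ?thesis by (simp add: size_aug_def)
  qed
  moreover have "annihilated K \<kappa> e"
    unfolding annihilated_def
  proof
    fix k assume "k \<in> K"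
    then have "(\<lambda>n. \<kappa> k (E (r n))) = (\<lambda>n. 0)"
      using EA(3) by (auto simp: annihilated_def)
    moreover have "(\<lambda>n. \<kappa> k (E (r n))) sums \<kappa> k e"
      by (rule bounded_linear.sums[OF blinfun.bounded_linear_right e])
    ultimately show "\<kappa> k e = 0" using sums_unique2[of "\<lambda>n. 0" "\<kappa> k e" 0] sums_zero by simp
  qed
  ultimately show ?thesis by (auto simp: mult_ac)
qed

text \<open>Baire category: the images \<open>A n\<close> of size-bounded pairs exhaust the target,
  so the closure of one of them contains a ball. Differences of two of its points approximate every
  \<open>y\<close> to within half its norm at a cost proportional to \<open>norm y\<close>, and
  \<open>aug_approx_solve\<close> finishes.\<close>

lemma aug_open_mapping:
  fixes D :: "'e::banach \<Rightarrow>\<^sub>L 'f::banach" and q :: "'i \<Rightarrow> 'f" and \<kappa> :: "'k \<Rightarrow> 'e \<Rightarrow>\<^sub>L real"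
  assumes I: "finite I"
    and surj: "\<And>y. \<exists>e a. aug D I q e a = y \<and> annihilated K \<kappa> e"
  shows "\<exists>C>0. \<forall>y. \<exists>e a. aug D I q e a = y \<and> size_aug I e a \<le> C * norm y \<and> annihilated K \<kappa> e"
proof -
  define A where "A n = {aug D I q e a | e a. size_aug I e a \<le> real n \<and> annihilated K \<kappa> e}" for n
  have "\<exists>n. interior (closure (A n)) \<noteq> {}"
  proof (rule ccontr)
    assume "\<not> ?thesis"
    then have "euclidean interior_of \<Union>(range (\<lambda>n. closure (A n))) = {}"
      by (intro Baire_category_alt) (auto simp: completely_metrizable_space_euclidean)
    moreover have "y \<in> \<Union>(range (\<lambda>n. closure (A n)))" for y
    proof -
      obtain e a where "aug D I q e a = y" "annihilated K \<kappa> e" using surj by blast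
      moreover obtain n where "size_aug I e a \<le> real n" using real_arch_simple by blast
      ultimately have "y \<in> A n" by (auto simp: A_def)
      then show ?thesis using closure_subset by blast
    qed
    then have "\<Union>(range (\<lambda>n. closure (A n))) = UNIV" by blast
    ultimately show False by simp
  qed
  then obtain n y0 where "y0 \<in> interior (closure (A n))" by blast
  then obtain d where d: "d > 0" "cball y0 d \<subseteq> closure (A n)"
    by (meson mem_interior_cball)
  \<comment> \<open>A step of length \<open>d\<close> in the direction of \<open>y\<close> is nearly
    a difference of two elements of size at most \<open>n\<close>, whence \<open>2 * n / d\<close>;
    the added 1 keeps \<open>C\<close> positive when \<open>n = 0\<close>.\<close>
  define C where "C = 2 * real n / d + 1"
  have C: "C > 0" using d by (simp add: C_def add_nonneg_pos)
  have "\<exists>e a. size_aug I e a \<le> C * norm y \<and> norm (y - aug D I q e a) \<le> norm y / 2 \<and> annihilated K \<kappa> e"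
    for y :: 'f
  proof (cases "y = 0")
    case True
    then show ?thesis
      by (intro exI[of _ 0] exI[of _ "\<lambda>_. 0"])
         (simp add: size_aug_def aug_def annihilated_def blinfun.zero_right)
  next
    case False
    define s where "s = d / norm y"
    have s: "s > 0" using False d by (simp add: s_def)
    have "y0 + s *\<^sub>R y \<in> cball y0 d" "y0 \<in> cball y0 d"
      using d False by (auto simp: dist_norm s_def)
    then have *: "y0 + s *\<^sub>R y \<in> closure (A n)" "y0 \<in> closure (A n)" using d by blast+
    have "d / 4 > 0" using d by simp
    then obtain b1 b2 where b: "b1 \<in> A n" "dist b1 (y0 + s *\<^sub>R y) < d/4" "b2 \<in> A n" "dist b2 y0 < d/4"
      using * closure_approachable by meson
    then obtain e1 a1 e2 a2 where ea: "b1 = aug D I q e1 a1" "b2 = aug D I q e2 a2"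
      "size_aug I e1 a1 \<le> real n" "size_aug I e2 a2 \<le> real n" "annihilated K \<kappa> e1" "annihilated K \<kappa> e2"
      by (auto simp: A_def)
    define e where "e = (1/s) *\<^sub>R (e1 + (-1) *\<^sub>R e2)"
    define a where "a = (\<lambda>i. (1/s) * (a1 i + (-1) * a2 i))"
    have aug: "aug D I q e a = (1/s) *\<^sub>R (b1 - b2)"
      unfolding e_def a_def aug_scale aug_add by (simp add: ea)
    have "size_aug I e a \<le> (1/s) * (real n + real n)"
      unfolding e_def a_def size_aug_scale
      using size_aug_triangle[of I e1 "(-1) *\<^sub>R e2" a1 "\<lambda>i. (-1) * a2 i"] ea(3,4) s
      unfolding size_aug_scale by (simp add: divide_right_mono)
    also have "\<dots> = 2 * real n / d * norm y" by (simp add: s_def)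
    also have "\<dots> \<le> C * norm y" by (simp add: C_def algebra_simps)
    finally have 1: "size_aug I e a \<le> C * norm y" .
    have "y - aug D I q e a = (1/s) *\<^sub>R ((y0 + s *\<^sub>R y - b1) - (y0 - b2))"
      using s by (simp add: aug algebra_simps)
    also have "norm \<dots> = (1/s) * norm ((y0 + s *\<^sub>R y - b1) - (y0 - b2))"
      using s by simp
    also have "norm ((y0 + s *\<^sub>R y - b1) - (y0 - b2)) \<le> norm (y0 + s *\<^sub>R y - b1) + norm (y0 - b2)"
      by (rule norm_triangle_ineq4)
    also have "\<dots> \<le> d/4 + d/4"
      using b by (intro add_mono) (simp_all add: dist_norm norm_minus_commute)
    finally have "norm (y - aug D I q e a) \<le> (1/s) * (d/4 + d/4)"
      using s by (simp add: mult_left_mono divide_right_mono)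
    also have "\<dots> = norm y / 2" using d False by (simp add: s_def)
    finally have 2: "norm (y - aug D I q e a) \<le> norm y / 2" .
    have "annihilated K \<kappa> e"
      unfolding e_def by (intro annihilated_scale annihilated_add ea)
    with 1 2 show ?thesis by blast
  qed
  from aug_approx_solve[OF I less_imp_le[OF C] this]
  show ?thesis using C by (intro exI[of _ "2 * C"]) auto
qed

text \<open>Quantitative invertibility of the bordered operator that sends \<open>(e, a)\<close> to
  \<open>aug D I q e a\<close> together with the numbers \<open>\<kappa> k e\<close>. Surjectivity
  is recorded only over \<kappa> = 0; vectors dual to \<kappa>, where available, supply the
  rest.\<close>

definition aug_iso ::
  "real \<Rightarrow> ('e::real_normed_vector \<Rightarrow>\<^sub>L 'f::real_normed_vector) \<Rightarrow> 'i set \<Rightarrow> ('i \<Rightarrow> 'f) \<Rightarrow>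
    'k set \<Rightarrow> ('k \<Rightarrow> 'e \<Rightarrow>\<^sub>L real) \<Rightarrow> bool" where
  "aug_iso C D I q K \<kappa> \<longleftrightarrow>
     (\<forall>e a. size_aug I e a \<le> C * (norm (aug D I q e a) + (\<Sum>k\<in>K. \<bar>\<kappa> k e\<bar>))) \<and>
     (\<forall>y. \<exists>e a. aug D I q e a = y \<and> annihilated K \<kappa> e)"

lemma aug_iso_bound:
  "aug_iso C D I q K \<kappa> \<Longrightarrow> size_aug I e a \<le> C * (norm (aug D I q e a) + (\<Sum>k\<in>K. \<bar>\<kappa> k e\<bar>))"
  by (simp add: aug_iso_def)

lemma aug_iso_solve:
  assumes "aug_iso C D I q K \<kappa>"
  obtains e a where "aug D I q e a = y" "annihilated K \<kappa> e" "size_aug I e a \<le> C * norm y"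
proof -
  obtain e a where *: "aug D I q e a = y" "annihilated K \<kappa> e"
    using assms unfolding aug_iso_def by blast
  moreover from *(2) have "(\<Sum>k\<in>K. \<bar>\<kappa> k e\<bar>) = 0"
    by (simp add: annihilated_def)
  ultimately show thesis using that aug_iso_bound[OF assms, of e a] by simp
qed

text \<open>Subtract from \<open>e\<close> the combination \<open>w\<close> of the dual vectors with
  the same \<kappa>-values; for the remainder, injectivity identifies \<open>(e - w, a)\<close> with
  the bounded solution from the open mapping theorem.\<close>

lemma aug_isoI:
  fixes D :: "'e::banach \<Rightarrow>\<^sub>L 'f::banach" and q :: "'i \<Rightarrow> 'f" and \<kappa> :: "'k \<Rightarrow> 'e \<Rightarrow>\<^sub>L real"
  assumes I: "finite I" and K: "finite K"
    and dual: "\<And>k l. k \<in> K \<Longrightarrow> l \<in> K \<Longrightarrow> \<kappa> k (u l) = (if k = l then 1 else 0)"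
    and surj: "\<And>y. \<exists>e a. aug D I q e a = y \<and> annihilated K \<kappa> e"
    and inj: "\<And>e a. aug D I q e a = 0 \<Longrightarrow> annihilated K \<kappa> e \<Longrightarrow> e = 0 \<and> (\<forall>i\<in>I. a i = 0)"
  shows "\<exists>C>0. aug_iso C D I q K \<kappa>"
proof -
  obtain C where C: "C > 0" and sol: "\<And>y. \<exists>e a. aug D I q e a = y \<and> size_aug I e a \<le> C * norm y \<and> annihilated K \<kappa> e"
    using aug_open_mapping[OF I surj] by blast
  \<comment> \<open>\<open>U\<close> is the price of subtracting \<open>w\<close>, per unit of the
    sum of the absolute values of \<open>\<kappa> k e\<close>: the norm of \<open>w\<close>, plus
    \<open>C\<close> times the change \<open>D w\<close> of the right-hand side.\<close>
  define U where "U = (\<Sum>k\<in>K. norm (u k)) + C * (\<Sum>k\<in>K. norm (D (u k)))"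
  have bound: "size_aug I e a \<le> (C + U) * (norm (aug D I q e a) + (\<Sum>k\<in>K. \<bar>\<kappa> k e\<bar>))" for e a
  proof -
    define S where "S = (\<Sum>k\<in>K. \<bar>\<kappa> k e\<bar>)"
    define w where "w = (\<Sum>k\<in>K. \<kappa> k e *\<^sub>R u k)"
    have le: "\<bar>\<kappa> k e\<bar> \<le> S" if "k \<in> K" for k
      unfolding S_def using member_le_sum[OF that, of "\<lambda>k. \<bar>\<kappa> k e\<bar>"] K by simp
    have S: "S \<ge> 0" by (simp add: S_def sum_nonneg)
    have ann: "annihilated K \<kappa> (e - w)"
      using K by (simp add: annihilated_def w_def blinfun.diff_right blinfun.sum_right
          blinfun.scaleR_right dual if_distrib sum.delta cong: if_cong sum.cong)
    obtain e' a' where ea: "aug D I q e' a' = aug D I q (e - w) a" 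
       "size_aug I e' a' \<le> C * norm (aug D I q (e - w) a)" "annihilated K \<kappa> e'" using sol by blast
    have "aug D I q ((e - w) - e') (\<lambda>i. a i - a' i) = 0" by (simp only: aug_diff ea) simp
    moreover have "annihilated K \<kappa> ((e - w) - e')"
      using ann ea by (simp add: annihilated_def blinfun.diff_right)
    ultimately have "(e - w) - e' = 0 \<and> (\<forall>i\<in>I. a i - a' i = 0)" by (rule inj)
    then have "size_aug I e' a' = size_aug I (e - w) a"
      by (simp add: size_aug_def)
    then have 1: "size_aug I (e - w) a \<le> C * norm (aug D I q (e - w) a)" using ea by simp
    have w: "norm w \<le> S * (\<Sum>k\<in>K. norm (u k))"
      unfolding w_def sum_distrib_left
      by (rule sum_norm_le) (use le in \<open>auto intro!: mult_right_mono\<close>)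
    have Dw: "norm (D w) \<le> S * (\<Sum>k\<in>K. norm (D (u k)))"
      unfolding w_def sum_distrib_left blinfun.sum_right blinfun.scaleR_right
      by (rule sum_norm_le) (use le in \<open>auto intro!: mult_right_mono\<close>)
    have "aug D I q (e - w) a = aug D I q e a - D w"
      by (simp add: aug_def blinfun.diff_right)
    then have "norm (aug D I q (e - w) a) \<le> norm (aug D I q e a) + S * (\<Sum>k\<in>K. norm (D (u k)))"
      using norm_triangle_ineq4[of "aug D I q e a" "D w"] Dw by simp
    then have 2: "C * norm (aug D I q (e - w) a) \<le> C * (norm (aug D I q e a) + S * (\<Sum>k\<in>K. norm (D (u k))))"
      using C by simp
    have "size_aug I e a \<le> norm w + size_aug I (e - w) a"
      using norm_triangle_ineq[of w "e - w"] by (simp add: size_aug_def)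
    also have "\<dots> \<le> C * norm (aug D I q e a) + S * U"
      using w 1 2 by (simp add: U_def algebra_simps)
    also have "\<dots> \<le> (C + U) * (norm (aug D I q e a) + S)"
    proof -
      have "U \<ge> 0" using C by (auto simp: U_def intro!: add_nonneg_nonneg mult_nonneg_nonneg sum_nonneg)
      then have "0 \<le> U * norm (aug D I q e a)" "0 \<le> C * S" using C S by auto
      then show ?thesis by (simp add: algebra_simps)
    qed
    finally show ?thesis unfolding S_def .
  qed
  have "U \<ge> 0" using C by (auto simp: U_def intro!: add_nonneg_nonneg mult_nonneg_nonneg sum_nonneg)
  then show ?thesis
    using C bound surj by (intro exI[of _ "C + U"]) (auto simp: aug_iso_def)
qed

text \<open>The perturbation is absorbed twice: it costs half the size in the lower bound, and it
  leaves at most half the residual for \<open>aug_approx_solve\<close>. As \<kappa> is not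
  perturbed, the constraint \<open>annihilated\<close> is the same for both operators.\<close>

lemma aug_iso_perturb:
  fixes D :: "'e::banach \<Rightarrow>\<^sub>L 'f::real_normed_vector" and q :: "'i \<Rightarrow> 'f" and \<kappa> :: "'k \<Rightarrow> 'e \<Rightarrow>\<^sub>L real"
  assumes I: "finite I" and C: "C > 0" and iso: "aug_iso C D I q K \<kappa>"
    and close: "\<And>e a. norm (aug D' I q' e a - aug D I q e a) \<le> \<eta> * size_aug I e a"
    and \<eta>: "\<eta> * C \<le> 1/2"
  shows "aug_iso (2 * C) D' I q' K \<kappa>"
  unfolding aug_iso_def
proof (intro conjI allI)
  fix e and a :: "'i \<Rightarrow> real"
  have "norm (aug D I q e a) \<le> norm (aug D' I q' e a) + \<eta> * size_aug I e a"
    using close[of e a] norm_triangle_ineq2[of "aug D I q e a" "aug D' I q' e a"]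
    by (simp add: norm_minus_commute)
  then have "C * (norm (aug D I q e a) + (\<Sum>k\<in>K. \<bar>\<kappa> k e\<bar>)) \<le>
      C * (norm (aug D' I q' e a) + \<eta> * size_aug I e a + (\<Sum>k\<in>K. \<bar>\<kappa> k e\<bar>))"
    using C by simp
  then have "size_aug I e a \<le> C * (norm (aug D' I q' e a) + (\<Sum>k\<in>K. \<bar>\<kappa> k e\<bar>)) + (\<eta> * C) * size_aug I e a"
    using aug_iso_bound[OF iso, of e a] by (simp add: algebra_simps)
  moreover have "(\<eta> * C) * size_aug I e a \<le> 1/2 * size_aug I e a"
    using \<eta> size_aug_nonneg by (intro mult_right_mono) auto
  ultimately show "size_aug I e a \<le> 2 * C * (norm (aug D' I q' e a) + (\<Sum>k\<in>K. \<bar>\<kappa> k e\<bar>))"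
    by (simp add: algebra_simps)
next
  have app: "\<exists>e a. size_aug I e a \<le> C * norm y \<and> norm (y - aug D' I q' e a) \<le> norm y / 2 \<and> annihilated K \<kappa> e" for y
  proof -
    obtain e a where ea: "aug D I q e a = y" "annihilated K \<kappa> e" "size_aug I e a \<le> C * norm y"
      using aug_iso_solve[OF iso] by blast
    have "norm (aug D' I q' e a - y) \<le> \<eta> * size_aug I e a" using close[of e a] ea by simp
    also have "\<dots> \<le> norm y / 2"
    proof (cases "\<eta> \<ge> 0")
      case True
      then have "\<eta> * size_aug I e a \<le> \<eta> * (C * norm y)" using ea by (intro mult_left_mono)
      also have "\<dots> = (\<eta> * C) * norm y" by simp
      also have "\<dots> \<le> 1/2 * norm y" using \<eta> by (intro mult_right_mono) auto
      finally show ?thesis by simp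
    next
      case False
      then have "\<eta> * size_aug I e a \<le> 0" using size_aug_nonneg by (simp add: mult_le_0_iff)
      then show ?thesis using norm_ge_zero[of y] by linarith
    qed
    finally show ?thesis using ea by (auto simp: norm_minus_commute)
  qed
  show "\<exists>e a. aug D' I q' e a = y \<and> annihilated K \<kappa> e" for y
    using aug_approx_solve[OF I less_imp_le[OF C] app] by blast
qed

lemma surj_open_mapping:
  fixes D :: "'e::banach \<Rightarrow>\<^sub>L 'f::banach"
  assumes "surj D"
  shows "\<exists>C>0. \<forall>y. \<exists>e. D e = y \<and> norm e \<le> C * norm y"
proof -
  have "\<exists>e a. aug D {} (\<lambda>_. 0) e a = y \<and> annihilated {} (\<lambda>_. 0) e" for y
    using surjD[OF assms, of y] by (auto simp: aug_def annihilated_def)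
  from aug_open_mapping[OF _ this] show ?thesis
    by (auto simp: aug_def annihilated_def size_aug_def)
qed

text \<open>A bounded solution for \<open>D\<close> is an approximate solution for
  \<open>D'\<close>, so the halving argument works without injectivity. It makes non-surjectivity a
  closed condition, as used in \<open>closed_Crit\<close>.\<close>

lemma surj_perturb:
  fixes D :: "'e::banach \<Rightarrow>\<^sub>L 'f::banach"
  assumes "surj D"
  shows "\<exists>\<delta>>0. \<forall>D'. norm (D' - D) < \<delta> \<longrightarrow> surj (blinfun_apply D')"
proof -
  obtain C where C: "C > 0" and sol: "\<And>y. \<exists>e. D e = y \<and> norm e \<le> C * norm y"
    using surj_open_mapping[OF assms] by blast
  have "surj (blinfun_apply D')" if "norm (D' - D) < 1 / (2 * C)" for D'
  proof -
    have "\<exists>e a. size_aug {} e a \<le> C * norm y \<and>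
       norm (y - aug D' {} (\<lambda>_. 0) e a) \<le> norm y / 2 \<and> annihilated {} (\<lambda>_. 0) e" for y
    proof -
      obtain e where e: "D e = y" "norm e \<le> C * norm y" using sol by blast
      have "norm (D' e - D e) \<le> norm (D' - D) * norm e"
        using norm_blinfun[of "D' - D" e] by (simp add: blinfun.diff_left)
      also have "\<dots> \<le> 1 / (2 * C) * (C * norm y)" using that e C by (intro mult_mono) auto
      finally show ?thesis using e C
        by (auto simp: aug_def annihilated_def size_aug_def norm_minus_commute)
    qed
    from aug_approx_solve[OF finite.emptyI less_imp_le[OF C] this]
    have "\<exists>x. D' x = y" for y by (force simp: aug_def)
    then show ?thesis unfolding surj_def by metis
  qed
  then show ?thesis using C by (intro exI[of _ "1 / (2 * C)"]) auto
qed

subsection \<open>Continuous linear functionals\<close>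

definition sublinear :: "('a::real_vector \<Rightarrow> real) \<Rightarrow> bool" where
  "sublinear p \<longleftrightarrow> (\<forall>x y. p (x + y) \<le> p x + p y) \<and> (\<forall>c\<ge>0. \<forall>x. p (c *\<^sub>R x) = c * p x)"

lemma sublinear_add: "sublinear p \<Longrightarrow> p (x + y) \<le> p x + p y"
  and sublinear_scale: "sublinear p \<Longrightarrow> 0 \<le> c \<Longrightarrow> p (c *\<^sub>R x) = c * p x"
  by (auto simp: sublinear_def)

lemma sublinear_zero: "sublinear p \<Longrightarrow> p 0 = 0"
  using sublinear_scale[of p 0 0] by simp

lemma sublinear_minus: "sublinear p \<Longrightarrow> - p (- x) \<le> p x"
  using sublinear_add[of p x "- x"] sublinear_zero[of p] by simp

lemma sublinear_norm: "sublinear (norm :: 'a::real_normed_vector \<Rightarrow> real)"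
  by (simp add: sublinear_def norm_triangle_ineq)

text \<open>\<open>q x\<close> is the infimum of \<open>p (x + s u) - s p u\<close> over s \<ge> 0;
  taking \<open>s = 1\<close> at \<open>x = - u\<close> gives the last inequality. If
  \<open>p\<close> is minimal then \<open>q = p\<close>, and that inequality makes \<open>p\<close>
  odd.\<close>

lemma sublinear_reduce:
  assumes p: "sublinear p"
  obtains q where "sublinear q" "\<And>x. q x \<le> p x" "q (- u) \<le> - p u"
proof -
  define S where "S x = (\<lambda>s. p (x + s *\<^sub>R u) - s * p u) ` {0..}" for x
  define q where "q x = Inf (S x)" for x
  have ne: "S x \<noteq> {}" for x by (auto simp: S_def)
  have lower: "- p (- x) \<le> r" if "r \<in> S x" for r x
  proof -
    obtain s where s: "s \<ge> 0" "r = p (x + s *\<^sub>R u) - s * p u" using \<open>r \<in> S x\<close> by (auto simp: S_def)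
    have "s * p u \<le> p (x + s *\<^sub>R u) + p (- x)"
      using sublinear_add[OF p, of "x + s *\<^sub>R u" "- x"] s sublinear_scale[OF p, of s u] by simp
    then show ?thesis using s by simp
  qed
  have bdd: "bdd_below (S x)" for x using lower by (meson bdd_belowI)
  have qle: "q x \<le> p (x + s *\<^sub>R u) - s * p u" if "s \<ge> 0" for x s
    unfolding q_def using bdd that by (intro cInf_lower) (auto simp: S_def)
  have glb: "m \<le> q x" if "\<And>s. s \<ge> 0 \<Longrightarrow> m \<le> p (x + s *\<^sub>R u) - s * p u" for m x
    unfolding q_def using that by (intro cInf_greatest ne) (auto simp: S_def)
  have "q (x + y) \<le> q x + q y" for x y
  proof -
    have "q (x + y) - (p (y + t *\<^sub>R u) - t * p u) \<le> q x" if t: "t \<ge> 0" for t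
    proof (rule glb)
      fix s :: real assume s: "s \<ge> 0"
      have "q (x + y) \<le> p ((x + y) + (s + t) *\<^sub>R u) - (s + t) * p u" using s t by (intro qle) simp
      also have "(x + y) + (s + t) *\<^sub>R u = (x + s *\<^sub>R u) + (y + t *\<^sub>R u)" by (simp add: algebra_simps)
      also have "p \<dots> \<le> p (x + s *\<^sub>R u) + p (y + t *\<^sub>R u)" by (rule sublinear_add[OF p])
      finally show "q (x + y) - (p (y + t *\<^sub>R u) - t * p u) \<le> p (x + s *\<^sub>R u) - s * p u"
        by (simp add: algebra_simps)
    qed
    then have "q (x + y) - q x \<le> q y" by (intro glb) (simp add: algebra_simps)
    then show ?thesis by simp
  qed
  moreover have "q (c *\<^sub>R x) = c * q x" if "c \<ge> 0" for c x
  proof -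
    have le: "q (c *\<^sub>R x) \<le> c * q x" if c: "c > 0" for c x
    proof -
      have "q (c *\<^sub>R x) / c \<le> q x"
      proof (rule glb)
        fix s :: real assume s: "s \<ge> 0"
        have "q (c *\<^sub>R x) \<le> p (c *\<^sub>R x + (c * s) *\<^sub>R u) - (c * s) * p u" using s c by (intro qle) simp
        also have "c *\<^sub>R x + (c * s) *\<^sub>R u = c *\<^sub>R (x + s *\<^sub>R u)" by (simp add: algebra_simps)
        also have "p \<dots> = c * p (x + s *\<^sub>R u)" using c by (simp add: sublinear_scale[OF p])
        finally have "q (c *\<^sub>R x) \<le> c * (p (x + s *\<^sub>R u) - s * p u)" by (simp add: algebra_simps)
        then show "q (c *\<^sub>R x) / c \<le> p (x + s *\<^sub>R u) - s * p u" using c by (simp add: field_simps)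
      qed
      then show ?thesis using c by (simp add: field_simps)
    qed
    have "q 0 = 0"
    proof (rule antisym)
      show "q 0 \<le> 0" using qle[of 0 0] sublinear_zero[OF p] by simp
      show "0 \<le> q 0" by (rule glb) (simp add: sublinear_scale[OF p])
    qed
    moreover have "c * q x \<le> q (c *\<^sub>R x)" if c: "c > 0"
      using le[of "1/c" "c *\<^sub>R x"] c by (simp add: field_simps)
    ultimately show ?thesis using le[of c x] \<open>c \<ge> 0\<close> by (cases "c = 0") (auto intro: antisym)
  qed
  ultimately have "sublinear q" by (simp add: sublinear_def)
  moreover have "q x \<le> p x" for x using qle[of 0 x] by simp
  moreover have "q (- u) \<le> - p u" using qle[of 1 "- u"] sublinear_zero[OF p] by simp
  ultimately show thesis by (rule that)
qed

text \<open>The bound that Zorn's lemma asks for. Subadditivity passes to the infimum because two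
  members of a chain have a common lower member; \<open>- p (- x)\<close> keeps the infimum
  finite.\<close>

lemma sublinear_Inf_chain:
  assumes ne: "C \<noteq> {}" and sub: "\<And>q. q \<in> C \<Longrightarrow> sublinear q" and le: "\<And>q x. q \<in> C \<Longrightarrow> q x \<le> p x"
    and chain: "\<And>q r. q \<in> C \<Longrightarrow> r \<in> C \<Longrightarrow> q \<le> r \<or> r \<le> q"
  shows "sublinear (\<lambda>x. INF q\<in>C. q x)" "\<And>q x. q \<in> C \<Longrightarrow> (INF q\<in>C. q x) \<le> q x"
proof -
  have bdd: "bdd_below ((\<lambda>q. q x) ` C)" for x
  proof (intro bdd_belowI2)
    fix q assume "q \<in> C"
    then show "- p (- x) \<le> q x" using sublinear_minus[OF sub, of q x] le[of q "- x"] by simp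
  qed
  show low: "(INF q\<in>C. q x) \<le> q x" if "q \<in> C" for q x
    using bdd that by (rule cINF_lower)
  have "(INF q\<in>C. q (x + y)) \<le> (INF q\<in>C. q x) + (INF q\<in>C. q y)" for x y
  proof -
    have "(INF q\<in>C. q (x + y)) \<le> q x + r y" if qr: "q \<in> C" "r \<in> C" for q r
    proof -
      obtain m where m: "m \<in> C" "m \<le> q" "m \<le> r" using chain[OF qr] qr by blast
      then have "m (x + y) \<le> q x + r y"
        using sublinear_add[OF sub[OF m(1)], of x y] m by (meson add_mono le_funD order_trans)
      then show ?thesis using low[OF m(1), of "x + y"] by simp
    qed
    then have "(INF q\<in>C. q (x + y)) - r y \<le> (INF q\<in>C. q x)" if "r \<in> C" for r
      using that ne by (intro cINF_greatest) (auto simp: algebra_simps)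
    then have "(INF q\<in>C. q (x + y)) - (INF q\<in>C. q x) \<le> (INF q\<in>C. q y)"
      using ne by (intro cINF_greatest) (auto simp: algebra_simps)
    then show ?thesis by simp
  qed
  moreover have "(INF q\<in>C. q (c *\<^sub>R x)) = c * (INF q\<in>C. q x)" if "c \<ge> 0" for c x
  proof (cases "c = 0")
    case True
    have "(INF q\<in>C. q (0::'a)) = (INF q\<in>C. (0::real))"
      by (intro INF_cong) (auto simp: sublinear_zero sub)
    then show ?thesis using True ne by simp
  next
    case False
    then have c: "c > 0" using that by simp
    have "(INF q\<in>C. q (c *\<^sub>R x)) = (INF q\<in>C. c * q x)"
      using that by (intro INF_cong) (auto simp: sublinear_scale sub)
    also have "\<dots> = c * (INF q\<in>C. q x)"
    proof (rule antisym)
      have "(INF q\<in>C. c * q x) / c \<le> (INF q\<in>C. q x)"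
      proof (rule cINF_greatest[OF ne])
        fix q assume q: "q \<in> C"
        have "bdd_below ((\<lambda>q. c * q x) ` C)"
        proof (intro bdd_belowI2)
          fix q assume "q \<in> C"
          then show "c * (INF q\<in>C. q x) \<le> c * q x" using low c by simp
        qed
        then have "(INF q\<in>C. c * q x) \<le> c * q x" using q by (rule cINF_lower)
        then show "(INF q\<in>C. c * q x) / c \<le> q x" using c by (simp add: field_simps)
      qed
      then show "(INF q\<in>C. c * q x) \<le> c * (INF q\<in>C. q x)" using c by (simp add: field_simps)
      show "c * (INF q\<in>C. q x) \<le> (INF q\<in>C. c * q x)"
        using low c by (intro cINF_greatest[OF ne]) simp
    qed
    finally show ?thesis .
  qed
  ultimately show "sublinear (\<lambda>x. INF q\<in>C. q x)" by (simp add: sublinear_def)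
qed

text \<open>A minimal sublinear functional is linear, because otherwise \<open>sublinear_reduce\<close> would
  make it smaller.\<close>

lemma linear_below_sublinear:
  assumes p: "sublinear p"
  obtains l where "linear l" "\<And>x. l x \<le> p x"
proof -
  define A where "A = {q. sublinear q \<and> q \<le> p}"
  \<comment> \<open>Zorn's lemma is applied to the reversed order, so that upper bounds of chains
    are pointwise infima.\<close>
  have "\<exists>m\<in>A. \<forall>q\<in>A. m \<ge> q \<longrightarrow> q = m"
  proof (rule predicate_Zorn)
    show "partial_order_on A (relation_of (\<ge>) A)"
      by (auto simp: partial_order_on_def preorder_on_def relation_of_def refl_on_def trans_def antisym_def)
    fix C assume C: "C \<in> Chains (relation_of (\<ge>) A)"
    then have CA: "C \<subseteq> A" and ch: "\<And>q r. q \<in> C \<Longrightarrow> r \<in> C \<Longrightarrow> q \<le> r \<or> r \<le> q"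
      by (auto simp: Chains_def relation_of_def)
    show "\<exists>u\<in>A. \<forall>a\<in>C. a \<ge> u"
    proof (cases "C = {}")
      case True
      then show ?thesis using p by (auto simp: A_def)
    next
      case False
      have sub: "\<And>q. q \<in> C \<Longrightarrow> sublinear q" and le: "\<And>q x. q \<in> C \<Longrightarrow> q x \<le> p x"
        using CA by (auto simp: A_def le_fun_def)
      let ?u = "\<lambda>x. INF q\<in>C. q x"
      have u: "sublinear ?u" "\<And>q x. q \<in> C \<Longrightarrow> ?u x \<le> q x"
        using sublinear_Inf_chain[of C p] False sub le ch by blast+
      obtain q where q: "q \<in> C" using False by blast
      have "?u \<le> p" using u(2)[OF q] le[OF q] by (auto simp: le_fun_def intro: order_trans)
      then show ?thesis using u by (intro bexI[of _ ?u]) (auto simp: A_def le_fun_def)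
    qed
  qed
  then obtain m where m: "sublinear m" "m \<le> p" and mini: "\<And>q. sublinear q \<Longrightarrow> q \<le> m \<Longrightarrow> q = m"
    by (auto simp: A_def intro: order_trans)
  have odd: "m (- u) = - m u" for u
  proof -
    obtain q where q: "sublinear q" "\<And>x. q x \<le> m x" "q (- u) \<le> - m u"
      using sublinear_reduce[OF m(1)] by metis
    then have "q = m" by (intro mini) (auto simp: le_fun_def)
    then show ?thesis using q(3) sublinear_minus[OF m(1), of u] by simp
  qed
  have "linear m"
  proof (rule linearI)
    fix x y
    show "m (x + y) = m x + m y"
      using sublinear_add[OF m(1), of x y] sublinear_add[OF m(1), of "x + y" "- y"] by (simp add: odd)
  next
    fix c x
    show "m (c *\<^sub>R x) = c *\<^sub>R m x"
    proof (cases "c \<ge> 0")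
      case False
      have "m (c *\<^sub>R x) = - m ((- c) *\<^sub>R x)" using odd[of "(- c) *\<^sub>R x"] by simp
      then show ?thesis using False sublinear_scale[OF m(1), of "- c" x] by simp
    qed (simp add: sublinear_scale[OF m(1)])
  qed
  then show thesis using m(2) by (intro that[of m]) (auto simp: le_fun_def)
qed

text \<open>Reducing the norm in the direction of \<open>u\<close> first forces every linear
  \<open>l\<close> below the result to satisfy \<open>l u\<close> \<ge> \<open>norm u\<close>; being
  below the norm, \<open>l\<close> is also bounded.\<close>

lemma separating_functional:
  fixes u :: "'a::real_normed_vector"
  assumes "u \<noteq> 0"
  obtains l :: "'a \<Rightarrow>\<^sub>L real" where "l u \<noteq> 0"
proof -
  obtain q where q: "sublinear q" "\<And>x. q x \<le> norm x" "q (- u) \<le> - norm u"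
    using sublinear_reduce[OF sublinear_norm, of u] by metis
  obtain l where l: "linear l" "\<And>x. l x \<le> q x" using linear_below_sublinear[OF q(1)] by metis
  have "bounded_linear l"
  proof (intro bounded_linear_intro[where K=1])
    fix x
    have "l x \<le> norm x" "- l x \<le> norm x"
      using l(2)[of x] q(2)[of x] l(2)[of "- x"] q(2)[of "- x"] by (simp_all add: linear_neg[OF l(1)])
    then show "norm (l x) \<le> norm x * 1" by simp
  qed (auto simp: linear_add[OF l(1)] linear_scale[OF l(1)])
  moreover have "l u \<noteq> 0"
  proof -
    have "norm u \<le> l u" using l(2)[of "- u"] q(3) by (simp add: linear_neg[OF l(1)])
    then show ?thesis using assms by auto
  qed
  ultimately show thesis using that[of "Blinfun l"] by (simp add: bounded_linear_Blinfun_apply)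
qed

text \<open>With \<open>P\<close> the projection onto \<open>span B\<close> given by the old
  functionals, a functional nonzero at \<open>v - P v\<close> is composed with the identity minus
  \<open>P\<close>, which kills \<open>B\<close>. The old functionals are then corrected by
  multiples of the new one so as to vanish at \<open>v\<close>.\<close>

lemma dual_functionals:
  fixes B :: "'a::real_normed_vector set"
  assumes "finite B" "independent B"
  shows "\<exists>\<beta> :: 'a \<Rightarrow> 'a \<Rightarrow>\<^sub>L real. \<forall>b\<in>B. \<forall>c\<in>B. \<beta> b c = (if b = c then 1 else 0)"
  using assms
proof (induction B)
  case (insert v B)
  then obtain \<beta> :: "'a \<Rightarrow> 'a \<Rightarrow>\<^sub>L real" where \<beta>: "\<And>b c. b \<in> B \<Longrightarrow> c \<in> B \<Longrightarrow> \<beta> b c = (if b = c then 1 else 0)"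
    by (metis independent_insert)
  define P where "P = (\<lambda>x. \<Sum>b\<in>B. \<beta> b x *\<^sub>R b)"
  have P: "bounded_linear P"
    unfolding P_def
    by (intro bounded_linear_sum bounded_linear_compose[OF bounded_linear_scaleR_left] blinfun.bounded_linear_right)
  have Pc: "P c = c" if "c \<in> B" for c
  proof -
    have "P c = (\<Sum>b\<in>B. if b = c then b else 0)"
      unfolding P_def by (rule sum.cong) (auto simp: \<beta> that)
    then show ?thesis using insert that by simp
  qed
  have "v \<notin> span B" using insert.hyps insert.prems by (simp add: independent_insert)
  moreover have "P v \<in> span B" unfolding P_def by (intro span_sum span_scale span_base)
  ultimately have "v - P v \<noteq> 0" by auto
  then obtain l0 :: "'a \<Rightarrow>\<^sub>L real" where l0: "l0 (v - P v) \<noteq> 0" by (rule separating_functional)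
  define l where "l = (1 / l0 (v - P v)) *\<^sub>R (l0 - (l0 o\<^sub>L Blinfun P))"
  have l: "l x = (l0 x - l0 (P x)) / l0 (v - P v)" for x
    by (simp add: l_def blinfun.scaleR_left blinfun.diff_left bounded_linear_Blinfun_apply[OF P])
  have lv: "l v = 1" using l0 by (simp add: l blinfun.diff_right)
  have lb: "l b = 0" if "b \<in> B" for b using that by (simp add: l Pc)
  define \<gamma> where "\<gamma> = (\<lambda>b. if b = v then l else \<beta> b - \<beta> b v *\<^sub>R l)"
  have "\<gamma> b c = (if b = c then 1 else 0)" if "b \<in> insert v B" "c \<in> insert v B" for b c
    using that insert.hyps
    by (auto simp: \<gamma>_def lv lb \<beta> blinfun.diff_left blinfun.scaleR_left)
  then show ?case by blast
qed auto

subsection \<open>The Fredholm index\<close>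

lemma rank_nullity:
  fixes f :: "'a::real_vector \<Rightarrow> 'b::real_vector"
  assumes f: "linear f" and V: "subspace V" "fin_dim V"
  shows "dim V = dim {x \<in> V. f x = 0} + dim (f ` V)"
proof -
  define N where "N = {x \<in> V. f x = 0}"
  obtain S where S: "finite S" "span S = V" using V by (auto simp: fin_dim_def)
  have N: "subspace N"
    using V(1) f unfolding N_def subspace_def by (auto simp: linear_0 linear_add linear_scale)
  obtain B0 where B0: "B0 \<subseteq> N" "independent B0" "N \<subseteq> span B0" "card B0 = dim N"
    by (rule basis_exists)
  have "B0 \<subseteq> V" using B0 by (auto simp: N_def)
  then obtain B where B: "B0 \<subseteq> B" "B \<subseteq> V" "independent B" "V \<subseteq> span B"
    by (rule maximal_independent_subset_extend[OF _ B0(2)])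
  have finB: "finite B" using independent_span_bound[OF S(1) B(3)] B S by auto
  have dimV: "dim V = card B" using basis_card_eq_dim[OF B(2,4,3)] by simp
  \<comment> \<open>\<open>g\<close> kills \<open>B0\<close> and fixes the other basis vectors, so
    \<open>span B0\<close> and \<open>span (B - B0)\<close> meet only in 0; hence \<open>f\<close>
    is injective on the latter.\<close>
  obtain g where g: "linear g" "\<And>x. x \<in> B \<Longrightarrow> g x = (if x \<in> B0 then 0 else x)"
    using linear_independent_extend[OF B(3), of "\<lambda>x. if x \<in> B0 then 0 else x"] by auto
  have g0: "g x = 0" if "x \<in> span B0" for x
    using that by (rule linear_eq_0_on_span[OF g(1), rotated]) (use g B in auto)
  have g1: "g x = x" if "x \<in> span (B - B0)" for x
    using that by (rule linear_eq_on_span[OF g(1) linear_ident, rotated]) (use g in auto)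
  have "span (B - B0) \<subseteq> V" using B V(1) by (intro span_minimal) auto
  then have "x = 0" if "x \<in> span (B - B0)" "f x = 0" for x
    using that g0[of x] g1[of x] B0(3) by (auto simp: N_def)
  then have inj: "inj_on f (span (B - B0))"
    by (subst linear_inj_on_iff_eq_0[OF f subspace_span]) blast
  have ind: "independent (f ` (B - B0))"
    by (intro linear_independent_injective_image f inj independent_mono[OF B(3)]) auto
  have "f ` V \<subseteq> span (f ` (B - B0))"
  proof -
    have "f ` V = span (f ` B)"
      using B V by (simp add: linear_span_image[OF f] span_subspace)
    also have "\<dots> \<subseteq> span (f ` (B - B0))"
    proof (rule span_minimal[OF _ subspace_span], rule image_subsetI)
      fix b assume "b \<in> B"
      then show "f b \<in> span (f ` (B - B0))"
        using B0(1) by (cases "b \<in> B0") (auto simp: N_def span_zero intro: span_base)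
    qed
    finally show ?thesis .
  qed
  then have "dim (f ` V) = card (f ` (B - B0))"
    using ind B by (intro dim_unique[OF _ _ _ refl]) auto
  also have "\<dots> = card (B - B0)"
    by (intro card_image inj_on_subset[OF inj] span_superset)
  finally have "dim (f ` V) = card B - card B0"
    using finB B by (simp add: card_Diff_subset finite_subset)
  moreover have "card B0 \<le> card B" using finB B by (intro card_mono)
  ultimately show ?thesis using dimV B0(4) by (simp add: N_def)
qed

lemma complement_projection:
  fixes W V :: "'a::real_vector set"
  assumes W: "subspace W" and c: "complement_of W V"
  obtains \<pi> where "linear \<pi>" "\<And>y. \<pi> y \<in> V" "\<And>y. \<pi> y = 0 \<longleftrightarrow> y \<in> W" "\<And>v. v \<in> V \<Longrightarrow> \<pi> v = v"
proof -
  have V: "subspace V" and WV: "W \<inter> V = {0}" using c by (auto simp: complement_of_def)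
  have "\<exists>v. v \<in> V \<and> y - v \<in> W" for y
    using c unfolding complement_of_def by (metis add_diff_cancel_right')
  then obtain \<pi> where \<pi>: "\<And>y. \<pi> y \<in> V" "\<And>y. y - \<pi> y \<in> W" by metis
  have uniq: "\<pi> y = v" if "v \<in> V" "y - v \<in> W" for y v
  proof -
    have "(y - v) - (y - \<pi> y) \<in> W" by (intro subspace_diff W that \<pi>)
    then have "\<pi> y - v \<in> W" by simp
    moreover have "\<pi> y - v \<in> V" by (intro subspace_diff V that \<pi>)
    ultimately have "\<pi> y - v = 0" using WV by blast
    then show ?thesis by simp
  qed
  have "linear \<pi>"
  proof (rule linearI)
    fix x y
    have "(x - \<pi> x) + (y - \<pi> y) \<in> W" by (intro subspace_add W \<pi>)
    then show "\<pi> (x + y) = \<pi> x + \<pi> y"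
      by (intro uniq subspace_add V \<pi>) (simp add: algebra_simps)
  next
    fix r x
    have "r *\<^sub>R (x - \<pi> x) \<in> W" by (intro subspace_scale W \<pi>)
    then show "\<pi> (r *\<^sub>R x) = r *\<^sub>R \<pi> x"
      by (intro uniq subspace_scale V \<pi>) (simp add: algebra_simps)
  qed
  moreover have "\<pi> y = 0 \<longleftrightarrow> y \<in> W" for y
    using \<pi>(2)[of y] uniq[of 0 y] subspace_0[OF V] by auto
  moreover have "\<pi> v = v" if "v \<in> V" for v
    using uniq[of v v] that subspace_0[OF W] by simp
  ultimately show thesis using that \<pi>(1) by blast
qed

lemma linear_blinfun: "linear (blinfun_apply L)"
  by (rule bounded_linear.linear[OF blinfun.bounded_linear_right])

lemma subspace_range_blinfun: "subspace (range (blinfun_apply L))"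
  using linear_subspace_image[OF linear_blinfun subspace_UNIV] .

lemma subspace_kernel: "subspace (kernel L)"
  by (auto simp: kernel_def subspace_def blinfun.zero_right blinfun.add_right blinfun.scaleR_right)

text \<open>\<open>codim\<close> measures an arbitrarily chosen complement. The projection onto it
  along \<open>W\<close> maps the given finite-dimensional complement onto it, so its
  \<open>dim\<close> is the true dimension.\<close>

lemma codim_complement:
  fixes W :: "'a::real_vector set"
  assumes W: "subspace W" and fin: "fin_codim W"
  obtains V where "complement_of W V" "fin_dim V" "codim W = dim V"
proof -
  obtain V0 where V0: "complement_of W V0" "fin_dim V0" using fin by (auto simp: fin_codim_def)
  define V where "V = (SOME V. complement_of W V)"
  have V: "complement_of W V" unfolding V_def by (rule someI, rule V0)
  obtain B where B: "finite B" "span B = V0" using V0 by (auto simp: fin_dim_def)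
  obtain \<pi> where \<pi>: "linear \<pi>" "\<And>y. \<pi> y \<in> V" "\<And>y. \<pi> y = 0 \<longleftrightarrow> y \<in> W" "\<And>v. v \<in> V \<Longrightarrow> \<pi> v = v"
    by (rule complement_projection[OF W V]) blast
  have "V \<subseteq> \<pi> ` V0"
  proof
    fix v assume v: "v \<in> V"
    obtain w v0 where "w \<in> W" "v0 \<in> V0" "v = w + v0" using V0(1) unfolding complement_of_def by blast
    then have "\<pi> v = \<pi> v0" using \<pi>(3)[of w] by (simp add: linear_add[OF \<pi>(1)])
    then show "v \<in> \<pi> ` V0" using \<pi>(4)[OF v] \<open>v0 \<in> V0\<close> by (metis imageI)
  qed
  then have "V = span (\<pi> ` B)"
    using \<pi>(2) B by (auto simp: linear_span_image[OF \<pi>(1)])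
  then have "fin_dim V" using B by (auto simp: fin_dim_def)
  then show thesis using V that by (simp add: codim_def V_def)
qed

lemma fin_dim_basis:
  assumes "subspace V" "fin_dim V"
  obtains B where "finite B" "independent B" "span B = V" "card B = dim V"
proof -
  obtain S where S: "finite S" "span S = V" using assms by (auto simp: fin_dim_def)
  obtain B where B: "B \<subseteq> V" "independent B" "V \<subseteq> span B" "card B = dim V" by (rule basis_exists)
  then have "finite B" using independent_span_bound[OF S(1) B(2)] S by auto
  moreover have "span B = V" using B assms by (intro span_subspace)
  ultimately show thesis using that B by blast
qed

text \<open>The classical border: functionals dual to a basis of the kernel, and columns forming a
  basis of a complement of the range. The excess of functionals over columns is then the
  index.\<close>

lemma fredholm_aug_iso:
  fixes L :: "'a::banach \<Rightarrow>\<^sub>L 'b::banach"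
  assumes "fredholm L"
  obtains K I \<beta> C where "finite K" "finite I" "independent K" "span K = kernel L"
    "card K = dim (kernel L)" "card I = codim (range (blinfun_apply L))"
    "\<And>k l. k \<in> K \<Longrightarrow> l \<in> K \<Longrightarrow> blinfun_apply (\<beta> k) l = (if k = l then 1 else 0)"
    "C > 0" "aug_iso C L I (\<lambda>c. c) K \<beta>"
proof -
  have "fin_dim (kernel L)" "fin_codim (range (blinfun_apply L))" using assms by (auto simp: fredholm_def)
  obtain K where K: "finite K" "independent K" "span K = kernel L" "card K = dim (kernel L)"
    using fin_dim_basis[OF subspace_kernel \<open>fin_dim (kernel L)\<close>] .
  obtain V where V: "complement_of (range L) V" "fin_dim V" "codim (range L) = dim V"
    using codim_complement[OF subspace_range_blinfun \<open>fin_codim (range L)\<close>] .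
  have sV: "subspace V" and RV: "range L \<inter> V = {0}" using V by (auto simp: complement_of_def)
  obtain I where I: "finite I" "independent I" "span I = V" "card I = dim V"
    using fin_dim_basis[OF sV V(2)] .
  obtain \<beta> :: "'a \<Rightarrow> 'a \<Rightarrow>\<^sub>L real" where \<beta>: "\<And>k l. k \<in> K \<Longrightarrow> l \<in> K \<Longrightarrow> \<beta> k l = (if k = l then 1 else 0)"
    using dual_functionals[OF K(1,2)] by blast
  have LK: "L k = 0" if "k \<in> K" for k
    using span_base[OF that] K by (auto simp: kernel_def)
  have "\<exists>C>0. aug_iso C L I (\<lambda>c. c) K \<beta>"
  proof (rule aug_isoI[OF I(1) K(1) \<beta>])
    fix y
    obtain w v where wv: "w \<in> range L" "v \<in> V" "y = w + v" using V(1) unfolding complement_of_def by blast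
    obtain x where x: "w = L x" using wv by blast
    have "v \<in> span I" using wv I by simp
    then obtain a where a: "v = (\<Sum>c\<in>I. a c *\<^sub>R c)" using I(1) by (auto simp: span_finite)
    define e where "e = x - (\<Sum>k\<in>K. \<beta> k x *\<^sub>R k)"
    have "L e = L x"
      by (simp add: e_def blinfun.diff_right blinfun.sum_right blinfun.scaleR_right LK)
    moreover have "annihilated K \<beta> e"
      using K(1) by (simp add: annihilated_def e_def blinfun.diff_right blinfun.sum_right
          blinfun.scaleR_right \<beta> if_distrib sum.delta cong: if_cong sum.cong)
    ultimately show "\<exists>e a. aug L I (\<lambda>c. c) e a = y \<and> annihilated K \<beta> e"
      using wv x a by (intro exI[of _ e] exI[of _ a]) (simp add: aug_def)
  next
    fix e and a :: "'b \<Rightarrow> real"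
    assume 0: "aug L I (\<lambda>c. c) e a = 0" and ann: "annihilated K \<beta> e"
    have "(\<Sum>c\<in>I. a c *\<^sub>R c) \<in> V"
      unfolding I(3)[symmetric] by (intro span_sum span_scale span_base)
    moreover have "(\<Sum>c\<in>I. a c *\<^sub>R c) = L (- e)"
      using 0 by (simp add: aug_def blinfun.minus_right eq_neg_iff_add_eq_0 add.commute)
    ultimately have a0: "(\<Sum>c\<in>I. a c *\<^sub>R c) = 0" using RV by blast
    then have "\<forall>c\<in>I. a c = 0" using independentD[OF I(2,1) subset_refl a0] by blast
    moreover have "e \<in> span K" using 0 a0 by (simp add: K(3) aug_def kernel_def)
    then obtain b where b: "e = (\<Sum>k\<in>K. b k *\<^sub>R k)" using K(1) by (auto simp: span_finite)
    have "\<beta> k e = b k" if "k \<in> K" for k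
      unfolding b using K(1) that
      by (simp add: blinfun.sum_right blinfun.scaleR_right \<beta> if_distrib sum.delta cong: if_cong sum.cong)
    then have "e = 0" using ann by (simp add: b annihilated_def)
    ultimately show "e = 0 \<and> (\<forall>c\<in>I. a c = 0)" by simp
  qed
  then show thesis using that[OF K(1) I(1) K(2,3,4) _ \<beta>] I V by auto
qed

text \<open>Any border reveals the index. With \<open>Q\<close> the span of the columns, the
  preimage \<open>V\<close> of \<open>Q\<close> has dimension \<open>card K\<close> and is mapped by
  \<open>L\<close> onto \<open>range L \<inter> Q\<close> with the kernel of \<open>L\<close>; the
  projection along \<open>range L\<close> maps \<open>Q\<close> onto a complement, with kernel
  \<open>range L \<inter> Q\<close>. Subtracting the two rank-nullity formulas cancels that
  intersection.\<close>

lemma fredholm_index_aug_iso: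
  fixes L :: "'a::banach \<Rightarrow>\<^sub>L 'b::banach" and \<kappa> :: "'k \<Rightarrow> 'a \<Rightarrow>\<^sub>L real"
  assumes fred: "fredholm L" and I: "finite I" and K: "finite K"
    and dual: "\<And>k l. k \<in> K \<Longrightarrow> l \<in> K \<Longrightarrow> \<kappa> k (u l) = (if k = l then 1 else 0)"
    and iso: "aug_iso C L I q K \<kappa>"
  shows "fredholm_index L = int (card K) - int (card I)"
proof -
  have uniq: "e = 0 \<and> (\<forall>i\<in>I. a i = 0)" if "aug L I q e a = 0" "annihilated K \<kappa> e" for e a
  proof -
    have *: "size_aug I e a \<le> 0"
      using aug_iso_bound[OF iso, of e a] that by (simp add: annihilated_def)
    then have "norm e \<le> 0" using norm_le_size_aug order_trans by blast
    moreover have "\<bar>a i\<bar> \<le> 0" if "i \<in> I" for i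
      using coord_le_size_aug[OF I that] * order_trans by blast
    ultimately show ?thesis by auto
  qed
  have q0: "\<forall>i\<in>I. a i = 0" if "(\<Sum>i\<in>I. a i *\<^sub>R q i) = 0" for a
    using uniq[of 0 a] that by (simp add: aug_def annihilated_def blinfun.zero_right)
  define Q where "Q = span (q ` I)"
  have Qin: "(\<Sum>i\<in>I. a i *\<^sub>R q i) \<in> Q" for a
    unfolding Q_def by (intro span_sum span_scale span_base) auto
  have Qex: "\<exists>a. y = (\<Sum>i\<in>I. a i *\<^sub>R q i)" if "y \<in> Q" for y
    using that unfolding Q_def
  proof (induction rule: span_induct_alt)
    case base
    show ?case by (intro exI[of _ "\<lambda>_. 0"]) simp
  next
    case (step c x y)
    then obtain i a where i: "i \<in> I" "x = q i" and a: "y = (\<Sum>i\<in>I. a i *\<^sub>R q i)" by blast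
    have "(\<Sum>j\<in>I. (a j + (if j = i then c else 0)) *\<^sub>R q j) = y + c *\<^sub>R x"
      using I i by (simp add: scaleR_add_left sum.distrib a if_distrib[of "\<lambda>c. c *\<^sub>R _"] sum.delta cong: if_cong)
    then show ?case by (metis add.commute)
  qed
  have injq: "inj_on q I"
  proof (rule inj_onI)
    fix i j assume ij: "i \<in> I" "j \<in> I" "q i = q j"
    show "i = j"
    proof (rule ccontr)
      assume "i \<noteq> j"
      then have "(\<Sum>l\<in>I. ((if l = i then 1 else 0) - (if l = j then 1 else 0)) *\<^sub>R q l) = q i - q j"
        using I ij by (simp add: scaleR_diff_left sum_subtractf if_distrib[of "\<lambda>c. c *\<^sub>R _"] sum.delta cong: if_cong)
      then show False using q0[of "\<lambda>l. (if l = i then 1 else 0) - (if l = j then 1 else 0)"] ij \<open>i \<noteq> j\<close> by auto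
    qed
  qed
  have "independent (q ` I)"
  proof (rule independent_if_scalars_zero)
    fix f x assume 0: "(\<Sum>x\<in>q ` I. f x *\<^sub>R x) = 0" and x: "x \<in> q ` I"
    have "(\<Sum>i\<in>I. f (q i) *\<^sub>R q i) = 0" using 0 by (simp add: sum.reindex[OF injq])
    then show "f x = 0" using q0[of "\<lambda>i. f (q i)"] x by auto
  qed (use I in simp)
  then have dimQ: "dim Q = card I"
    unfolding Q_def by (simp add: dim_eq_card_independent card_image[OF injq])
  have Q: "subspace Q" "fin_dim Q" using I by (auto simp: Q_def fin_dim_def)

  define V where "V = {x. L x \<in> Q}"
  have "\<exists>e a. aug L I q e a = L (u j) \<and> annihilated K \<kappa> e" for j
    using iso unfolding aug_iso_def by blast
  then obtain E A where EA: "\<And>j. aug L I q (E j) (A j) = L (u j)" "\<And>j. annihilated K \<kappa> (E j)" by metis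
  \<comment> \<open>Subtracting the annihilated solution \<open>E j\<close> moves
    \<open>L (u j)\<close> into \<open>Q\<close> and keeps the \<kappa>-values; the vectors
    \<open>w j\<close> form the basis of \<open>V\<close> dual to \<kappa>.\<close>
  define w where "w j = u j - E j" for j
  have wV: "w j \<in> V" for j
  proof -
    have "L (w j) = (\<Sum>i\<in>I. A j i *\<^sub>R q i)" using EA(1)[of j] by (simp add: w_def aug_def blinfun.diff_right algebra_simps)
    then show ?thesis using Qin by (simp add: V_def)
  qed
  have \<kappa>w: "\<kappa> k (w j) = (if k = j then 1 else 0)" if "k \<in> K" "j \<in> K" for k j
    using that EA(2) by (simp add: w_def blinfun.diff_right dual annihilated_def)
  have sV: "subspace V"
    using Q(1) by (auto simp: V_def subspace_def blinfun.zero_right blinfun.add_right blinfun.scaleR_right)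
  have \<kappa>sum: "\<kappa> k (\<Sum>j\<in>K. b j *\<^sub>R w j) = b k" if "k \<in> K" for k b
    using K that by (simp add: blinfun.sum_right blinfun.scaleR_right \<kappa>w if_distrib sum.delta cong: if_cong sum.cong)
  have Vrep: "x = (\<Sum>j\<in>K. \<kappa> j x *\<^sub>R w j)" if x: "x \<in> V" for x
  proof -
    let ?d = "x - (\<Sum>j\<in>K. \<kappa> j x *\<^sub>R w j)"
    have "?d \<in> V" by (intro subspace_diff subspace_sum subspace_scale sV x wV)
    then obtain a where a: "L ?d = (\<Sum>i\<in>I. a i *\<^sub>R q i)" using Qex by (auto simp: V_def)
    have "aug L I q ?d (\<lambda>i. - a i) = 0" by (simp add: aug_def a sum_negf)
    moreover have "annihilated K \<kappa> ?d" by (simp add: annihilated_def blinfun.diff_right \<kappa>sum)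
    ultimately show ?thesis using uniq by fastforce
  qed
  have injw: "inj_on w K"
  proof (rule inj_onI)
    fix i j assume "i \<in> K" "j \<in> K" "w i = w j"
    then show "i = j" using \<kappa>w[of i i] \<kappa>w[of i j] by (auto split: if_splits)
  qed
  have "independent (w ` K)"
  proof (rule independent_if_scalars_zero)
    fix f x assume 0: "(\<Sum>x\<in>w ` K. f x *\<^sub>R x) = 0" and x: "x \<in> w ` K"
    have "(\<Sum>k\<in>K. f (w k) *\<^sub>R w k) = 0" using 0 by (simp add: sum.reindex[OF injw])
    then show "f x = 0" using \<kappa>sum[of _ "\<lambda>k. f (w k)"] x by (auto simp: blinfun.zero_right)
  qed (use K in simp)
  moreover have Vspan: "span (w ` K) = V"
  proof
    show "span (w ` K) \<subseteq> V" using wV sV by (intro span_minimal) auto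
    show "V \<subseteq> span (w ` K)"
    proof
      fix x assume x: "x \<in> V"
      have "(\<Sum>j\<in>K. \<kappa> j x *\<^sub>R w j) \<in> span (w ` K)"
        by (intro span_sum span_scale span_base) auto
      then show "x \<in> span (w ` K)" using Vrep[OF x] by simp
    qed
  qed
  ultimately have dimV: "dim V = card K"
    by (metis dim_span_eq_card_independent card_image[OF injw])
  have "fin_dim V" using Vspan K by (auto simp: fin_dim_def)
  have 1: "card K = dim (kernel L) + dim (range L \<inter> Q)"
  proof -
    have "{x \<in> V. L x = 0} = kernel L" using subspace_0[OF Q(1)] by (auto simp: V_def kernel_def)
    moreover have "blinfun_apply L ` V = range L \<inter> Q" by (auto simp: V_def)
    ultimately show ?thesis using rank_nullity[OF linear_blinfun[of L] sV \<open>fin_dim V\<close>] dimV by simp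
  qed
  obtain V' where V': "complement_of (range L) V'" "codim (range L) = dim V'"
    by (rule codim_complement[OF subspace_range_blinfun]) (use fred in \<open>auto simp: fredholm_def\<close>)
  obtain \<pi> where \<pi>: "linear \<pi>" "\<And>y. \<pi> y \<in> V'" "\<And>y. \<pi> y = 0 \<longleftrightarrow> y \<in> range L" "\<And>v. v \<in> V' \<Longrightarrow> \<pi> v = v"
    by (rule complement_projection[OF subspace_range_blinfun V'(1)]) blast
  have "\<pi> ` Q = V'"
  proof
    show "V' \<subseteq> \<pi> ` Q"
    proof
      fix v assume v: "v \<in> V'"
      obtain e a where ea: "aug L I q e a = v" using iso unfolding aug_iso_def by blast
      then have "\<pi> v = \<pi> (L e) + \<pi> (\<Sum>i\<in>I. a i *\<^sub>R q i)" by (simp add: aug_def linear_add[OF \<pi>(1), symmetric])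
      also have "\<pi> (L e) = 0" using \<pi>(3) by blast
      finally show "v \<in> \<pi> ` Q" using \<pi>(4)[OF v] Qin by auto
    qed
  qed (use \<pi> in auto)
  moreover have "{x \<in> Q. \<pi> x = 0} = range L \<inter> Q" using \<pi>(3) by auto
  ultimately have "card I = dim (range L \<inter> Q) + codim (range L)"
    using rank_nullity[OF \<pi>(1) Q] dimQ V' by simp
  with 1 show ?thesis by (simp add: fredholm_index_def)
qed

text \<open>A border that makes \<open>L\<close> invertible does so for every nearby operator, and
  the index is read off the border. Fredholmness of \<open>L'\<close> is a premise here; (J1)
  provides it in the application.\<close>

lemma fredholm_index_locally_constant:
  fixes L :: "'a::banach \<Rightarrow>\<^sub>L 'b::banach"
  assumes "fredholm L"
  obtains \<delta> where "\<delta> > 0" "\<And>L'. norm (L' - L) < \<delta> \<Longrightarrow> fredholm L' \<Longrightarrow> fredholm_index L' = fredholm_index L"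
proof -
  obtain K I \<beta> C where *: "finite K" "finite I" 
    "\<And>k l. k \<in> K \<Longrightarrow> l \<in> K \<Longrightarrow> blinfun_apply (\<beta> k) l = (if k = l then 1 else 0)"
    "C > 0" "aug_iso C L I (\<lambda>c. c) K \<beta>"
    by (rule fredholm_aug_iso[OF assms]) blast
  have "fredholm_index L' = fredholm_index L" if "norm (L' - L) < 1 / (2 * C)" "fredholm L'" for L'
  proof -
    have "aug_iso (2 * C) L' I (\<lambda>c. c) K \<beta>"
    proof (rule aug_iso_perturb[OF *(2,4,5), where \<eta>="norm (L' - L)"])
      fix e a
      have "norm (aug L' I (\<lambda>c. c) e a - aug L I (\<lambda>c. c) e a) \<le> norm (L' - L) * norm e"
        using norm_blinfun[of "L' - L" e] by (simp add: aug_def blinfun.diff_left)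
      also have "\<dots> \<le> norm (L' - L) * size_aug I e a"
        by (intro mult_left_mono norm_le_size_aug) simp
      finally show "norm (aug L' I (\<lambda>c. c) e a - aug L I (\<lambda>c. c) e a) \<le> norm (L' - L) * size_aug I e a" .
    next
      show "norm (L' - L) * C \<le> 1/2" using that *(4) by (simp add: field_simps)
    qed
    then show ?thesis
      using fredholm_index_aug_iso[OF that(2) *(2,1,3)] fredholm_index_aug_iso[OF assms *(2,1,3,5)] by simp
  qed
  then show thesis using *(4) by (intro that[of "1 / (2 * C)"]) auto
qed

lemma fredholm_index_connected:
  fixes A :: "'c::topological_space \<Rightarrow> 'a::banach \<Rightarrow>\<^sub>L 'b::banach"
  assumes S: "connected S" and A: "continuous_on S A" and fred: "\<And>z. z \<in> S \<Longrightarrow> fredholm (A z)"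
    and zw: "z \<in> S" "w \<in> S"
  shows "fredholm_index (A z) = fredholm_index (A w)"
proof (rule connected_local_const[OF S zw], rule ballI)
  fix a assume a: "a \<in> S"
  obtain \<delta> where \<delta>: "\<delta> > 0" "\<And>L'. norm (L' - A a) < \<delta> \<Longrightarrow> fredholm L' \<Longrightarrow> fredholm_index L' = fredholm_index (A a)"
    by (rule fredholm_index_locally_constant[OF fred[OF a]]) blast
  have "(A \<longlongrightarrow> A a) (at a within S)" using A a by (simp add: continuous_on_def)
  then have "\<forall>\<^sub>F b in at a within S. dist (A b) (A a) < \<delta>" using \<delta>(1) by (rule tendstoD)
  moreover have "\<forall>\<^sub>F b in at a within S. b \<in> S" by (simp add: eventually_at_filter)
  ultimately show "\<forall>\<^sub>F b in at a within S. fredholm_index (A a) = fredholm_index (A b)"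
    by eventually_elim (use \<delta>(2) fred in \<open>auto simp: dist_norm\<close>)
qed

subsection \<open>A counting form of Sard's theorem in equal dimensions\<close>

lemma card_nat_near:
  assumes "w \<ge> 0"
  shows "finite {j::nat. \<bar>real j - real c\<bar> \<le> w}" "real (card {j::nat. \<bar>real j - real c\<bar> \<le> w}) \<le> 2 * w + 1"
proof -
  let ?A = "{j::nat. \<bar>real j - real c\<bar> \<le> w}"
  have sub: "int ` ?A \<subseteq> {int c - \<lfloor>w\<rfloor>..int c + \<lfloor>w\<rfloor>}"
  proof (rule image_subsetI)
    fix j assume "j \<in> ?A"
    then have "real_of_int (int j - int c) \<le> w" "real_of_int (int c - int j) \<le> w" by auto
    then have "int j - int c \<le> \<lfloor>w\<rfloor>" "int c - int j \<le> \<lfloor>w\<rfloor>" by (simp_all add: le_floor_iff)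
    then show "int j \<in> {int c - \<lfloor>w\<rfloor>..int c + \<lfloor>w\<rfloor>}" by auto
  qed
  then have "finite (int ` ?A)" by (rule finite_subset) simp
  then show fin: "finite ?A" by (rule finite_imageD) simp
  have "card ?A = card (int ` ?A)" by (simp add: card_image)
  also have "\<dots> \<le> card {int c - \<lfloor>w\<rfloor>..int c + \<lfloor>w\<rfloor>}" by (intro card_mono sub) simp
  finally have "real (card ?A) \<le> real (nat (2 * \<lfloor>w\<rfloor> + 1))" by simp
  also have "\<dots> = 2 * real_of_int \<lfloor>w\<rfloor> + 1" using assms by simp
  also have "\<dots> \<le> 2 * w + 1" by simp
  finally show "real (card ?A) \<le> 2 * w + 1" .
qed

text \<open>The points \<open>s\<close> are parametrized by the coordinates \<open>\<kappa> s\<close>, on which \<open>a s\<close> depends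
  in a Lipschitz way. Near every point the values \<open>a\<close> are confined to a thin slab, so a cell of
  side \<open>r\<close> in the \<open>\<kappa>\<close>-space meets few points of a grid of mesh \<open>3\<epsilon>r\<close> in the
  \<open>a\<close>-space: in the transversal direction \<open>i0\<close> there is at most one.\<close>

lemma no_cube_of_critical_values:
  fixes \<kappa> :: "'s \<Rightarrow> 'k \<Rightarrow> real" and a :: "'s \<Rightarrow> 'i \<Rightarrow> real"
  assumes fin: "finite I" "finite K" and card: "card K = card I"
    and R: "R > 0" "\<And>s k. s \<in> S \<Longrightarrow> k \<in> K \<Longrightarrow> \<bar>\<kappa> s k\<bar> \<le> R"
    and L: "L > 0" "\<And>s s' d i. s \<in> S \<Longrightarrow> s' \<in> S \<Longrightarrow> (\<And>k. k \<in> K \<Longrightarrow> \<bar>\<kappa> s k - \<kappa> s' k\<bar> \<le> d) \<Longrightarrow> i \<in> I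
               \<Longrightarrow> \<bar>a s i - a s' i\<bar> \<le> L * d"
    and \<delta>: "\<delta> > 0" "\<And>b. (\<And>i. i \<in> I \<Longrightarrow> 0 \<le> b i \<and> b i \<le> \<delta>) \<Longrightarrow> \<exists>s\<in>S. \<forall>i\<in>I. a s i = b i"
    and slab: "\<And>\<epsilon>. \<epsilon> > 0 \<Longrightarrow> \<exists>r0>0. \<forall>r. 0 < r \<and> r < r0 \<longrightarrow> (\<forall>s\<in>S. \<exists>c. \<exists>i0\<in>I. \<bar>c i0\<bar> = 1 \<and>
                 (\<forall>s'\<in>S. (\<forall>k\<in>K. \<bar>\<kappa> s' k - \<kappa> s k\<bar> \<le> r) \<longrightarrow> \<bar>\<Sum>i\<in>I. c i * (a s' i - a s i)\<bar> \<le> \<epsilon> * r))"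
  shows False
proof -
  define m where "m = card I"
  \<comment> \<open>The first bound gives \<open>2 * w + 1\<close> \<le>
    \<open>L / \<epsilon>\<close> below, the second brings the final estimate down to
    \<open>\<delta> ^ m / 2\<close>. Neither involves \<open>r\<close>, which has to be chosen after
    \<epsilon>.\<close>
  define \<epsilon> where "\<epsilon> = min (L / 3) (\<delta> ^ m / (2 * (15 * R) ^ m * L ^ (m - 1)))"
  have \<epsilon>: "\<epsilon> > 0" "\<epsilon> \<le> L / 3" "\<epsilon> \<le> \<delta> ^ m / (2 * (15 * R) ^ m * L ^ (m - 1))"
    using L R \<delta> by (auto simp: \<epsilon>_def)
  obtain r0 where r0: "r0 > 0" and slab0: "\<And>r s. 0 < r \<Longrightarrow> r < r0 \<Longrightarrow> s \<in> S \<Longrightarrow> \<exists>c. \<exists>i0\<in>I. \<bar>c i0\<bar> = 1 \<and>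
                 (\<forall>s'\<in>S. (\<forall>k\<in>K. \<bar>\<kappa> s' k - \<kappa> s k\<bar> \<le> r) \<longrightarrow> \<bar>\<Sum>i\<in>I. c i * (a s' i - a s i)\<bar> \<le> \<epsilon> * r)"
    using slab[OF \<epsilon>(1)] by blast
  define r where "r = min (r0 / 2) R"
  have r: "0 < r" "r < r0" "r \<le> R" using r0 R by (auto simp: r_def)
  \<comment> \<open>Values in one slab differ by at most \<open>2 * \<epsilon> * r\<close> across
    it, which is less than one mesh.\<close>
  define h where "h = 3 * \<epsilon> * r"
  have h: "h > 0" using \<epsilon> r by (simp add: h_def)
  \<comment> \<open>The \<open>+ 1\<close> counts the grid coordinate 0: there are at least
    \<open>\<delta> / h\<close> coordinates, and all of them stay in the interval from 0 to
    \<delta>.\<close>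
  define n where "n = nat \<lfloor>\<delta> / h\<rfloor> + 1"
  have n: "real n \<ge> \<delta> / h" unfolding n_def using \<delta> h by (simp add: of_nat_nat) linarith
  define G where "G = PiE I (\<lambda>_. {0..<n})"
  have finG: "finite G" and cardG: "card G = n ^ m"
    using fin by (auto simp: G_def m_def card_PiE intro!: finite_PiE)
  have "\<exists>s\<in>S. \<forall>i\<in>I. a s i = h * real (g i)" if g: "g \<in> G" for g
  proof (rule \<delta>(2))
    fix i assume "i \<in> I"
    then have "g i < n" using g by (auto simp: G_def)
    then have "real (g i) \<le> real (nat \<lfloor>\<delta> / h\<rfloor>)" by (simp add: n_def)
    also have "\<dots> \<le> \<delta> / h" using \<delta> h by simp
    finally show "0 \<le> h * real (g i) \<and> h * real (g i) \<le> \<delta>" using h by (simp add: field_simps)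
  qed
  then obtain p where p: "\<And>g. g \<in> G \<Longrightarrow> p g \<in> S" "\<And>g i. g \<in> G \<Longrightarrow> i \<in> I \<Longrightarrow> a (p g) i = h * real (g i)"
    by metis
  \<comment> \<open>\<open>p\<close> picks a point over each grid value, and \<open>q\<close>
    records the cell of side \<open>r\<close> of the \<kappa>-space that contains it.\<close>
  define q where "q g = restrict (\<lambda>k. \<lfloor>\<kappa> (p g) k / r\<rfloor>) K" for g
  define B where "B = \<lceil>R / r\<rceil>"
  have "0 < R / r" using R r by simp
  then have B0: "B \<ge> 0" unfolding B_def by linarith
  have qG: "q ` G \<subseteq> PiE K (\<lambda>_. {-B..B})"
  proof (rule image_subsetI)
    fix g assume g: "g \<in> G"
    have "\<lfloor>\<kappa> (p g) k / r\<rfloor> \<in> {-B..B}" if k: "k \<in> K" for k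
    proof -
      have "\<bar>\<kappa> (p g) k / r\<bar> \<le> R / r" using R(2)[OF p(1)[OF g] k] r by (simp add: divide_right_mono)
      then have "\<kappa> (p g) k / r \<le> R / r" "- (R / r) \<le> \<kappa> (p g) k / r" by linarith+
      then have "\<kappa> (p g) k / r \<le> of_int B" "- of_int B \<le> \<kappa> (p g) k / r"
        unfolding B_def by linarith+
      then show ?thesis by (auto simp: le_floor_iff floor_le_iff)
    qed
    then show "q g \<in> PiE K (\<lambda>_. {-B..B})" by (auto simp: q_def)
  qed
  have finq: "finite (PiE K (\<lambda>_. {-B..B}))" using fin by (intro finite_PiE) auto
  have "real (card (q ` G)) \<le> real (card (PiE K (\<lambda>_. {-B..B})))"
    using card_mono[OF finq qG] by simp
  also have "\<dots> = (2 * real_of_int B + 1) ^ m"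
    using fin card B0 by (simp add: card_PiE m_def of_nat_nat)
  also have "\<dots> \<le> (5 * R / r) ^ m"
  proof (rule power_mono)
    have "real_of_int B \<le> R / r + 1" unfolding B_def by linarith
    moreover have "1 \<le> R / r" using r by simp
    ultimately show "2 * real_of_int B + 1 \<le> 5 * R / r" by simp
  qed (use B0 in simp)
  finally have cells: "real (card (q ` G)) \<le> (5 * R / r) ^ m" .
  \<comment> \<open>Within a cell the values differ by at most \<open>L * r = w * h\<close>, so
    \<open>w\<close> is this bound counted in meshes.\<close>
  define w where "w = L / (3 * \<epsilon>)"
  have w: "w \<ge> 0" "2 * w + 1 \<le> L / \<epsilon>" using L \<epsilon> by (auto simp: w_def field_simps)
  have fiber: "real (card {g \<in> G. q g = c}) \<le> (L / \<epsilon>) ^ (m - 1)" for c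
  proof (cases "{g \<in> G. q g = c} = {}")
    case True
    show ?thesis unfolding True using L(1) \<epsilon>(1) by simp
  next
    case False
    then obtain g0 where g0: "g0 \<in> G" "q g0 = c" by blast
    obtain e i0 where i0: "i0 \<in> I" "\<bar>e i0\<bar> = 1" and
      sl: "\<And>s'. s' \<in> S \<Longrightarrow> (\<And>k. k \<in> K \<Longrightarrow> \<bar>\<kappa> s' k - \<kappa> (p g0) k\<bar> \<le> r) \<Longrightarrow>
        \<bar>\<Sum>i\<in>I. e i * (a s' i - a (p g0) i)\<bar> \<le> \<epsilon> * r"
      using slab0[OF r(1,2) p(1)[OF g0(1)]] by blast
    have near: "\<bar>\<kappa> (p g) k - \<kappa> (p g0) k\<bar> \<le> r" if "g \<in> G" "q g = c" "k \<in> K" for g k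
    proof -
      have "q g k = q g0 k" using that g0 by simp
      then have "\<lfloor>\<kappa> (p g) k / r\<rfloor> = \<lfloor>\<kappa> (p g0) k / r\<rfloor>" using that by (simp add: q_def)
      then have "\<bar>\<kappa> (p g) k / r - \<kappa> (p g0) k / r\<bar> \<le> 1" by linarith
      then show ?thesis using r by (simp add: diff_divide_distrib[symmetric] abs_divide)
    qed
    let ?F = "{g \<in> G. q g = c}"
    let ?P = "PiE (I - {i0}) (\<lambda>i. {j::nat. \<bar>real j - real (g0 i)\<bar> \<le> w})"
    have "inj_on (\<lambda>g. restrict g (I - {i0})) ?F"
    proof (rule inj_onI)
      fix g g' assume g: "g \<in> ?F" and g': "g' \<in> ?F" and eq: "restrict g (I - {i0}) = restrict g' (I - {i0})"
      have other: "g i = g' i" if "i \<in> I - {i0}" for i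
        using fun_cong[OF eq, of i] that by simp
      have 1: "\<bar>\<Sum>i\<in>I. e i * (a (p g) i - a (p g0) i)\<bar> \<le> \<epsilon> * r"
        using g by (intro sl near p) auto
      have 2: "\<bar>\<Sum>i\<in>I. e i * (a (p g') i - a (p g0) i)\<bar> \<le> \<epsilon> * r"
        using g' by (intro sl near p) auto
      have "(\<Sum>i\<in>I. e i * (a (p g) i - a (p g0) i)) - (\<Sum>i\<in>I. e i * (a (p g') i - a (p g0) i))
          = (\<Sum>i\<in>I. e i * (a (p g) i - a (p g') i))"
        by (simp add: sum_subtractf[symmetric] algebra_simps)
      \<comment> \<open>The two grid points agree in all other coordinates, so only the term of
        \<open>i0\<close> survives, with a coefficient of absolute value 1.\<close>
      also have "\<dots> = e i0 * (a (p g) i0 - a (p g') i0) + (\<Sum>i\<in>I - {i0}. e i * (a (p g) i - a (p g') i))"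
        using fin i0 by (simp add: sum.remove)
      also have "(\<Sum>i\<in>I - {i0}. e i * (a (p g) i - a (p g') i)) = 0"
        using g g' other by (intro sum.neutral) (auto simp: p(2))
      also have "a (p g) i0 - a (p g') i0 = h * (real (g i0) - real (g' i0))"
        using g g' i0 by (simp add: p(2) algebra_simps)
      finally have "\<bar>e i0 * (h * (real (g i0) - real (g' i0)))\<bar> \<le> 2 * \<epsilon> * r"
        using 1 2 by linarith
      then have "h * \<bar>real (g i0) - real (g' i0)\<bar> \<le> 2 * \<epsilon> * r"
        using i0 h by (simp add: abs_mult)
      then have "(\<epsilon> * r) * (3 * \<bar>real (g i0) - real (g' i0)\<bar>) \<le> (\<epsilon> * r) * 2"
        by (simp add: h_def algebra_simps)
      then have "3 * \<bar>real (g i0) - real (g' i0)\<bar> \<le> 2"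
        using \<epsilon> r by (subst (asm) mult_le_cancel_left_pos) auto
      then have "\<bar>real_of_int (int (g i0) - int (g' i0))\<bar> < 1" by simp
      then have "g i0 = g' i0" by linarith
      then have "g i = g' i" if "i \<in> I" for i using other that by blast
      moreover have "g \<in> extensional I" "g' \<in> extensional I" using g g' by (auto simp: G_def PiE_def)
      ultimately show "g = g'" by (intro extensionalityI[of g I g'])
    qed
    then have "card ?F = card ((\<lambda>g. restrict g (I - {i0})) ` ?F)" by (simp add: card_image)
    also have "\<dots> \<le> card ?P"
    proof (rule card_mono)
      show "finite ?P" using fin card_nat_near(1)[OF w(1)] by (intro finite_PiE) auto
      show "(\<lambda>g. restrict g (I - {i0})) ` ?F \<subseteq> ?P"
      proof (rule image_subsetI)
        fix g assume g: "g \<in> ?F"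
        have "\<bar>real (g i) - real (g0 i)\<bar> \<le> w" if i: "i \<in> I" for i
        proof -
          have "\<bar>a (p g) i - a (p g0) i\<bar> \<le> L * r"
            using g g0 i by (intro L(2) p near) auto
          also have "a (p g) i - a (p g0) i = h * (real (g i) - real (g0 i))"
            using g g0 i by (simp add: p(2) algebra_simps)
          finally have "h * \<bar>real (g i) - real (g0 i)\<bar> \<le> L * r" using h by (simp add: abs_mult)
          then show ?thesis using \<epsilon> r by (simp add: h_def w_def field_simps)
        qed
        then show "restrict g (I - {i0}) \<in> ?P" by auto
      qed
    qed
    finally have "real (card ?F) \<le> real (card ?P)" by simp
    also have "\<dots> = (\<Prod>i\<in>I - {i0}. real (card {j::nat. \<bar>real j - real (g0 i)\<bar> \<le> w}))"
      using fin by (simp add: card_PiE)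
    also have "\<dots> \<le> (\<Prod>i\<in>I - {i0}. L / \<epsilon>)"
      using order_trans[OF card_nat_near(2)[OF w(1)] w(2)] by (intro prod_mono) auto
    also have "\<dots> = (L / \<epsilon>) ^ (m - 1)" using fin i0 by (simp add: m_def)
    finally show ?thesis .
  qed
  have "real (card G) \<le> real (\<Sum>c\<in>q ` G. card {g \<in> G. q g = c})"
  proof -
    have "G = (\<Union>c\<in>q ` G. {g \<in> G. q g = c})" by blast
    then have "card G = card (\<Union>c\<in>q ` G. {g \<in> G. q g = c})" by simp
    also have "\<dots> \<le> (\<Sum>c\<in>q ` G. card {g \<in> G. q g = c})" using finG by (intro card_UN_le) simp
    finally show ?thesis by (rule of_nat_mono)
  qed
  also have "\<dots> \<le> (\<Sum>c\<in>q ` G. (L / \<epsilon>) ^ (m - 1))" unfolding of_nat_sum by (intro sum_mono fiber)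
  also have "\<dots> = real (card (q ` G)) * (L / \<epsilon>) ^ (m - 1)" by simp
  also have "\<dots> \<le> (5 * R / r) ^ m * (L / \<epsilon>) ^ (m - 1)"
    using cells L \<epsilon> by (intro mult_right_mono) auto
  finally have "real n ^ m \<le> (5 * R / r) ^ m * (L / \<epsilon>) ^ (m - 1)" by (simp add: cardG)
  moreover have "(\<delta> / h) ^ m \<le> real n ^ m" using n \<delta> h by (intro power_mono) auto
  ultimately have main: "(\<delta> / h) ^ m \<le> (5 * R / r) ^ m * (L / \<epsilon>) ^ (m - 1)" by linarith
  \<comment> \<open>The slab hypothesis supplies an index as soon as there is a point. This rules
    out \<open>m = 0\<close>, where \<open>m - 1\<close> would be truncated.\<close>
  have "G \<noteq> {}" by (auto simp: G_def n_def PiE_eq_empty_iff)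
  then obtain g where "g \<in> G" by blast
  then have "I \<noteq> {}" using slab0[OF r(1,2) p(1)] by blast
  then have m: "m > 0" using fin by (simp add: m_def card_gt_0_iff)
  \<comment> \<open>Multiplication by \<open>h ^ m\<close> removes \<open>r\<close>; of its
    \<open>m\<close> factors \<epsilon> only \<open>m - 1\<close> are consumed by the powers of
    \<open>L / \<epsilon>\<close>.\<close>
  have "\<delta> ^ m = (\<delta> / h) ^ m * h ^ m" using h by (simp add: power_divide)
  also have "\<dots> \<le> ((5 * R / r) ^ m * (L / \<epsilon>) ^ (m - 1)) * h ^ m"
    using main h by (intro mult_right_mono) auto
  also have "\<dots> = ((5 * R / r) * h) ^ m * (L / \<epsilon>) ^ (m - 1)"
    unfolding power_mult_distrib[of "5 * R / r" h] by (simp only: mult_ac)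
  also have "(5 * R / r) * h = 15 * R * \<epsilon>" using r by (simp add: h_def)
  also have "(15 * R * \<epsilon>) ^ m * (L / \<epsilon>) ^ (m - 1) = (15 * R) ^ m * L ^ (m - 1) * \<epsilon>"
  proof -
    have "\<epsilon> ^ m = \<epsilon> ^ (m - 1) * \<epsilon>" using m by (metis power_minus_mult)
    then show ?thesis using \<epsilon> by (simp add: power_mult_distrib power_divide)
  qed
  also have "\<dots> \<le> (15 * R) ^ m * L ^ (m - 1) * (\<delta> ^ m / (2 * (15 * R) ^ m * L ^ (m - 1)))"
    using \<epsilon> L R by (intro mult_left_mono) auto
  also have "\<dots> = \<delta> ^ m / 2" using L R by simp
  finally show False using \<delta> by simp
qed

subsection \<open>A local Sard--Smale lemma\<close>

lift_definition inl_blinfun :: "'a::real_normed_vector \<Rightarrow>\<^sub>L ('a \<times> 'b::real_normed_vector)"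
  is "\<lambda>x. (x, 0)"
  by (intro bounded_linear_Pair bounded_linear_ident bounded_linear_zero)

lemmas inl_blinfun_apply [simp] = inl_blinfun.rep_eq

section \<open>Compactness and linearization tools\<close>

lemma subsequence_convergent_family:
  fixes s :: "'k \<Rightarrow> nat \<Rightarrow> real"
  assumes "finite K" "\<And>k. k \<in> K \<Longrightarrow> bounded (range (s k))"
  shows "\<exists>r. strict_mono r \<and> (\<forall>k\<in>K. convergent (s k \<circ> r))"
  using assms
proof (induction K)
  case empty
  show ?case by (intro exI[of _ id]) (simp add: strict_mono_def)
next
  case (insert k K)
  then obtain r where r: "strict_mono r" "\<And>l. l \<in> K \<Longrightarrow> convergent (s l \<circ> r)" by blast
  have "bounded (range (s k \<circ> r))"
    by (rule bounded_subset[OF insert.prems[of k]]) auto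
  then obtain l r' where r': "strict_mono r'" "((s k \<circ> r) \<circ> r') \<longlonglongrightarrow> l"
    using bounded_imp_convergent_subsequence by blast
  have "convergent (s l \<circ> (r \<circ> r'))" if "l \<in> insert k K" for l
  proof (cases "l = k")
    case True
    then show ?thesis using r'(2) by (auto simp: convergent_def comp_assoc)
  next
    case False
    then obtain x where "(s l \<circ> r) \<longlonglongrightarrow> x" using r(2)[of l] \<open>l \<in> insert k K\<close> by (auto simp: convergent_def)
    from LIMSEQ_subseq_LIMSEQ[OF this r'(1)] show ?thesis by (auto simp: convergent_def comp_assoc)
  qed
  then show ?case using strict_mono_o[OF r(1) r'(1)] by blast
qed

text \<open>For \<open>Crit_subsequence\<close>: a convergent parameter and finitely many convergent
  scalar coordinates force convergence in the infinite-dimensional space.\<close>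

lemma Cauchy_dominated:
  fixes x :: "nat \<Rightarrow> 'a::metric_space" and y :: "nat \<Rightarrow> 'b::metric_space" and s :: "'k \<Rightarrow> nat \<Rightarrow> real"
  assumes K: "finite K" and y: "Cauchy y" and s: "\<And>k. k \<in> K \<Longrightarrow> Cauchy (s k)" and M: "M > 0"
    and le: "\<And>m n. dist (x m) (x n) \<le> M * (dist (y m) (y n) + (\<Sum>k\<in>K. \<bar>s k m - s k n\<bar>))"
  shows "Cauchy x"
proof (rule metric_CauchyI)
  fix e :: real assume e: "e > 0"
  define d where "d = e / (M * (real (card K) + 1))"
  have d: "d > 0" using e M by (simp add: d_def add_nonneg_pos)
  have "\<exists>N. \<forall>m\<ge>N. \<forall>n\<ge>N. \<bar>s k m - s k n\<bar> < d" if "k \<in> K" for k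
    using metric_CauchyD[OF s[OF that] d] by (simp add: dist_real_def)
  then obtain N where N: "\<And>k m n. k \<in> K \<Longrightarrow> m \<ge> N k \<Longrightarrow> n \<ge> N k \<Longrightarrow> \<bar>s k m - s k n\<bar> < d" by metis
  obtain N0 where N0: "\<And>m n. m \<ge> N0 \<Longrightarrow> n \<ge> N0 \<Longrightarrow> dist (y m) (y n) < d"
    using metric_CauchyD[OF y d] by blast
  define M0 where "M0 = Max (insert N0 (N ` K))"
  have big: "N0 \<le> M0" "\<And>k. k \<in> K \<Longrightarrow> N k \<le> M0" using K by (auto simp: M0_def)
  have "dist (x m) (x n) < e" if "m \<ge> M0" "n \<ge> M0" for m n
  proof -
    have "\<bar>s k m - s k n\<bar> \<le> d" if "k \<in> K" for k
      using N[OF that, of m n] big(2)[OF that] \<open>m \<ge> M0\<close> \<open>n \<ge> M0\<close> by simp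
    then have "(\<Sum>k\<in>K. \<bar>s k m - s k n\<bar>) \<le> (\<Sum>k\<in>K. d)" by (rule sum_mono)
    moreover have "dist (y m) (y n) < d" using big that by (intro N0) auto
    ultimately have "dist (y m) (y n) + (\<Sum>k\<in>K. \<bar>s k m - s k n\<bar>) < d * (real (card K) + 1)"
      by (simp add: algebra_simps)
    then have "M * (dist (y m) (y n) + (\<Sum>k\<in>K. \<bar>s k m - s k n\<bar>)) < M * (d * (real (card K) + 1))"
      using M by simp
    also have "\<dots> = e" using M by (simp add: d_def add_nonneg_eq_0_iff)
    finally show ?thesis using le[of m n] by simp
  qed
  then show "\<exists>N. \<forall>m\<ge>N. \<forall>n\<ge>N. dist (x m) (x n) < e" by blast
qed

text \<open>Stronger than uniform continuity on \<open>S\<close>, since \<open>w'\<close> may leave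
  \<open>S\<close>: in the application it runs through a convex set joining two zeros. The radius is
  a Lebesgue number for the cover by open sets on which \<open>D\<close> oscillates by less than
  \<open>e\<close>.\<close>

lemma uniform_modulus_near_compact:
  fixes D :: "'a::metric_space \<Rightarrow> 'b::metric_space"
  assumes S: "compact S" "S \<subseteq> W" and W: "open W" and D: "continuous_on W D" and e: "e > 0"
  obtains r where "r > 0" "\<And>w w'. w \<in> S \<Longrightarrow> dist w w' < r \<Longrightarrow> dist (D w') (D w) < e"
proof -
  define \<G> where "\<G> = {V. open V \<and> (\<forall>u\<in>V. \<forall>v\<in>V. dist (D u) (D v) < e)}"
  have "S \<subseteq> \<Union>\<G>"
  proof
    fix w assume "w \<in> S"
    then have w: "w \<in> W" using S by blast
    have "e / 2 > 0" using e by simp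
    have "isCont D w" using w W D by (simp add: continuous_on_eq_continuous_at)
    then obtain V where V: "open V" "w \<in> V" "\<And>v. v \<in> V \<Longrightarrow> dist (D v) (D w) < e/2"
      using continuous_at_open[of w D] \<open>e / 2 > 0\<close> 
      by (metis (no_types, lifting) centre_in_ball dist_commute mem_ball open_ball)
    have "dist (D u) (D v) < e" if "u \<in> V" "v \<in> V" for u v
      using V(3)[OF that(1)] V(3)[OF that(2)] by (rule dist_triangle_half_l)
    then show "w \<in> \<Union>\<G>" using V by (auto simp: \<G>_def)
  qed
  moreover have "\<And>V. V \<in> \<G> \<Longrightarrow> open V" by (simp add: \<G>_def)
  ultimately obtain r where r: "r > 0" "\<And>w. w \<in> S \<Longrightarrow> \<exists>V\<in>\<G>. ball w r \<subseteq> V"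
    using Heine_Borel_lemma[OF S(1)] by metis
  show thesis
  proof (rule that[OF r(1)])
    fix w w' assume w: "w \<in> S" "dist w w' < r"
    then obtain V where "V \<in> \<G>" "ball w r \<subseteq> V" using r(2) by blast
    moreover have "w \<in> ball w r" "w' \<in> ball w r" using w r by auto
    ultimately have "w \<in> V" "w' \<in> V" by blast+
    then show "dist (D w') (D w) < e" using \<open>V \<in> \<G>\<close> by (auto simp: \<G>_def)
  qed
qed

lemma linearization_error:
  fixes \<Phi> :: "'a::real_normed_vector \<Rightarrow> 'b::real_normed_vector" and D :: "'a \<Rightarrow> 'a \<Rightarrow>\<^sub>L 'b"
  assumes S: "convex S" and deriv: "\<And>w. w \<in> S \<Longrightarrow> (\<Phi> has_derivative D w) (at w)"
    and close: "\<And>w. w \<in> S \<Longrightarrow> norm (D w - A) \<le> \<eta>" and w: "u \<in> S" "v \<in> S"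
  shows "norm (\<Phi> u - \<Phi> v - A (u - v)) \<le> \<eta> * norm (u - v)"
proof -
  have "norm ((\<Phi> u - A u) - (\<Phi> v - A v)) \<le> \<eta> * norm (u - v)"
  proof (rule differentiable_bound[OF S _ _ w, where f'="\<lambda>w. blinfun_apply (D w - A)"])
    fix x assume x: "x \<in> S"
    show "((\<lambda>x. \<Phi> x - A x) has_derivative (D x - A)) (at x within S)"
      unfolding blinfun.diff_left
      by (intro has_derivative_diff has_derivative_at_withinI[OF deriv[OF x]]
          bounded_linear_imp_has_derivative blinfun.bounded_linear_right)
    show "onorm (D x - A) \<le> \<eta>" using close[OF x] by (simp add: norm_blinfun.rep_eq)
  qed
  then show ?thesis by (simp add: blinfun.diff_right algebra_simps)
qed

text \<open>A linear functional \<open>l\<close> that vanishes on \<open>range E\<close> but not at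
  \<open>y0\<close> sees only the \<open>a\<close>-part of \<open>aug\<close>. The covector consists
  of the numbers \<open>l (q i)\<close>, scaled so that the largest absolute value is 1; since just
  these finitely many numbers are kept, an algebraic extension from a basis serves.\<close>

lemma annihilating_covector:
  fixes E :: "'e::real_normed_vector \<Rightarrow>\<^sub>L 'f::real_normed_vector" and q :: "'i \<Rightarrow> 'f"
  assumes I: "finite I" and ns: "\<not> surj (blinfun_apply E)" and gen: "\<And>y. \<exists>e a. aug E I q e a = y"
  obtains c i0 where "i0 \<in> I" "\<bar>c i0\<bar> = 1" "\<And>i. i \<in> I \<Longrightarrow> \<bar>c i\<bar> \<le> 1"
    "\<And>e a. aug E I q e a = 0 \<Longrightarrow> (\<Sum>i\<in>I. c i * a i) = 0"
proof -
  obtain y0 where y0: "y0 \<notin> range E" using ns by blast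
  obtain B where B: "B \<subseteq> range E" "independent B" "range E \<subseteq> span B"
    by (rule maximal_independent_subset)
  have "span B = range E" using B subspace_range_blinfun by (intro span_subspace)
  then have "independent (insert y0 B)" using B y0 by (intro independent_insertI) auto
  then obtain l :: "'f \<Rightarrow> real" where l: "linear l" "\<And>x. x \<in> insert y0 B \<Longrightarrow> l x = (if x = y0 then 1 else 0)"
    using linear_independent_extend[of "insert y0 B" "\<lambda>x. if x = y0 then 1 else 0"] by blast
  have lE: "l (E e) = 0" for e
  proof (rule linear_eq_0_on_span[OF l(1)])
    show "E e \<in> span B" using B by blast
    fix b assume b: "b \<in> B"
    then have "b \<noteq> y0" using y0 B by blast
    then show "l b = 0" using l(2)[of b] b by simp
  qed
  have laug: "l (aug E I q e a) = (\<Sum>i\<in>I. l (q i) * a i)" for e a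
    by (simp add: aug_def linear_add[OF l(1)] lE linear_sum[OF l(1)] linear_scale[OF l(1)] mult.commute)
  obtain e a where "aug E I q e a = y0" using gen by blast
  then have "(\<Sum>i\<in>I. l (q i) * a i) = 1" using laug[of e a] l(2)[of y0] by simp
  then obtain i1 where i1: "i1 \<in> I" "l (q i1) \<noteq> 0"
    by (metis (no_types, lifting) mult_eq_0_iff sum.neutral zero_neq_one)
  define m where "m = Max ((\<lambda>i. \<bar>l (q i)\<bar>) ` I)"
  have le: "\<bar>l (q i)\<bar> \<le> m" if "i \<in> I" for i unfolding m_def using I that by (intro Max_ge) auto
  then have m: "m > 0" using i1 by fastforce
  have "m \<in> (\<lambda>i. \<bar>l (q i)\<bar>) ` I" unfolding m_def using I i1 by (intro Max_in) auto
  then obtain i0 where i0: "i0 \<in> I" "\<bar>l (q i0)\<bar> = m" by auto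
  show thesis
  proof (rule that[of i0 "\<lambda>i. l (q i) / m"])
    show "\<bar>l (q i0) / m\<bar> = 1" using i0 m by simp
    show "\<bar>l (q i) / m\<bar> \<le> 1" if "i \<in> I" for i using le[OF that] m by simp
    fix e a assume "aug E I q e a = 0"
    then have "(\<Sum>i\<in>I. l (q i) * a i) = 0" using laug[of e a] linear_0[OF l(1)] by simp
    then show "(\<Sum>i\<in>I. l (q i) / m * a i) = 0" by (simp add: sum_divide_distrib[symmetric])
  qed (rule i0)
qed

text \<open>Surjectivity of the whole differential, expressed by finitely many directions \<open>p i\<close> in the
  parameter space, and injectivity modulo \<open>\<kappa>\<close> are encoded together in \<open>aug_iso\<close>. As
  \<open>card K = card I\<close>, the partial differential in the direction of \<open>'e\<close> then has index 0.\<close>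

locale regular_zero =
  fixes \<Phi> :: "'e::banach \<times> 'l::banach \<Rightarrow> 'f::banach"
    and D :: "'e \<times> 'l \<Rightarrow> ('e \<times> 'l) \<Rightarrow>\<^sub>L 'f"
    and W :: "('e \<times> 'l) set" and w0 :: "'e \<times> 'l"
    and I :: "'i set" and p :: "'i \<Rightarrow> 'l" and K :: "'k set" and \<kappa> :: "'k \<Rightarrow> 'e \<Rightarrow>\<^sub>L real" and C :: real
  assumes W: "open W" and w0: "w0 \<in> W"
    and deriv: "w \<in> W \<Longrightarrow> (\<Phi> has_derivative D w) (at w)"
    and cont: "continuous_on W D"
    and fin: "finite I" "finite K" and card: "card K = card I"
    and C: "C > 0"
    and iso: "aug_iso C (D w0 o\<^sub>L inl_blinfun) I (\<lambda>i. D w0 (0, p i)) K \<kappa>"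
begin

abbreviation "extended_system w \<equiv> aug (D w o\<^sub>L inl_blinfun) I (\<lambda>i. D w (0, p i))"

text \<open>\<open>M\<close> bounds the passage from \<open>(e, a)\<close> to
  \<open>(e, \<Sum>i\<in>I. a i *\<^sub>R p i)\<close>, and \<eta> is the error that the constant
  \<open>C\<close> can absorb even after this factor: \<open>\<eta> * M * C = 1/2\<close>.\<close>

definition M where "M = 1 + (\<Sum>i\<in>I. norm (p i))"

definition \<eta> where "\<eta> = 1 / (2 * C * M)"

definition \<rho> where "\<rho> = (SOME \<rho>. \<rho> > 0 \<and> cball w0 \<rho> \<subseteq> W \<and> (\<forall>w\<in>cball w0 \<rho>. norm (D w - D w0) \<le> \<eta>))"

definition Crit where "Crit = {w \<in> cball w0 \<rho>. \<Phi> w = 0 \<and> \<not> surj (blinfun_apply (D w o\<^sub>L inl_blinfun))}"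

lemma norm_le_M: "i \<in> I \<Longrightarrow> norm (p i) \<le> M"
  using fin member_le_sum[of i I "\<lambda>i. norm (p i)"] by (simp add: M_def)

lemma M_ge_1: "M \<ge> 1" by (simp add: M_def sum_nonneg)

lemma \<eta>: "\<eta> > 0" "\<eta> * M * C \<le> 1/2" "\<eta> * C \<le> 1/2"
proof -
  have "M > 0" using M_ge_1 by simp
  then show "\<eta> > 0" "\<eta> * M * C \<le> 1/2" using C by (auto simp: \<eta>_def)
  show "\<eta> * C \<le> 1/2" using C M_ge_1 by (simp add: \<eta>_def field_simps)
qed

lemma norm_slice: "norm (e, \<Sum>i\<in>I. a i *\<^sub>R p i) \<le> M * size_aug I e a"
proof -
  have "norm (\<Sum>i\<in>I. a i *\<^sub>R p i) \<le> (\<Sum>i\<in>I. M * \<bar>a i\<bar>)"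
    by (rule sum_norm_le) (use norm_le_M mult_left_mono in \<open>fastforce simp: mult.commute\<close>)
  moreover have "norm e \<le> M * norm e" using mult_right_mono[OF M_ge_1, of "norm e"] by simp
  moreover have "norm (e, \<Sum>i\<in>I. a i *\<^sub>R p i) \<le> norm e + norm (\<Sum>i\<in>I. a i *\<^sub>R p i)" by (rule norm_Pair_le)
  ultimately show ?thesis by (simp add: size_aug_def distrib_left sum_distrib_left)
qed

lemma extended_system_eq: "extended_system w e a = D w (e, \<Sum>i\<in>I. a i *\<^sub>R p i)"
proof -
  have "(\<Sum>i\<in>I. a i *\<^sub>R (0 :: 'e, p i)) = (0, \<Sum>i\<in>I. a i *\<^sub>R p i)"
    by (simp add: prod_eq_iff fst_sum snd_sum)
  then have "(\<Sum>i\<in>I. a i *\<^sub>R D w (0, p i)) = D w (0, \<Sum>i\<in>I. a i *\<^sub>R p i)"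
    by (simp add: blinfun.scaleR_right[symmetric] blinfun.sum_right[symmetric])
  then show ?thesis by (simp add: aug_def blinfun.add_right[symmetric])
qed

lemma \<rho>: "\<rho> > 0" "cball w0 \<rho> \<subseteq> W" "w \<in> cball w0 \<rho> \<Longrightarrow> norm (D w - D w0) \<le> \<eta>"
proof -
  obtain r1 where r1: "r1 > 0" "cball w0 r1 \<subseteq> W" using W w0 open_contains_cball by blast
  have "isCont D w0" using w0 W cont by (simp add: continuous_on_eq_continuous_at)
  then obtain r2 where r2: "r2 > 0" "\<And>w. dist w w0 < r2 \<Longrightarrow> dist (D w) (D w0) < \<eta>"
    using \<eta>(1) by (metis continuous_at_eps_delta)
  have "\<exists>\<rho>. \<rho> > 0 \<and> cball w0 \<rho> \<subseteq> W \<and> (\<forall>w\<in>cball w0 \<rho>. norm (D w - D w0) \<le> \<eta>)"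
  proof (intro exI[of _ "min r1 (r2 / 2)"] conjI ballI)
    fix w assume "w \<in> cball w0 (min r1 (r2/2))"
    then have "dist w w0 < r2" using r2(1) by (simp add: dist_commute)
    then show "norm (D w - D w0) \<le> \<eta>" using r2(2) by (simp add: dist_norm less_imp_le)
  qed (use r1 r2 in auto)
  from someI_ex[OF this]
  show "\<rho> > 0" "cball w0 \<rho> \<subseteq> W" "w \<in> cball w0 \<rho> \<Longrightarrow> norm (D w - D w0) \<le> \<eta>"
    unfolding \<rho>_def[symmetric] by auto
qed

lemma iso_near:
  assumes w: "w \<in> cball w0 \<rho>"
  shows "aug_iso (2 * C) (D w o\<^sub>L inl_blinfun) I (\<lambda>i. D w (0, p i)) K \<kappa>"
proof (rule aug_iso_perturb[OF fin(1) C iso, where \<eta>="\<eta> * M"])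
  fix e a
  have "norm (extended_system w e a - extended_system w0 e a) \<le> norm (D w - D w0) * norm (e, \<Sum>i\<in>I. a i *\<^sub>R p i)"
    unfolding extended_system_eq by (simp add: blinfun.diff_left[symmetric] norm_blinfun)
  also have "\<dots> \<le> \<eta> * (M * size_aug I e a)"
    by (intro mult_mono \<rho> w norm_slice) (use \<eta> in auto)
  finally show "norm (extended_system w e a - extended_system w0 e a) \<le> \<eta> * M * size_aug I e a" by simp
qed (use \<eta> in auto)

text \<open>This application of the mean value inequality to two zeros takes the place of the
  implicit function theorem in both bounds below.\<close>

lemma zeros_close:
  assumes "w \<in> cball w0 \<rho>" "w' \<in> cball w0 \<rho>" "\<Phi> w = 0" "\<Phi> w' = 0"
  shows "norm (D w0 (w - w')) \<le> \<eta> * norm (w - w')"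
proof -
  have "norm (\<Phi> w - \<Phi> w' - D w0 (w - w')) \<le> \<eta> * norm (w - w')"
    by (rule linearization_error[where S="cball w0 \<rho>" and D=D])
       (use assms \<rho> deriv in \<open>auto simp del: mem_cball\<close>)
  then show ?thesis using assms by simp
qed

text \<open>For arbitrary parameters: the parameter is treated as data, and \<open>e\<close> is
  controlled by it and by \<kappa>. This makes the projection of \<open>Crit\<close> to the
  parameters proper.\<close>

lemma zeros_bound:
  assumes "(e, l) \<in> cball w0 \<rho>" "(e', l') \<in> cball w0 \<rho>" "\<Phi> (e, l) = 0" "\<Phi> (e', l') = 0"
  shows "norm (e - e') \<le> 2 * C * ((\<eta> + norm (D w0)) * norm (l - l') + (\<Sum>k\<in>K. \<bar>\<kappa> k e - \<kappa> k e'\<bar>))"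
proof -
  define x and y where "x = e - e'" and "y = l - l'"
  have "norm (D w0 (x, y)) \<le> \<eta> * norm (x, y)"
    using zeros_close[OF assms] by (simp add: x_def y_def)
  also have "\<dots> \<le> \<eta> * (norm x + norm y)" using \<eta> by (intro mult_left_mono norm_Pair_le) auto
  finally have 1: "norm (D w0 (x, y)) \<le> \<eta> * (norm x + norm y)" .
  have "D w0 (x, 0) = D w0 (x, y) - D w0 (0, y)" by (simp add: blinfun.diff_right[symmetric])
  then have "norm (D w0 (x, 0)) \<le> norm (D w0 (x, y)) + norm (D w0 (0, y))"
    using norm_triangle_ineq4 by metis
  also have "norm (D w0 (0, y)) \<le> norm (D w0) * norm y"
    using norm_blinfun[of "D w0" "(0, y)"] by (simp add: norm_Pair)
  finally have 2: "norm (D w0 (x, 0)) \<le> \<eta> * norm x + (\<eta> + norm (D w0)) * norm y"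
    using 1 by (simp add: algebra_simps)
  have "norm x \<le> C * (norm (D w0 (x, 0)) + (\<Sum>k\<in>K. \<bar>\<kappa> k x\<bar>))"
    using aug_iso_bound[OF iso, of x "\<lambda>_. 0"] by (simp add: aug_def size_aug_def)
  also have "\<dots> \<le> C * ((\<eta> * norm x + (\<eta> + norm (D w0)) * norm y) + (\<Sum>k\<in>K. \<bar>\<kappa> k x\<bar>))"
    using 2 C by (intro mult_left_mono add_right_mono) auto
  also have "\<dots> = (\<eta> * C) * norm x + C * ((\<eta> + norm (D w0)) * norm y + (\<Sum>k\<in>K. \<bar>\<kappa> k x\<bar>))"
    by (simp add: algebra_simps)
  also have "(\<eta> * C) * norm x \<le> 1/2 * norm x" using \<eta> by (intro mult_right_mono) auto
  finally show ?thesis by (simp add: x_def y_def blinfun.diff_right)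
qed

text \<open>On a slice the displacement of the parameter is itself an unknown \<open>a\<close> of
  the bordered operator, so it is controlled together with \<open>e\<close> by \<kappa>
  alone.\<close>

lemma slice_zeros_bound:
  assumes "(e, l) \<in> cball w0 \<rho>" "(e', l') \<in> cball w0 \<rho>" "\<Phi> (e, l) = 0" "\<Phi> (e', l') = 0"
    and l: "l - l' = (\<Sum>i\<in>I. a i *\<^sub>R p i)"
  shows "size_aug I (e - e') a \<le> 2 * C * (\<Sum>k\<in>K. \<bar>\<kappa> k e - \<kappa> k e'\<bar>)"
proof -
  let ?s = "size_aug I (e - e') a" and ?k = "\<Sum>k\<in>K. \<bar>\<kappa> k (e - e')\<bar>"
  have "norm (extended_system w0 (e - e') a) \<le> \<eta> * norm (e - e', \<Sum>i\<in>I. a i *\<^sub>R p i)"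
    using zeros_close[OF assms(1-4)] by (simp add: extended_system_eq l)
  also have "\<dots> \<le> \<eta> * (M * ?s)" using \<eta> by (intro mult_left_mono norm_slice) auto
  finally have 1: "norm (extended_system w0 (e - e') a) \<le> \<eta> * (M * ?s)" .
  have "?s \<le> C * (norm (extended_system w0 (e - e') a) + ?k)" by (rule aug_iso_bound[OF iso])
  also have "\<dots> \<le> C * (\<eta> * (M * ?s) + ?k)" using 1 C by (intro mult_left_mono add_right_mono) auto
  also have "\<dots> = (\<eta> * M * C) * ?s + C * ?k" by (simp add: algebra_simps)
  also have "(\<eta> * M * C) * ?s \<le> 1/2 * ?s" using \<eta> by (intro mult_right_mono size_aug_nonneg) auto
  finally show ?thesis by (simp add: blinfun.diff_right)
qed

lemma Crit_D: "w \<in> Crit \<Longrightarrow> w \<in> cball w0 \<rho>" "w \<in> Crit \<Longrightarrow> \<Phi> w = 0"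
  "w \<in> Crit \<Longrightarrow> \<not> surj (blinfun_apply (D w o\<^sub>L inl_blinfun))"
  by (auto simp: Crit_def)

lemma closed_Crit: "closed Crit"
  unfolding closed_sequential_limits
proof (intro allI impI, elim conjE)
  fix w and wl assume w: "\<forall>n. w n \<in> Crit" and lim: "w \<longlonglongrightarrow> wl"
  have wl: "wl \<in> cball w0 \<rho>"
    using closed_sequentially[OF closed_cball _ lim] w Crit_D(1) by blast
  then have "wl \<in> W" using \<rho> by blast
  have "(\<lambda>n. \<Phi> (w n)) \<longlonglongrightarrow> \<Phi> wl"
    using has_derivative_continuous[OF deriv[OF \<open>wl \<in> W\<close>]] lim
    by (rule isCont_tendsto_compose)
  then have "\<Phi> wl = 0" using w Crit_D(2) LIMSEQ_unique[OF _ tendsto_const] by simp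
  moreover have "\<not> surj (blinfun_apply (D wl o\<^sub>L inl_blinfun))"
  proof
    assume "surj (blinfun_apply (D wl o\<^sub>L inl_blinfun))"
    then obtain d where d: "d > 0" "\<And>D'. norm (D' - (D wl o\<^sub>L inl_blinfun)) < d \<Longrightarrow> surj (blinfun_apply D')"
      using surj_perturb by blast
    have "isCont D wl" using \<open>wl \<in> W\<close> W cont by (simp add: continuous_on_eq_continuous_at)
    then have "(\<lambda>n. D (w n)) \<longlonglongrightarrow> D wl" using lim by (rule isCont_tendsto_compose)
    then have "(\<lambda>n. D (w n) o\<^sub>L inl_blinfun) \<longlonglongrightarrow> (D wl o\<^sub>L inl_blinfun)"
      by (intro tendsto_intros)
    then obtain n where "norm ((D (w n) o\<^sub>L inl_blinfun) - (D wl o\<^sub>L inl_blinfun)) < d"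
      using d(1) LIMSEQ_D by blast
    then show False using d(2) w Crit_D(3) by blast
  qed
  ultimately show "wl \<in> Crit" using wl by (simp add: Crit_def)
qed

text \<open>Closed balls of \<open>'e\<close> need not be compact. Compactness comes from the
  finitely many bounded coordinates \<kappa>, and \<open>zeros_bound\<close> transfers the
  convergence to \<open>e\<close>.\<close>

lemma Crit_subsequence:
  assumes w: "\<And>n. (e n, l n) \<in> Crit" and l: "l \<longlonglongrightarrow> ll"
  shows "\<exists>r el. strict_mono r \<and> (e \<circ> r) \<longlonglongrightarrow> el \<and> (el, ll) \<in> Crit"
proof -
  have "bounded (range (\<lambda>n. \<kappa> k (e n)))" for k
  proof -
    have "bounded (range e)"
    proof (rule bounded_subset[OF bounded_fst[OF bounded_cball[of w0 \<rho>]]])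
      show "range e \<subseteq> fst ` cball w0 \<rho>"
        using w Crit_D(1) by (metis fst_conv image_eqI image_subsetI)
    qed
    from bounded_linear_image[OF this blinfun.bounded_linear_right, of "\<kappa> k"]
    show ?thesis by (simp add: image_image)
  qed
  then obtain r where r: "strict_mono r" "\<And>k. k \<in> K \<Longrightarrow> convergent ((\<lambda>n. \<kappa> k (e n)) \<circ> r)"
    using subsequence_convergent_family[OF fin(2), of "\<lambda>k n. \<kappa> k (e n)"] by blast
  have lr: "(l \<circ> r) \<longlonglongrightarrow> ll" by (rule LIMSEQ_subseq_LIMSEQ[OF l r(1)])
  define c where "c = \<eta> + norm (D w0)"
  have c: "c > 0" using \<eta> by (simp add: c_def add_pos_nonneg)
  have "Cauchy (e \<circ> r)"
  proof (rule Cauchy_dominated[OF fin(2)])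
    show "Cauchy (l \<circ> r)" using lr by (rule LIMSEQ_imp_Cauchy)
    show "Cauchy ((\<lambda>n. \<kappa> k (e n)) \<circ> r)" if "k \<in> K" for k
      using r(2)[OF that] by (rule convergent_Cauchy)
    \<comment> \<open>\<open>c + 1\<close> dominates both coefficients in
      \<open>zeros_bound\<close>: \<open>c\<close> of the parameter distance and 1 of the
      \<kappa>-sum.\<close>
    show "2 * C * (c + 1) > 0" using C c by simp
    fix m n
    let ?S = "\<Sum>k\<in>K. \<bar>((\<lambda>n. \<kappa> k (e n)) \<circ> r) m - ((\<lambda>n. \<kappa> k (e n)) \<circ> r) n\<bar>"
    have S: "0 \<le> ?S" by (rule sum_nonneg) simp
    have "dist ((e \<circ> r) m) ((e \<circ> r) n) \<le> 2 * C * (c * dist ((l \<circ> r) m) ((l \<circ> r) n) + ?S)"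
      using zeros_bound[OF Crit_D(1)[OF w] Crit_D(1)[OF w] Crit_D(2)[OF w] Crit_D(2)[OF w]]
      by (simp add: dist_norm c_def)
    also have "\<dots> \<le> 2 * C * ((c + 1) * (dist ((l \<circ> r) m) ((l \<circ> r) n) + ?S))"
    proof (intro mult_left_mono)
      have "0 \<le> c * ?S" using c S by simp
      then show "c * dist ((l \<circ> r) m) ((l \<circ> r) n) + ?S \<le> (c + 1) * (dist ((l \<circ> r) m) ((l \<circ> r) n) + ?S)"
        by (simp add: algebra_simps)
    qed (use C in auto)
    finally show "dist ((e \<circ> r) m) ((e \<circ> r) n) \<le> 2 * C * (c + 1) * (dist ((l \<circ> r) m) ((l \<circ> r) n) + ?S)"
      by (simp add: mult.assoc)
  qed
  then obtain el where el: "(e \<circ> r) \<longlonglongrightarrow> el" using convergent_eq_Cauchy by blast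
  have "(\<lambda>n. ((e \<circ> r) n, (l \<circ> r) n)) \<longlonglongrightarrow> (el, ll)" by (intro tendsto_Pair el lr)
  moreover have "\<And>n. ((e \<circ> r) n, (l \<circ> r) n) \<in> Crit" using w by simp
  ultimately have "(el, ll) \<in> Crit" by (rule closed_sequentially[OF closed_Crit, rotated])
  then show ?thesis using r el by blast
qed

lemma closed_critical_values: "closed (snd ` Crit)"
  unfolding closed_sequential_limits
proof (intro allI impI, elim conjE)
  fix l ll assume "\<forall>n. l n \<in> snd ` Crit" and lim: "l \<longlonglongrightarrow> ll"
  then have "\<forall>n. \<exists>e. (e, l n) \<in> Crit" by force
  then obtain e where "\<And>n. (e n, l n) \<in> Crit" by metis
  from Crit_subsequence[OF this lim] show "ll \<in> snd ` Crit" by force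
qed

text \<open>If the critical values contained a ball, they would contain a cube spanned by the directions
  \<open>p i\<close>. Over this cube the critical points form a compact set, on which the linearization error
  is uniform, and the counting lemma applies with slabs given by \<open>annihilating_covector\<close>.\<close>

lemma interior_critical_values: "interior (snd ` Crit) = {}"
proof (rule ccontr)
  assume "interior (snd ` Crit) \<noteq> {}"
  then obtain l0 d where d: "d > 0" "ball l0 d \<subseteq> snd ` Crit"
    by (meson ex_in_conv mem_interior)
  define P where "P b = (\<Sum>i\<in>I. b i *\<^sub>R p i)" for b
  \<comment> \<open>\<open>\<delta> * M = d / 2\<close> keeps the cube of side \<delta> at
    \<open>l0\<close> inside the ball.\<close>
  define \<delta> where "\<delta> = d / (2 * M)"
  have \<delta>: "\<delta> > 0" using d M_ge_1 by (simp add: \<delta>_def)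
  define Box where "Box = {b :: 'i \<Rightarrow> real. \<forall>i\<in>I. 0 \<le> b i \<and> b i \<le> \<delta>}"
  have cube: "l0 + P b \<in> snd ` Crit" if "b \<in> Box" for b
  proof -
    have "norm (P b) \<le> (\<Sum>i\<in>I. \<delta> * norm (p i))"
      unfolding P_def by (rule sum_norm_le) (use that in \<open>auto simp: Box_def intro!: mult_right_mono\<close>)
    also have "\<dots> \<le> \<delta> * M" using \<delta> by (simp add: M_def sum_distrib_left[symmetric])
    also have "\<dots> < d" using d M_ge_1 by (simp add: \<delta>_def)
    finally show ?thesis using d by (auto simp: dist_norm)
  qed
  define Z where "Z = {(e, l). (e, l) \<in> Crit \<and> (\<exists>b\<in>Box. l = l0 + P b)}"
  have "compact Z"
    unfolding compact_def
  proof (intro allI impI)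
    fix f :: "nat \<Rightarrow> 'e \<times> 'l" assume f: "\<forall>n. f n \<in> Z"
    have "\<exists>b. b \<in> Box \<and> snd (f n) = l0 + P b" for n
      using f[rule_format, of n] by (auto simp: Z_def)
    then obtain b where b: "\<And>n. b n \<in> Box" "\<And>n. snd (f n) = l0 + P (b n)" by metis
    have "bounded (range (\<lambda>n. b n i))" if "i \<in> I" for i
      by (rule bounded_subset[OF bounded_closed_interval[of 0 \<delta>]]) (use b(1) that in \<open>auto simp: Box_def\<close>)
    then obtain r where r: "strict_mono r" "\<forall>i\<in>I. convergent ((\<lambda>n. b n i) \<circ> r)"
      using subsequence_convergent_family[OF fin(1), of "\<lambda>i n. b n i"] by blast
    then have "\<forall>i\<in>I. \<exists>x. (\<lambda>n. b (r n) i) \<longlonglongrightarrow> x" by (simp add: convergent_def o_def)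
    then obtain bl where bl: "\<And>i. i \<in> I \<Longrightarrow> (\<lambda>n. b (r n) i) \<longlonglongrightarrow> bl i" by metis
    have "bl \<in> Box"
      unfolding Box_def
    proof (intro CollectI ballI)
      fix i assume i: "i \<in> I"
      have "\<And>n. b (r n) i \<in> {0..\<delta>}" using b(1) i by (auto simp: Box_def)
      then have "bl i \<in> {0..\<delta>}" using bl[OF i] by (rule closed_sequentially[OF closed_atLeastAtMost])
      then show "0 \<le> bl i \<and> bl i \<le> \<delta>" by simp
    qed
    have "(\<lambda>n. l0 + P (b (r n))) \<longlonglongrightarrow> l0 + P bl"
      unfolding P_def by (intro tendsto_intros bl)
    moreover have "\<And>n. (fst (f (r n)), l0 + P (b (r n))) \<in> Crit"
    proof -
      fix n
      have "f (r n) \<in> Crit" using f[rule_format, of "r n"] by (auto simp: Z_def)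
      then show "(fst (f (r n)), l0 + P (b (r n))) \<in> Crit" by (simp add: b(2)[symmetric])
    qed
    ultimately obtain r' el where r': "strict_mono r'" "((\<lambda>n. fst (f (r n))) \<circ> r') \<longlonglongrightarrow> el" "(el, l0 + P bl) \<in> Crit"
      using Crit_subsequence[of "\<lambda>n. fst (f (r n))" "\<lambda>n. l0 + P (b (r n))" "l0 + P bl"] by blast
    have "((\<lambda>n. l0 + P (b (r n))) \<circ> r') \<longlonglongrightarrow> l0 + P bl"
      by (rule LIMSEQ_subseq_LIMSEQ) (fact | rule r')+
    from tendsto_Pair[OF r'(2) this] have "(f \<circ> (r \<circ> r')) \<longlonglongrightarrow> (el, l0 + P bl)"
      by (simp add: o_def b(2)[symmetric])
    moreover have "(el, l0 + P bl) \<in> Z" using r'(3) \<open>bl \<in> Box\<close> by (auto simp: Z_def)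
    ultimately show "\<exists>l\<in>Z. \<exists>r. strict_mono r \<and> (f \<circ> r) \<longlonglongrightarrow> l"
      using strict_mono_o[OF r(1) r'(1)] by blast
  qed
  have ZW: "Z \<subseteq> W" using Crit_D(1) \<rho> by (auto simp: Z_def)
  \<comment> \<open>The coordinates \<open>b\<close> are kept as data instead of the parameter, so
    that \<open>snd\<close> can serve as the value map of the counting lemma even if the
    \<open>p i\<close> are dependent.\<close>
  define S where "S = {(e, b). b \<in> Box \<and> (e, l0 + P b) \<in> Crit}"
  define N where "N = real (card K)"
  have bound: "size_aug I (fst s - fst s') (\<lambda>i. snd s i - snd s' i) \<le> 2 * C * (N * d)"
    if "s \<in> S" "s' \<in> S" "\<And>k. k \<in> K \<Longrightarrow> \<bar>\<kappa> k (fst s) - \<kappa> k (fst s')\<bar> \<le> d" for s s' d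
  proof -
    have "(fst s, l0 + P (snd s)) \<in> Crit" "(fst s', l0 + P (snd s')) \<in> Crit"
      using that by (auto simp: S_def)
    from slice_zeros_bound[OF Crit_D(1)[OF this(1)] Crit_D(1)[OF this(2)] Crit_D(2)[OF this(1)] Crit_D(2)[OF this(2)]]
    have "size_aug I (fst s - fst s') (\<lambda>i. snd s i - snd s' i) \<le> 2 * C * (\<Sum>k\<in>K. \<bar>\<kappa> k (fst s) - \<kappa> k (fst s')\<bar>)"
      by (simp add: P_def scaleR_diff_left sum_subtractf)
    also have "\<dots> \<le> 2 * C * (\<Sum>k\<in>K. d)" using C that by (intro mult_left_mono sum_mono) auto
    finally show ?thesis by (simp add: N_def)
  qed
  define R where "R = 1 + (\<Sum>k\<in>K. norm (\<kappa> k)) * (norm (fst w0) + \<rho>)"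
  have "(\<Sum>k\<in>K. norm (\<kappa> k)) * (norm (fst w0) + \<rho>) \<ge> 0"
    using \<rho>(1) by (intro mult_nonneg_nonneg sum_nonneg add_nonneg_nonneg) auto
  then have R: "R > 0" by (simp add: R_def)
  show False
  \<comment> \<open>\<open>N\<close> bounds a sum over \<open>K\<close> by its largest term; the
    \<open>+ 1\<close> keeps the Lipschitz constant positive when \<open>K\<close> is empty.\<close>
  proof (rule no_cube_of_critical_values[OF fin card R _ _ _ \<delta>, where S=S and \<kappa>="\<lambda>s k. \<kappa> k (fst s)" and a=snd and L="2 * C * N + 1"])
    fix s k assume s: "s \<in> S" and k: "k \<in> K"
    have "(fst s, l0 + P (snd s)) \<in> cball w0 \<rho>" using s Crit_D(1) by (auto simp: S_def)
    then have "dist (fst w0) (fst s) \<le> \<rho>" using dist_fst_le[of w0 "(fst s, l0 + P (snd s))"] by simp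
    then have "norm (fst s) \<le> norm (fst w0) + \<rho>"
      using norm_triangle_ineq2[of "fst s" "fst w0"] by (simp add: dist_norm norm_minus_commute)
    moreover have "norm (\<kappa> k) \<le> (\<Sum>k\<in>K. norm (\<kappa> k))" using fin k by (intro member_le_sum) auto
    moreover have "\<bar>\<kappa> k (fst s)\<bar> \<le> norm (\<kappa> k) * norm (fst s)" using norm_blinfun[of "\<kappa> k" "fst s"] by simp
    ultimately have "\<bar>\<kappa> k (fst s)\<bar> \<le> (\<Sum>k\<in>K. norm (\<kappa> k)) * (norm (fst w0) + \<rho>)"
      by (meson mult_mono norm_ge_zero order_trans sum_nonneg)
    then show "\<bar>\<kappa> k (fst s)\<bar> \<le> R" by (simp add: R_def)
  next
    show "0 < 2 * C * N + 1" using C by (simp add: N_def add_nonneg_pos)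
  next
    fix s s' d i assume s: "s \<in> S" "s' \<in> S" and k: "\<And>k. k \<in> K \<Longrightarrow> \<bar>\<kappa> k (fst s) - \<kappa> k (fst s')\<bar> \<le> d" and i: "i \<in> I"
    have "K \<noteq> {}" using i fin card by auto
    then have "d \<ge> 0" using k abs_ge_zero order_trans by blast
    have "\<bar>snd s i - snd s' i\<bar> \<le> size_aug I (fst s - fst s') (\<lambda>i. snd s i - snd s' i)"
      using coord_le_size_aug[OF fin(1) i, of "\<lambda>i. snd s i - snd s' i"] .
    also have "\<dots> \<le> 2 * C * (N * d)" using s k by (rule bound)
    also have "\<dots> \<le> (2 * C * N + 1) * d" using \<open>d \<ge> 0\<close> by (simp add: algebra_simps)
    finally show "\<bar>snd s i - snd s' i\<bar> \<le> (2 * C * N + 1) * d" .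
  next
    fix b :: "'i \<Rightarrow> real" assume "\<And>i. i \<in> I \<Longrightarrow> 0 \<le> b i \<and> b i \<le> \<delta>"
    then have b: "b \<in> Box" by (simp add: Box_def)
    then obtain e where "(e, l0 + P b) \<in> Crit" using cube[OF b] by force
    then have "(e, b) \<in> S" using b by (simp add: S_def)
    then show "\<exists>s\<in>S. \<forall>i\<in>I. snd s i = b i" by force
  next
    fix \<epsilon> :: real assume \<epsilon>: "\<epsilon> > 0"
    \<comment> \<open>Zeros whose \<kappa>-coordinates differ by at most \<open>r\<close> have
      distance at most \<open>Q * r\<close>. The choice of \<open>\<epsilon>'\<close> then allows
      for the linearization error over this distance and for the constant \<open>2 * C\<close> of
      \<open>iso_near\<close>.\<close>
    define Q where "Q = 2 * C * N * M + 1"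
    have Q: "Q > 0" using C M_ge_1 by (simp add: Q_def N_def add_nonneg_pos)
    define \<epsilon>' where "\<epsilon>' = \<epsilon> / (2 * C * Q)"
    have \<epsilon>': "\<epsilon>' > 0" using \<epsilon> C Q by (simp add: \<epsilon>'_def)
    obtain r1 where r1: "r1 > 0" "\<And>w w'. w \<in> Z \<Longrightarrow> dist w w' < r1 \<Longrightarrow> dist (D w') (D w) < \<epsilon>'"
      using uniform_modulus_near_compact[OF \<open>compact Z\<close> ZW W cont \<epsilon>'] by metis
    show "\<exists>r0>0. \<forall>r. 0 < r \<and> r < r0 \<longrightarrow> (\<forall>s\<in>S. \<exists>c. \<exists>i0\<in>I. \<bar>c i0\<bar> = 1 \<and>
       (\<forall>s'\<in>S. (\<forall>k\<in>K. \<bar>\<kappa> k (fst s') - \<kappa> k (fst s)\<bar> \<le> r) \<longrightarrow> \<bar>\<Sum>i\<in>I. c i * (snd s' i - snd s i)\<bar> \<le> \<epsilon> * r))"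
    proof (intro exI[of _ "r1 / Q"] conjI allI impI ballI)
      show "0 < r1 / Q" using r1 Q by simp
      fix r s assume r: "0 < r \<and> r < r1 / Q" and s: "s \<in> S"
      define w where "w = (fst s, l0 + P (snd s))"
      have w: "w \<in> Crit" "w \<in> Z" using s by (auto simp: S_def Z_def w_def)
      have wc: "w \<in> cball w0 \<rho>" by (rule Crit_D(1)[OF w(1)])
      have gen: "\<exists>e a. extended_system w e a = y" for y using iso_near[OF wc] by (auto simp: aug_iso_def) metis
      obtain c i0 where c: "i0 \<in> I" "\<bar>c i0\<bar> = 1" "\<And>i. i \<in> I \<Longrightarrow> \<bar>c i\<bar> \<le> 1"
        "\<And>e a. extended_system w e a = 0 \<Longrightarrow> (\<Sum>i\<in>I. c i * a i) = 0"
        using annihilating_covector[OF fin(1) Crit_D(3)[OF w(1)] gen] by metis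
      have "\<bar>\<Sum>i\<in>I. c i * (snd s' i - snd s i)\<bar> \<le> \<epsilon> * r"
        if s': "s' \<in> S" and close: "\<forall>k\<in>K. \<bar>\<kappa> k (fst s') - \<kappa> k (fst s)\<bar> \<le> r" for s'
      proof -
        define w' where "w' = (fst s', l0 + P (snd s'))"
        have w': "w' \<in> Crit" using s' by (auto simp: S_def w'_def)
        define \<Delta> where "\<Delta> = (\<lambda>i. snd s' i - snd s i)"
        have diff: "w' - w = (fst s' - fst s, \<Sum>i\<in>I. \<Delta> i *\<^sub>R p i)"
          by (simp add: w'_def w_def \<Delta>_def P_def scaleR_diff_left sum_subtractf)
        have "norm (w' - w) \<le> M * size_aug I (fst s' - fst s) \<Delta>" unfolding diff by (rule norm_slice)
        also have "\<dots> \<le> M * (2 * C * (N * r))"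
          unfolding \<Delta>_def using close M_ge_1 by (intro mult_left_mono bound s s') auto
        also have "\<dots> \<le> Q * r" using r by (simp add: Q_def algebra_simps)
        finally have nd: "norm (w' - w) \<le> Q * r" .
        also have "\<dots> < r1" using r Q by (simp add: field_simps)
        finally have "norm (w' - w) < r1" .
        have "norm (\<Phi> w' - \<Phi> w - D w (w' - w)) \<le> \<epsilon>' * norm (w' - w)"
        \<comment> \<open>The intersection of the two balls is convex, contains \<open>w\<close> and
          \<open>w'\<close>, lies in \<open>W\<close>, and stays within \<open>r1\<close> of
          \<open>w\<close>.\<close>
        proof (rule linearization_error[where S="cball w (dist w w') \<inter> cball w0 \<rho>" and D=D])
          fix u assume u: "u \<in> cball w (dist w w') \<inter> cball w0 \<rho>"
          then show "(\<Phi> has_derivative D u) (at u)" using \<rho> by (intro deriv) blast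
          have "dist w u < r1" using u \<open>norm (w' - w) < r1\<close> by (simp add: dist_norm norm_minus_commute)
          then show "norm (D u - D w) \<le> \<epsilon>'" using r1(2)[OF w(2), of u] by (simp add: dist_norm)
        qed (use wc Crit_D(1)[OF w'] in \<open>auto intro!: convex_Int\<close>)
        then have small: "norm (D w (w' - w)) \<le> \<epsilon>' * norm (w' - w)"
          using Crit_D(2)[OF w(1)] Crit_D(2)[OF w'] by simp
        \<comment> \<open>The displacement solves the linearized equation up to a small error.
          Subtracting the small pair \<open>(e, a)\<close> with the same error puts it into the
          kernel, where the covector \<open>c\<close> vanishes.\<close>
        obtain e a where ea: "extended_system w e a = D w (w' - w)" "size_aug I e a \<le> 2 * C * norm (D w (w' - w))"
          using aug_iso_solve[OF iso_near[OF wc]] by metis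
        have "extended_system w (fst s' - fst s - e) (\<lambda>i. \<Delta> i - a i) = 0"
          unfolding aug_diff ea(1) unfolding extended_system_eq diff by simp
        then have "(\<Sum>i\<in>I. c i * (\<Delta> i - a i)) = 0" by (rule c(4))
        then have "(\<Sum>i\<in>I. c i * \<Delta> i) = (\<Sum>i\<in>I. c i * a i)" by (simp add: right_diff_distrib sum_subtractf)
        then have "\<bar>\<Sum>i\<in>I. c i * \<Delta> i\<bar> \<le> (\<Sum>i\<in>I. \<bar>c i * a i\<bar>)" by simp
        also have "\<dots> \<le> (\<Sum>i\<in>I. \<bar>a i\<bar>)"
          using c(3) by (intro sum_mono) (simp add: abs_mult mult_left_le_one_le)
        also have "\<dots> \<le> size_aug I e a" by (simp add: size_aug_def)
        also have "\<dots> \<le> 2 * C * (\<epsilon>' * (Q * r))"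
        proof -
          have "norm (D w (w' - w)) \<le> \<epsilon>' * (Q * r)"
            using small nd \<epsilon>' by (meson less_imp_le mult_left_mono order_trans)
          then have "2 * C * norm (D w (w' - w)) \<le> 2 * C * (\<epsilon>' * (Q * r))"
            using C by (intro mult_left_mono) auto
          then show ?thesis using ea(2) by linarith
        qed
        also have "\<dots> = \<epsilon> * r" using C Q by (simp add: \<epsilon>'_def)
        finally show ?thesis by (simp add: \<Delta>_def)
      qed
      then show "\<exists>c. \<exists>i0\<in>I. \<bar>c i0\<bar> = 1 \<and>
       (\<forall>s'\<in>S. (\<forall>k\<in>K. \<bar>\<kappa> k (fst s') - \<kappa> k (fst s)\<bar> \<le> r) \<longrightarrow> \<bar>\<Sum>i\<in>I. c i * (snd s' i - snd s i)\<bar> \<le> \<epsilon> * r)"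
        using c(1,2) by blast
    qed
  qed
qed

lemma critical_values_nowhere_dense:
  obtains N B where "open N" "w0 \<in> N" "closed B" "interior B = {}"
    "\<And>e l. (e, l) \<in> N \<Longrightarrow> \<Phi> (e, l) = 0 \<Longrightarrow> \<not> surj (\<lambda>e'. D (e, l) (e', 0)) \<Longrightarrow> l \<in> B"
proof (rule that[of "ball w0 \<rho>" "snd ` Crit"])
  fix e l assume "(e, l) \<in> ball w0 \<rho>" "\<Phi> (e, l) = 0" "\<not> surj (\<lambda>e'. D (e, l) (e', 0))"
  then have "(e, l) \<in> Crit" by (auto simp: Crit_def)
  then show "l \<in> snd ` Crit" by force
qed (use \<rho> closed_critical_values interior_critical_values in auto)

end

subsection \<open>The linearized system at a singular point\<close>

text \<open>By the first row, \<open>range L\<close> and \<open>a\<close> span the target, so the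
  codimension is at most 1, and index 0 with \<open>v \<noteq> 0\<close> makes the kernel a line. A
  functional that kills \<open>range L\<close> and \<open>a\<close> is 0, which is (T2). For (T3),
  solve with first component 0 and second component \<open>y\<close>, where
  \<open>l y \<noteq> 0\<close>: then \<open>t = 0\<close>, \<open>x = s *\<^sub>R v\<close>, and
  \<open>l y = s * l (B v)\<close>.\<close>

lemma transversality_of_surj:
  fixes L B :: "'x::banach \<Rightarrow>\<^sub>L 'y::banach" and a b :: 'y and \<eta> :: "'x \<Rightarrow>\<^sub>L real"
  assumes L: "fredholm L" "fredholm_index L = 0" and v: "v \<noteq> 0" "L v = 0"
    and surj: "\<And>y y' s. \<exists>x t w. L x + t *\<^sub>R a = y \<and> B x + t *\<^sub>R b + L w = y' \<and> \<eta> w = s"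
  shows "dim (kernel L) = 1" "\<And>u. u \<in> kernel L \<Longrightarrow> \<exists>s. u = s *\<^sub>R v"
    "\<And>l. l \<in> kernel (adjoint_blinfun L) \<Longrightarrow> l \<noteq> 0 \<Longrightarrow> l a \<noteq> 0 \<and> l (B v) \<noteq> 0"
proof -
  have onto: "\<exists>x t. y = L x + t *\<^sub>R a" for y using surj[of y 0 0] by metis
  have fd: "fin_dim (kernel L)" "fin_codim (range (blinfun_apply L))" using L by (auto simp: fredholm_def)
  obtain V where V: "complement_of (range L) V" "codim (range L) = dim V"
    by (rule codim_complement[OF subspace_range_blinfun fd(2)]) blast
  obtain \<pi> where \<pi>: "linear \<pi>" "\<And>y. \<pi> y \<in> V" "\<And>y. \<pi> y = 0 \<longleftrightarrow> y \<in> range L" "\<And>v. v \<in> V \<Longrightarrow> \<pi> v = v"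
    by (rule complement_projection[OF subspace_range_blinfun V(1)]) blast
  have "V \<subseteq> span {\<pi> a}"
  proof
    fix y assume y: "y \<in> V"
    obtain x t where xt: "y = L x + t *\<^sub>R a" using onto by blast
    have "y = \<pi> (L x + t *\<^sub>R a)" using \<pi>(4)[OF y] xt by simp
    also have "\<dots> = t *\<^sub>R \<pi> a" using \<pi>(3)[of "L x"] by (simp add: linear_add[OF \<pi>(1)] linear_scale[OF \<pi>(1)])
    finally show "y \<in> span {\<pi> a}" by (metis span_base span_scale insertI1)
  qed
  then have "dim V \<le> 1" using dim_le_card[of V "{\<pi> a}"] by simp
  then have le: "dim (kernel L) \<le> 1" using L(2) V(2) by (simp add: fredholm_index_def)
  obtain K where K: "finite K" "independent K" "span K = kernel L" "card K = dim (kernel L)"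
    using fin_dim_basis[OF subspace_kernel fd(1)] .
  have vk: "v \<in> kernel L" using v by (simp add: kernel_def)
  have "K \<noteq> {}" using K vk v by auto
  then have "card K \<noteq> 0" using K(1) by simp
  then have "card K = 1" using le K(4) by linarith
  then show "dim (kernel L) = 1" using K by simp
  obtain k where k: "K = {k}" using \<open>card K = 1\<close> by (rule card_1_singletonE)
  have "v \<in> span {k}" using vk K(3) k by simp
  then obtain r where r: "v = r *\<^sub>R k" by (auto simp: span_singleton)
  show multiple: "\<exists>s. u = s *\<^sub>R v" if "u \<in> kernel L" for u
  proof -
    have "u \<in> span {k}" using that K(3) k by simp
    then obtain q where "u = q *\<^sub>R k" by (auto simp: span_singleton)
    then show ?thesis using r v by (intro exI[of _ "q / r"]) auto
  qed
  fix l assume l: "l \<in> kernel (adjoint_blinfun L)" "l \<noteq> 0"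
  have lL: "l (L x) = 0" for x
  proof -
    have "adjoint_blinfun L l = 0" using l by (simp add: kernel_def)
    then have "l o\<^sub>L L = 0" by (simp add: adjoint_blinfun.rep_eq)
    then show ?thesis by (metis blinfun_apply_blinfun_compose zero_blinfun.rep_eq)
  qed
  have "\<exists>y. l y \<noteq> 0" using l(2) by (metis blinfun_eqI zero_blinfun.rep_eq)
  then obtain y where y: "l y \<noteq> 0" by blast
  have la: "l a \<noteq> 0"
  proof
    assume "l a = 0"
    obtain x t where "y = L x + t *\<^sub>R a" using onto by blast
    then show False using y \<open>l a = 0\<close> by (simp add: blinfun.add_right blinfun.scaleR_right lL)
  qed
  obtain x t w where xtw: "L x + t *\<^sub>R a = 0" "B x + t *\<^sub>R b + L w = y" using surj by blast
  have "l (L x + t *\<^sub>R a) = 0" using xtw by (simp add: blinfun.zero_right)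
  then have "t = 0" using la by (simp add: blinfun.add_right blinfun.scaleR_right lL)
  then have "x \<in> kernel L" using xtw by (simp add: kernel_def)
  then obtain s where "x = s *\<^sub>R v" using multiple by blast
  then have "l y = s * l (B v)"
    using xtw(2) \<open>t = 0\<close> by (auto simp: blinfun.add_right blinfun.scaleR_right lL)
  then show "l a \<noteq> 0 \<and> l (B v) \<noteq> 0" using y la by auto
qed

text \<open>The first family of parameter directions, \<open>(c, 0)\<close>, spans the cokernel of \<open>L\<close> in the first
  equation. The second one, \<open>(- J (z c), z c)\<close>, leaves the first equation unchanged and spans the
  cokernel in the second equation; it exists by the surjectivity hypothesis on \<open>(L, S)\<close>.\<close>

lemma extended_system_aug_iso:
  fixes L B :: "'x::banach \<Rightarrow>\<^sub>L 'y::banach" and a b :: 'y and S J :: "'z::banach \<Rightarrow>\<^sub>L 'y"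
  assumes L: "fredholm L" "fredholm_index L = 0" and v: "v \<noteq> 0" "L v = 0"
    and gen: "\<And>y. \<exists>w z. y = L w + S z"
  obtains \<eta> :: "'x \<Rightarrow>\<^sub>L real" where "\<eta> v = 1"
    "\<And>D :: (('x \<times> real \<times> 'x) \<times> ('y \<times> 'z)) \<Rightarrow>\<^sub>L ('y \<times> 'y \<times> real).
       (\<And>x t w y z. blinfun_apply D ((x, t, w), (y, z)) =
          (L x + t *\<^sub>R a + y + J z, B x + t *\<^sub>R b + L w + S z, \<eta> w)) \<Longrightarrow>
       \<exists>(I :: ('y + 'y) set) p (K :: ('x + 'x) set) (\<kappa> :: 'x + 'x \<Rightarrow> ('x \<times> real \<times> 'x) \<Rightarrow>\<^sub>L real) C. finite I \<and> finite K \<and> card K = card I \<and> C > 0 \<and>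
         aug_iso C (D o\<^sub>L inl_blinfun) I (\<lambda>i. blinfun_apply D (0, p i)) K \<kappa>"
proof -
  obtain K I \<beta> C where K: "finite K" "finite I" "span K = kernel L"
    "card K = dim (kernel L)" "card I = codim (range (blinfun_apply L))"
    and \<beta>: "\<And>k l. k \<in> K \<Longrightarrow> l \<in> K \<Longrightarrow> blinfun_apply (\<beta> k) l = (if k = l then 1 else 0)"
    and iso: "aug_iso C L I (\<lambda>c. c) K \<beta>"
    by (rule fredholm_aug_iso[OF L(1)]) blast
  have card: "card K = card I" using L(2) K by (simp add: fredholm_index_def)
  have LK: "L k = 0" if "k \<in> K" for k using span_base[OF that] K by (auto simp: kernel_def)
  have uniq: "x = 0 \<and> (\<forall>c\<in>I. q c = 0)" if "aug L I (\<lambda>c. c) x q = 0" "annihilated K \<beta> x" for x q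
  proof -
    have *: "size_aug I x q \<le> 0"
      using aug_iso_bound[OF iso, of x q] that by (simp add: annihilated_def)
    then have "norm x \<le> 0" using norm_le_size_aug order_trans by blast
    moreover have "\<bar>q i\<bar> \<le> 0" if "i \<in> I" for i
      using coord_le_size_aug[OF K(2) that] * order_trans by blast
    ultimately show ?thesis by auto
  qed
  define P where "P x = (\<Sum>k\<in>K. \<beta> k x *\<^sub>R k)" for x
  have LP: "L (P x) = 0" for x by (simp add: P_def blinfun.sum_right blinfun.scaleR_right LK)
  have \<beta>P: "\<beta> k (P x) = \<beta> k x" if "k \<in> K" for k x
    using K(1) that by (simp add: P_def blinfun.sum_right blinfun.scaleR_right \<beta> if_distrib sum.delta cong: if_cong sum.cong)
  have "\<exists>k0\<in>K. \<beta> k0 v \<noteq> 0"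
  proof (rule ccontr)
    assume "\<not> ?thesis"
    then have "annihilated K \<beta> v" by (auto simp: annihilated_def)
    then show False using uniq[of v "\<lambda>_. 0"] v by (simp add: aug_def)
  qed
  then obtain k0 where k0: "k0 \<in> K" "\<beta> k0 v \<noteq> 0" by blast
  \<comment> \<open>\<eta> is fixed before \<open>D\<close>, because the nonlinear system whose
    differential will be \<open>D\<close> already contains it.\<close>
  define \<eta> where "\<eta> = (1 / \<beta> k0 v) *\<^sub>R \<beta> k0"
  have \<eta>: "\<eta> w = \<beta> k0 w / \<beta> k0 v" for w by (simp add: \<eta>_def blinfun.scaleR_left)
  have "\<forall>c. \<exists>r z. c = L r + S z" using gen by blast
  then obtain r z where rz: "\<And>c. c = L (r c) + S (z c)" by metis
  then have Sz: "S (z c) = c - L (r c)" for c by (metis add_diff_cancel_left')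
  show thesis
  proof (rule that)
    show "\<eta> v = 1" using k0 by (simp add: \<eta>)
    fix D :: "(('x \<times> real \<times> 'x) \<times> ('y \<times> 'z)) \<Rightarrow>\<^sub>L ('y \<times> 'y \<times> real)"
    assume D: "\<And>x t w y z. D ((x, t, w), (y, z)) =
          (L x + t *\<^sub>R a + y + J z, B x + t *\<^sub>R b + L w + S z, \<eta> w)"
    define p where "p = case_sum (\<lambda>c. (c, 0)) (\<lambda>c. (- J (z c), z c))"
    \<comment> \<open>In the unknown \<open>w\<close> the coordinate \<open>\<beta> k0\<close> is
      already prescribed by the equation for \<eta>; its place among the functionals goes to
      \<open>t\<close>. This keeps the number of functionals equal to the number of
      directions.\<close>
    define \<kappa> where "\<kappa> = case_sum (\<lambda>k. \<beta> k o\<^sub>L fst_blinfun)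
      (\<lambda>k. if k = k0 then fst_blinfun o\<^sub>L snd_blinfun else \<beta> k o\<^sub>L snd_blinfun o\<^sub>L (snd_blinfun :: ('x \<times> real \<times> 'x) \<Rightarrow>\<^sub>L (real \<times> 'x)))"
    define u where "u = case_sum (\<lambda>k::'x. (k, 0::real, 0::'x)) (\<lambda>k. if k = k0 then (0, 1, 0) else (0, 0, k))"
    have \<kappa>: "\<kappa> (Inl k) (x, t, w) = \<beta> k x" "\<kappa> (Inr k) (x, t, w) = (if k = k0 then t else \<beta> k w)" for k x t w
      by (simp_all add: \<kappa>_def)
    have p: "D (0, p (Inl c)) = (c, 0, 0)" "D (0, p (Inr c)) = (0, c - L (r c), 0)" for c
      using D[of 0 0 0] by (simp_all add: p_def zero_prod_def blinfun.zero_right Sz blinfun.minus_right)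
    have sys: "aug (D o\<^sub>L inl_blinfun) (I <+> I) (\<lambda>i. D (0, p i)) (x, t, w) q =
        (L x + t *\<^sub>R a + (\<Sum>c\<in>I. q (Inl c) *\<^sub>R c),
         B x + t *\<^sub>R b + L w + (\<Sum>c\<in>I. q (Inr c) *\<^sub>R (c - L (r c))), \<eta> w)" for x t w q
    proof -
      have "(\<Sum>i\<in>I <+> I. q i *\<^sub>R D (0, p i)) =
        (\<Sum>c\<in>I. q (Inl c) *\<^sub>R c, \<Sum>c\<in>I. q (Inr c) *\<^sub>R (c - L (r c)), 0)"
        using K(2) by (simp add: sum.Plus p o_def prod_eq_iff fst_sum snd_sum)
      moreover have "D ((x, t, w), 0) = (L x + t *\<^sub>R a, B x + t *\<^sub>R b + L w, \<eta> w)"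
        using D[of x t w 0 0] by (simp add: zero_prod_def blinfun.zero_right)
      ultimately show ?thesis by (simp add: aug_def)
    qed
    have "\<exists>C>0. aug_iso C (D o\<^sub>L inl_blinfun) (I <+> I) (\<lambda>i. D (0, p i)) (K <+> K) \<kappa>"
    proof (rule aug_isoI)
      show "finite (I <+> I)" "finite (K <+> K)" using K by auto
      show "\<kappa> k (u l) = (if k = l then 1 else 0)" if "k \<in> K <+> K" "l \<in> K <+> K" for k l
        using that k0(1) by (auto simp: \<kappa> u_def \<beta> blinfun.zero_right split: if_splits)
    next
      fix y :: "'y \<times> 'y \<times> real"
      obtain y1 y2 s where y: "y = (y1, y2, s)" by (cases y) auto
      obtain x q1 where x: "aug L I (\<lambda>c. c) x q1 = y1" "annihilated K \<beta> x"
        using aug_iso_solve[OF iso] by blast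
      obtain w q2 where w: "aug L I (\<lambda>c. c) w q2 = y2 - B x" "annihilated K \<beta> w"
        using aug_iso_solve[OF iso] by blast
      \<comment> \<open>The columns of the second row are \<open>c - L (r c)\<close> instead of
        \<open>c\<close>. Adding \<open>h - P h\<close> to \<open>w\<close> restores the terms
        \<open>L (r c)\<close> without touching the coordinates \<beta>, and a multiple of
        \<open>k0\<close> adjusts \<eta> inside the kernel.\<close>
      define h where "h = (\<Sum>c\<in>I. q2 c *\<^sub>R r c)"
      define w' where "w' = w + (h - P h) + (s * \<beta> k0 v) *\<^sub>R k0"
      define q where "q = case_sum q1 q2"
      have Lw': "L w' = L w + (\<Sum>c\<in>I. q2 c *\<^sub>R L (r c))"
        by (simp add: w'_def h_def blinfun.add_right blinfun.diff_right blinfun.scaleR_right LP LK[OF k0(1)] blinfun.sum_right)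
      have \<beta>w': "\<beta> k w' = (if k = k0 then s * \<beta> k0 v else 0)" if "k \<in> K" for k
        using w(2) k0(1) that
        by (simp add: w'_def blinfun.add_right blinfun.diff_right blinfun.scaleR_right \<beta>P \<beta> annihilated_def)
      have "aug (D o\<^sub>L inl_blinfun) (I <+> I) (\<lambda>i. D (0, p i)) (x, 0, w') q = y"
        unfolding sys using x(1) w(1) k0
        by (simp add: y q_def aug_def Lw' \<eta> \<beta>w' scaleR_diff_right sum_subtractf algebra_simps)
      moreover have "annihilated (K <+> K) \<kappa> (x, 0, w')"
        using x(2) by (auto simp: annihilated_def \<kappa> \<beta>w')
      ultimately show "\<exists>e q. aug (D o\<^sub>L inl_blinfun) (I <+> I) (\<lambda>i. D (0, p i)) e q = y \<and> annihilated (K <+> K) \<kappa> e"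
        by blast
    next
      fix e :: "'x \<times> real \<times> 'x" and q :: "'y + 'y \<Rightarrow> real"
      assume 0: "aug (D o\<^sub>L inl_blinfun) (I <+> I) (\<lambda>i. D (0, p i)) e q = 0" and ann: "annihilated (K <+> K) \<kappa> e"
      obtain x t w where e: "e = (x, t, w)" by (cases e) auto
      have \<kappa>0: "\<kappa> i (x, t, w) = 0" if "i \<in> K <+> K" for i using ann that by (simp add: annihilated_def e)
      have t: "t = 0" using \<kappa>0[of "Inr k0"] k0(1) by (simp add: \<kappa> InrI)
      have \<beta>x: "annihilated K \<beta> x" using \<kappa>0[OF InlI] by (simp add: annihilated_def \<kappa>)
      have \<beta>w: "\<beta> k w = 0" if "k \<in> K" "k \<noteq> k0" for k using \<kappa>0[OF InrI[OF that(1)]] that by (simp add: \<kappa>)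
      have eqs: "L x + (\<Sum>c\<in>I. q (Inl c) *\<^sub>R c) = 0"
        "B x + L w + (\<Sum>c\<in>I. q (Inr c) *\<^sub>R (c - L (r c))) = 0" "\<eta> w = 0"
        using 0 unfolding e sys t by (simp_all add: prod_eq_iff)
      have 1: "x = 0 \<and> (\<forall>c\<in>I. q (Inl c) = 0)"
        using eqs(1) by (intro uniq[of x "\<lambda>c. q (Inl c)"] \<beta>x) (simp add: aug_def)
      define h where "h = w - (\<Sum>c\<in>I. q (Inr c) *\<^sub>R r c)"
      have "aug L I (\<lambda>c. c) (h - P h) (\<lambda>c. q (Inr c)) = 0"
        using eqs(2) 1
        by (simp add: aug_def h_def blinfun.diff_right blinfun.add_right LP blinfun.sum_right blinfun.scaleR_right
            blinfun.zero_right scaleR_diff_right sum_subtractf algebra_simps)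
      moreover have "annihilated K \<beta> (h - P h)" by (simp add: annihilated_def blinfun.diff_right \<beta>P)
      ultimately have 2: "\<forall>c\<in>I. q (Inr c) = 0" using uniq by blast
      have "L w = 0" using eqs(2) 1 2 by (simp add: blinfun.zero_right)
      moreover have "annihilated K \<beta> w"
        using \<beta>w eqs(3) k0(2) unfolding annihilated_def by (metis \<eta> divide_eq_0_iff)
      ultimately have "w = 0" using uniq[of w "\<lambda>_. 0"] by (simp add: aug_def)
      then show "e = 0 \<and> (\<forall>i\<in>I <+> I. q i = 0)" using 1 2 t by (auto simp: e zero_prod_def)
    qed
    then show "\<exists>(I :: ('y + 'y) set) p (K :: ('x + 'x) set) (\<kappa> :: 'x + 'x \<Rightarrow> ('x \<times> real \<times> 'x) \<Rightarrow>\<^sub>L real) C. finite I \<and> finite K \<and> card K = card I \<and> C > 0 \<and>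
         aug_iso C (D o\<^sub>L inl_blinfun) I (\<lambda>i. D (0, p i)) K \<kappa>"
      using K card by (intro exI[of _ "I <+> I"] exI[of _ p] exI[of _ "K <+> K"] exI[of _ \<kappa>])
        (auto simp: card_Plus)
  qed
qed

text \<open>Index 0 leaves a complement of dimension 0, so \<open>L\<close> is onto, and the open
  mapping theorem bounds the inverse. By contraposition every singular point carries a vector
  \<open>v\<close>.\<close>

lemma invertible_of_trivial_kernel:
  fixes L :: "'a::banach \<Rightarrow>\<^sub>L 'b::banach"
  assumes L: "fredholm L" "fredholm_index L = 0" and ker: "\<And>v. L v = 0 \<Longrightarrow> v = 0"
  shows "invertible_blinfun L"
proof -
  have "kernel L = {0}" using ker by (auto simp: kernel_def blinfun.zero_right)
  then have "dim (kernel L) = 0" using dim_le_card[of "{0}" "{}"] by simp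
  moreover have fc: "fin_codim (range (blinfun_apply L))" using L by (simp add: fredholm_def)
  obtain V where V: "complement_of (range L) V" "fin_dim V" "codim (range L) = dim V"
    by (rule codim_complement[OF subspace_range_blinfun fc]) blast
  moreover have "subspace V" using V by (simp add: complement_of_def)
  then obtain B where B: "finite B" "span B = V" "card B = dim V"
    by (rule fin_dim_basis[OF _ V(2)]) blast
  ultimately have "V = {0}" using L(2) by (auto simp: fredholm_index_def)
  then have "surj (blinfun_apply L)" using V(1) unfolding complement_of_def surj_def by force
  then obtain C where C: "C > 0" "\<And>y. \<exists>e. L e = y \<and> norm e \<le> C * norm y"
    using surj_open_mapping by blast
  then obtain g where g: "\<And>y. L (g y) = y" "\<And>y. norm (g y) \<le> C * norm y" by metis
  have inj: "u = v" if "L u = L v" for u v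
    using ker[of "u - v"] that by (simp add: blinfun.diff_right)
  have "bounded_linear g"
  proof (rule bounded_linear_intro)
    show "g (x + y) = g x + g y" for x y by (rule inj) (simp add: g blinfun.add_right)
    show "g (r *\<^sub>R x) = r *\<^sub>R g x" for r x by (rule inj) (simp add: g blinfun.scaleR_right)
    show "norm (g x) \<le> norm x * C" for x using g(2)[of x] by (simp add: mult.commute)
  qed
  then have ap: "blinfun_apply (Blinfun g) = g" by (rule bounded_linear_Blinfun_apply)
  have "Blinfun g o\<^sub>L L = id_blinfun"
    by (rule blinfun_eqI) (auto simp: ap g intro: inj)
  moreover have "L o\<^sub>L Blinfun g = id_blinfun"
    by (rule blinfun_eqI) (simp add: ap g)
  ultimately show ?thesis by (auto simp: invertible_blinfun_def)
qed

subsection \<open>Continuously differentiable maps and partial differentials\<close>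

text \<open>Unlike in \<open>C1_on\<close>, the differential is an explicit argument, so that the
  rules below assemble a formula for the differential of the whole system.\<close>

definition has_C1_derivative ::
  "('a::real_normed_vector \<Rightarrow> 'b::real_normed_vector) \<Rightarrow> ('a \<Rightarrow> 'a \<Rightarrow>\<^sub>L 'b) \<Rightarrow> 'a set \<Rightarrow> bool" where
  "has_C1_derivative f f' S \<longleftrightarrow> (\<forall>x\<in>S. (f has_derivative blinfun_apply (f' x)) (at x)) \<and> continuous_on S f'"

lemma frechet_diff_works:
  assumes "f differentiable (at x)"
  shows "(f has_derivative frechet_diff f x) (at x)"
proof -
  have d: "(f has_derivative frechet_derivative f (at x)) (at x)"
    using assms by (simp add: frechet_derivative_works)
  then show ?thesis
    using bounded_linear_Blinfun_apply[OF has_derivative_bounded_linear[OF d]] by (simp add: frechet_diff_def)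
qed

lemma frechet_diff_eq: "(f has_derivative blinfun_apply D) (at x) \<Longrightarrow> frechet_diff f x = D"
  by (simp add: frechet_diff_def frechet_derivative_at[symmetric] blinfun_apply_inverse)

lemma C1_on_iff: "C1_on S f \<longleftrightarrow> has_C1_derivative f (frechet_diff f) S"
  by (auto simp: C1_on_def has_C1_derivative_def differentiable_def intro: frechet_diff_works[unfolded differentiable_def])

lemma has_C1_derivativeD: "has_C1_derivative f f' S \<Longrightarrow> x \<in> S \<Longrightarrow> (f has_derivative f' x) (at x)"
  by (simp add: has_C1_derivative_def)

lemma has_C1_derivative_continuous: "has_C1_derivative f f' S \<Longrightarrow> continuous_on S f"
  using has_derivative_continuous continuous_at_imp_continuous_on
  unfolding has_C1_derivative_def by blast

lemma has_C1_derivative_linear: "has_C1_derivative (blinfun_apply A) (\<lambda>_. A) S"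
  by (simp add: has_C1_derivative_def bounded_linear_imp_has_derivative blinfun.bounded_linear_right)

lemma has_C1_derivative_const: "has_C1_derivative (\<lambda>_. c) (\<lambda>_. 0) S"
  by (simp add: has_C1_derivative_def zero_blinfun.rep_eq)

lemma has_C1_derivative_add:
  assumes "has_C1_derivative f f' S" "has_C1_derivative g g' S"
  shows "has_C1_derivative (\<lambda>x. f x + g x) (\<lambda>x. f' x + g' x) S"
  using assms unfolding has_C1_derivative_def
  by (auto simp: plus_blinfun.rep_eq intro!: has_derivative_add continuous_on_add)

lemma has_C1_derivative_compose_linear:
  assumes f: "has_C1_derivative f f' S" and A: "\<And>w. w \<in> W \<Longrightarrow> blinfun_apply A w \<in> S"
  shows "has_C1_derivative (\<lambda>w. f (A w)) (\<lambda>w. f' (A w) o\<^sub>L A) W"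
  unfolding has_C1_derivative_def
proof (intro conjI ballI)
  fix w assume w: "w \<in> W"
  have "((\<lambda>w. f (A w)) has_derivative (\<lambda>x. f' (A w) (A x))) (at w)"
    by (rule has_derivative_compose[OF bounded_linear_imp_has_derivative[OF blinfun.bounded_linear_right]
          has_C1_derivativeD[OF f A[OF w]]])
  then show "((\<lambda>w. f (A w)) has_derivative (f' (A w) o\<^sub>L A)) (at w)" by (simp add: blinfun_compose.rep_eq o_def)
next
  have "continuous_on W (\<lambda>w. f' (A w))"
    by (rule continuous_on_compose2[of S f']) (use f A in \<open>auto simp: has_C1_derivative_def intro!: continuous_intros\<close>)
  then show "continuous_on W (\<lambda>w. f' (A w) o\<^sub>L A)" by (intro continuous_intros)
qed

lemma has_C1_derivative_apply:
  fixes F :: "'w::real_normed_vector \<Rightarrow> 'a::real_normed_vector \<Rightarrow>\<^sub>L 'b::real_normed_vector"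
    and F' :: "'w \<Rightarrow> 'w \<Rightarrow>\<^sub>L ('a \<Rightarrow>\<^sub>L 'b)" and A :: "'w \<Rightarrow>\<^sub>L 'a"
  assumes F: "has_C1_derivative F F' S"
  shows "has_C1_derivative (\<lambda>w. blinfun_apply (F w) (blinfun_apply A w))
     (\<lambda>w. (blinfun.prod_left (A w) o\<^sub>L F' w) + (F w o\<^sub>L A)) S"
  unfolding has_C1_derivative_def
proof (intro conjI ballI)
  fix w assume w: "w \<in> S"
  have "((\<lambda>w. F w (A w)) has_derivative (\<lambda>h. F w (A h) + (F' w h) (A w))) (at w)"
    by (rule bounded_bilinear.FDERIV[OF bounded_bilinear_blinfun_apply has_C1_derivativeD[OF F w]
          bounded_linear_imp_has_derivative[OF blinfun.bounded_linear_right]])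
  then show "((\<lambda>w. F w (A w)) has_derivative ((blinfun.prod_left (A w) o\<^sub>L F' w) + (F w o\<^sub>L A))) (at w)"
    by (simp add: plus_blinfun.rep_eq blinfun_compose.rep_eq blinfun.prod_left.rep_eq o_def add.commute)
next
  have "continuous_on S F'" "continuous_on S F"
    using F has_C1_derivative_continuous by (auto simp: has_C1_derivative_def)
  then show "continuous_on S (\<lambda>w. (blinfun.prod_left (A w) o\<^sub>L F' w) + (F w o\<^sub>L A))"
    by (intro continuous_intros bounded_linear.continuous_on[OF blinfun.bounded_linear_prod_left])
qed

lift_definition inr_blinfun :: "'b::real_normed_vector \<Rightarrow>\<^sub>L ('a::real_normed_vector \<times> 'b)"
  is "\<lambda>x. (0, x)"
  by (intro bounded_linear_Pair bounded_linear_ident bounded_linear_zero)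

lemmas inr_blinfun_apply [simp] = inr_blinfun.rep_eq

lemma has_C1_derivative_Pair:
  assumes "has_C1_derivative f f' S" "has_C1_derivative g g' S"
  shows "has_C1_derivative (\<lambda>x. (f x, g x)) (\<lambda>x. (inl_blinfun o\<^sub>L f' x) + (inr_blinfun o\<^sub>L g' x)) S"
  unfolding has_C1_derivative_def
proof (intro conjI ballI)
  fix x assume x: "x \<in> S"
  have "((\<lambda>x. (f x, g x)) has_derivative (\<lambda>h. (f' x h, g' x h))) (at x)"
    by (intro has_derivative_Pair has_C1_derivativeD[OF _ x] assms)
  then show "((\<lambda>x. (f x, g x)) has_derivative ((inl_blinfun o\<^sub>L f' x) + (inr_blinfun o\<^sub>L g' x))) (at x)"
    by (simp add: plus_blinfun.rep_eq blinfun_compose.rep_eq o_def)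
next
  show "continuous_on S (\<lambda>x. (inl_blinfun o\<^sub>L f' x) + (inr_blinfun o\<^sub>L g' x))"
    using assms unfolding has_C1_derivative_def by (intro continuous_intros) auto
qed

lemma partial_fst_eq:
  assumes "(h has_derivative blinfun_apply D) (at (x, t))"
  shows "partial_fst h (x, t) = D o\<^sub>L inl_blinfun"
proof -
  have "((\<lambda>x. h (x, t)) has_derivative (\<lambda>v. D (v, 0))) (at x)"
    by (rule has_derivative_compose[of "\<lambda>x. (x, t)" "\<lambda>v. (v, 0)" x UNIV h])
       (use assms in \<open>auto intro!: derivative_eq_intros\<close>)
  then have "((\<lambda>x. h (x, t)) has_derivative (D o\<^sub>L inl_blinfun)) (at x)"
    by (simp add: blinfun_compose.rep_eq o_def)
  then show ?thesis by (simp add: partial_fst_def frechet_diff_eq)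
qed

lemma partial_snd_eq:
  assumes "(h has_derivative blinfun_apply D) (at (x, z))"
  shows "partial_snd h (x, z) = D o\<^sub>L inr_blinfun"
proof -
  have "((\<lambda>z. h (x, z)) has_derivative (\<lambda>v. D (0, v))) (at z)"
    by (rule has_derivative_compose[of "\<lambda>z. (x, z)" "\<lambda>v. (0, v)" z UNIV h])
       (use assms in \<open>auto intro!: derivative_eq_intros\<close>)
  then have "((\<lambda>z. h (x, z)) has_derivative (D o\<^sub>L inr_blinfun)) (at z)"
    by (simp add: blinfun_compose.rep_eq o_def)
  then show ?thesis by (simp add: partial_snd_def frechet_diff_eq)
qed

lemma has_derivative_partial_fst:
  assumes S: "open S" "(x, t) \<in> S" and h: "C1_on S h" "C1_on S (frechet_diff h)"
  shows "(partial_fst h has_derivative (\<lambda>d. frechet_diff (frechet_diff h) (x, t) d o\<^sub>L inl_blinfun)) (at (x, t))"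
proof (rule has_derivative_transform_within_open[OF _ S])
  show "((\<lambda>p. frechet_diff h p o\<^sub>L inl_blinfun) has_derivative
     (\<lambda>d. frechet_diff (frechet_diff h) (x, t) d o\<^sub>L inl_blinfun)) (at (x, t))"
    using h(2) S by (intro bounded_linear.has_derivative[OF bounded_bilinear.bounded_linear_left[OF bounded_bilinear_blinfun_compose]]
        frechet_diff_works) (auto simp: C1_on_def)
  fix p assume "p \<in> S"
  then show "frechet_diff h p o\<^sub>L inl_blinfun = partial_fst h p"
    using h(1) by (cases p) (auto simp: C1_on_def partial_fst_eq[OF frechet_diff_works])
qed

text \<open>The first vector is the direction in which the differential is differentiated, the
  second the one to which it is applied. This turns the iterated partials into blocks of the full
  second differential.\<close>

lemma second_partials:
  assumes S: "open S" "(x, t) \<in> S" and h: "C1_on S h" "C1_on S (frechet_diff h)"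
  shows "partial_fst (partial_fst h) (x, t) v w = frechet_diff (frechet_diff h) (x, t) (v, 0) (w, 0)"
    and "partial_snd (partial_fst h) (x, t) z w = frechet_diff (frechet_diff h) (x, t) (0, z) (w, 0)"
proof -
  define D where "D = Blinfun (\<lambda>d. frechet_diff (frechet_diff h) (x, t) d o\<^sub>L (inl_blinfun :: 'a \<Rightarrow>\<^sub>L ('a \<times> 'b)))"
  have D: "blinfun_apply D = (\<lambda>d. frechet_diff (frechet_diff h) (x, t) d o\<^sub>L inl_blinfun)"
    unfolding D_def
    by (rule bounded_linear_Blinfun_apply[OF has_derivative_bounded_linear[OF has_derivative_partial_fst[OF assms]]])
  have *: "(partial_fst h has_derivative D) (at (x, t))"
    unfolding D by (rule has_derivative_partial_fst[OF assms])
  show "partial_fst (partial_fst h) (x, t) v w = frechet_diff (frechet_diff h) (x, t) (v, 0) (w, 0)"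
    using partial_fst_eq[OF *] by (simp add: D)
  show "partial_snd (partial_fst h) (x, t) z w = frechet_diff (frechet_diff h) (x, t) (0, z) (w, 0)"
    using partial_snd_eq[OF *] by (simp add: D)
qed

subsection \<open>Countable covers and nowhere dense sets\<close>

lemma separable_countable_dense:
  assumes "separable_space (euclidean :: 'a::topological_space topology)"
  obtains D :: "'a::topological_space set" where "countable D" "closure D = UNIV"
  using assms that by (auto simp: separable_space_def)

text \<open>A Lindelof argument: \<open>J\<close> lists the balls with center in \<open>D\<close>
  and radius \<open>1 / Suc n\<close> that fit into some \<open>N w\<close>, and one such
  \<open>w\<close> is chosen for each.\<close>

lemma countable_dense_subcover:
  fixes N :: "'a::metric_space \<Rightarrow> 'a set" and D :: "'a set"
  assumes D: "countable D" "closure D = UNIV" and N: "\<And>w. w \<in> M \<Longrightarrow> open (N w) \<and> w \<in> N w"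
  obtains M0 where "countable M0" "M0 \<subseteq> M" "M \<subseteq> (\<Union>w\<in>M0. N w)"
proof -
  define J where "J = {(d, n::nat). d \<in> D \<and> (\<exists>w\<in>M. ball d (1 / real (Suc n)) \<subseteq> N w)}"
  define g where "g = (\<lambda>(d, n). SOME w. w \<in> M \<and> ball d (1 / real (Suc n)) \<subseteq> N w)"
  have g: "g (d, n) \<in> M" "ball d (1 / real (Suc n)) \<subseteq> N (g (d, n))" if "(d, n) \<in> J" for d n
  proof -
    have "\<exists>w. w \<in> M \<and> ball d (1 / real (Suc n)) \<subseteq> N w" using that by (auto simp: J_def)
    from someI_ex[OF this] show "g (d, n) \<in> M" "ball d (1 / real (Suc n)) \<subseteq> N (g (d, n))"
      by (auto simp: g_def)
  qed
  have "countable J"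
    by (rule countable_subset[of _ "D \<times> UNIV"]) (use D in \<open>auto simp: J_def\<close>)
  show thesis
  proof (rule that[of "g ` J"])
    show "countable (g ` J)" using \<open>countable J\<close> by simp
    show "g ` J \<subseteq> M" using g by auto
    show "M \<subseteq> (\<Union>w\<in>g ` J. N w)"
    proof
      fix w assume w: "w \<in> M"
      then obtain e where e: "e > 0" "ball w e \<subseteq> N w" using N open_contains_ball by blast
      obtain n where n: "1 / real (Suc n) < e / 2" using nat_approx_posE[of "e/2"] e by auto
      have "w \<in> closure D" using D by simp
      then obtain d where d: "d \<in> D" "dist d w < 1 / real (Suc n)"
        unfolding closure_approachable by (metis of_nat_0_less_iff zero_less_Suc zero_less_divide_1_iff)
      have "ball d (1 / real (Suc n)) \<subseteq> ball w e"
      proof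
        fix u assume "u \<in> ball d (1 / real (Suc n))"
        then have "dist d u < 1 / real (Suc n)" by simp
        then have "dist w u < e" using dist_triangle[of w u d] d(2) n by (simp add: dist_commute)
        then show "u \<in> ball w e" by simp
      qed
      then have J: "(d, n) \<in> J" using d w e by (auto simp: J_def)
      have "w \<in> N (g (d, n))" using g(2)[OF J] d(2) by (auto simp: subset_eq)
      then show "w \<in> (\<Union>w\<in>g ` J. N w)" using J by blast
    qed
  qed
qed

lemma nowhere_dense_in_open:
  assumes U: "open U" and B: "closed B" "interior B = {}"
  shows "nowhere_dense_in (top_of_set U) (U \<inter> B)"
proof -
  have "(top_of_set U) closure_of (U \<inter> B) \<subseteq> B"
    using closure_of_minimal[of "U \<inter> B" "U \<inter> B" "top_of_set U"] B(1) by (auto simp: closedin_closed_Int)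
  moreover have "V = {}" if "openin (top_of_set U) V" "V \<subseteq> B" for V
  proof -
    have "open V" using that(1) U by (simp add: openin_open_eq)
    then have "V \<subseteq> interior B" using that by (intro interior_maximal)
    then show ?thesis using B by simp
  qed
  ultimately have "(top_of_set U) interior_of ((top_of_set U) closure_of (U \<inter> B)) = {}"
    using interior_of_subset openin_interior_of by (metis order_trans)
  then show ?thesis by (simp add: nowhere_dense_in_def)
qed

subsection \<open>The parametrized system\<close>

locale parametrized_family =
  fixes X :: "'x::banach set" and Z :: "'z::banach set" and T :: real
    and f :: "'x \<times> real \<Rightarrow> 'y::banach" and j :: "'x \<times> 'z \<Rightarrow> 'y"
  assumes X: "open X" and Z: "open Z" "connected Z" "0 \<in> Z"
    and f: "C1_on (X \<times> {0<..<T}) f" "C1_on (X \<times> {0<..<T}) (frechet_diff f)"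
    and f_index: "\<And>t. t \<in> {0<..<T} \<Longrightarrow> fredholm_map X (\<lambda>x. f (x, t)) 0"
    and j: "C1_on (X \<times> Z) j" "C1_on (X \<times> Z) (frechet_diff j)"
    and j0: "\<And>x. x \<in> X \<Longrightarrow> j (x, 0) = 0"
    and J1: "\<And>x t z. x \<in> X \<Longrightarrow> t \<in> {0<..<T} \<Longrightarrow> z \<in> Z \<Longrightarrow>
              fredholm (partial_fst f (x, t) + partial_fst j (x, z))"
    and J2: "\<And>x t z v. x \<in> X \<Longrightarrow> t \<in> {0<..<T} \<Longrightarrow> z \<in> Z \<Longrightarrow> v \<noteq> 0 \<Longrightarrow>
              surj (\<lambda>(v', z'). blinfun_apply (partial_fst f (x, t)) v'
                + blinfun_apply (partial_fst j (x, z)) v'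
                + blinfun_apply (blinfun_apply (partial_snd (partial_fst j) (x, z)) z') v)"
begin

definition L where "L x t z = partial_fst f (x, t) + partial_fst j (x, z)"

definition h where "h y z = (\<lambda>(x, t). f (x, t) + y + j (x, z))"

abbreviation "Gf \<equiv> frechet_diff f"
abbreviation "Gj \<equiv> frechet_diff j"

lemma open_domains: "open (X \<times> {0<..<T})" "open (X \<times> Z)"
  using X Z by (auto intro: open_Times)

lemma f_deriv: "x \<in> X \<Longrightarrow> t \<in> {0<..<T} \<Longrightarrow> (f has_derivative Gf (x, t)) (at (x, t))"
  using f(1) by (auto simp: C1_on_def intro!: frechet_diff_works)

lemma j_deriv: "x \<in> X \<Longrightarrow> z \<in> Z \<Longrightarrow> (j has_derivative Gj (x, z)) (at (x, z))"
  using j(1) by (auto simp: C1_on_def intro!: frechet_diff_works)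

lemma L_apply:
  assumes "x \<in> X" "t \<in> {0<..<T}" "z \<in> Z"
  shows "L x t z v = Gf (x, t) (v, 0) + Gj (x, z) (v, 0)"
  unfolding L_def partial_fst_eq[OF f_deriv[OF assms(1,2)]] partial_fst_eq[OF j_deriv[OF assms(1,3)]]
  by (simp add: blinfun.add_left)

lemma L_fredholm:
  assumes x: "x \<in> X" and t: "t \<in> {0<..<T}" and z: "z \<in> Z"
  shows "fredholm (L x t z)" "fredholm_index (L x t z) = 0"
proof -
  show "fredholm (L x t z)" unfolding L_def using assms by (rule J1)
  have cont: "continuous_on Z (\<lambda>z. L x t z)"
  proof -
    have "continuous_on Z (\<lambda>z. Gj (x, z))"
      by (rule continuous_on_compose2[of "X \<times> Z" "Gj"])
         (use j(1) x in \<open>auto simp: C1_on_def intro!: continuous_intros\<close>)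
    then have "continuous_on Z (\<lambda>z. partial_fst f (x, t) + (Gj (x, z) o\<^sub>L inl_blinfun))"
      by (intro continuous_intros)
    then show ?thesis
      by (rule continuous_on_cong[THEN iffD1, rotated -1])
         (auto simp: L_def partial_fst_eq[OF j_deriv[OF x]])
  qed
  have "partial_fst j (x, 0) = 0"
  proof -
    have "((\<lambda>x. j (x, 0)) has_derivative blinfun_apply 0) (at x)"
      by (rule has_derivative_transform_within_open[OF _ X x, of "\<lambda>_. 0"])
         (auto simp: j0 zero_blinfun.rep_eq)
    then show ?thesis by (simp add: partial_fst_def frechet_diff_eq)
  qed
  then have "L x t 0 = frechet_diff (\<lambda>x. f (x, t)) x" by (simp add: L_def partial_fst_def)
  then have "fredholm_index (L x t 0) = 0" using f_index[OF t] x by (simp add: fredholm_map_def)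
  then show "fredholm_index (L x t z) = 0"
    using fredholm_index_connected[OF Z(2) cont _ z Z(3)] J1[OF x t] by (simp add: L_def)
qed

text \<open>The dictionary between (T1)-(T3), stated with partials of \<open>h\<close>, and the
  system, whose differential is expressed by full differentials of \<open>f\<close> and
  \<open>j\<close>.\<close>

lemma partials_h:
  assumes x: "x \<in> X" and t: "t \<in> {0<..<T}" and z: "z \<in> Z"
  shows "partial_fst (h y z) (x, t) = L x t z"
    and "partial_t (h y z) (x, t) = Gf (x, t) (0, 1)"
    and "partial_fst (partial_fst (h y z)) (x, t) v w =
      frechet_diff Gf (x, t) (v, 0) (w, 0) + frechet_diff Gj (x, z) (v, 0) (w, 0)"
proof -
  \<comment> \<open>Proved on all of \<open>X\<close>, since the identity is differentiated in
    \<open>x\<close> once more below.\<close>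
  have fst_h: "partial_fst (h y z) (x, t) = L x t z" if x: "x \<in> X" for x
  proof -
    have "((\<lambda>x. f (x, t) + y + j (x, z)) has_derivative (\<lambda>v. Gf (x, t) (v, 0) + 0 + Gj (x, z) (v, 0))) (at x)"
      by (intro has_derivative_add has_derivative_const
          has_derivative_compose[of "\<lambda>x. (x, _)" "\<lambda>v. (v, 0)" x UNIV, OF _ f_deriv[OF x t]]
          has_derivative_compose[of "\<lambda>x. (x, _)" "\<lambda>v. (v, 0)" x UNIV, OF _ j_deriv[OF x z]]
          has_derivative_Pair has_derivative_ident)
    also have "(\<lambda>v. Gf (x, t) (v, 0) + 0 + Gj (x, z) (v, 0)) = L x t z"
      by (auto simp: L_apply[OF x t z])
    finally show ?thesis by (simp add: partial_fst_def h_def frechet_diff_eq)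
  qed
  show "partial_fst (h y z) (x, t) = L x t z" by (rule fst_h[OF x])
  have "((\<lambda>t. f (x, t) + y + j (x, z)) has_derivative (\<lambda>s. Gf (x, t) (0, s) + 0 + 0)) (at t)"
    by (intro has_derivative_add has_derivative_const
          has_derivative_compose[of "\<lambda>t. (x, t)" "\<lambda>s. (0, s)" t UNIV, OF _ f_deriv[OF x t]]
          has_derivative_Pair has_derivative_ident)
  also have "(\<lambda>s. Gf (x, t) (0, s) + 0 + 0) = (\<lambda>s. s *\<^sub>R Gf (x, t) (0, 1))"
    by (simp add: blinfun.scaleR_right[symmetric])
  finally have "((\<lambda>t. f (x, t) + y + j (x, z)) has_vector_derivative Gf (x, t) (0, 1)) (at t)"
    unfolding has_vector_derivative_def .
  then show "partial_t (h y z) (x, t) = Gf (x, t) (0, 1)"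
    by (simp add: partial_t_def h_def vector_derivative_at)
  have df: "(\<lambda>x. partial_fst f (x, t)) differentiable (at x)"
    unfolding differentiable_def
    by (rule exI, rule has_derivative_compose[of "\<lambda>x. (x, t)" "\<lambda>v. (v, 0)" x UNIV,
          OF _ has_derivative_partial_fst[OF open_domains(1) _ f]])
       (use x t in \<open>auto intro!: derivative_eq_intros\<close>)
  have dj: "(\<lambda>x. partial_fst j (x, z)) differentiable (at x)"
    unfolding differentiable_def
    by (rule exI, rule has_derivative_compose[of "\<lambda>x. (x, z)" "\<lambda>v. (v, 0)" x UNIV,
          OF _ has_derivative_partial_fst[OF open_domains(2) _ j]])
       (use x z in \<open>auto intro!: derivative_eq_intros\<close>)
  have "((\<lambda>x. L x t z) has_derivative
      (partial_fst (partial_fst f) (x, t) + partial_fst (partial_fst j) (x, z))) (at x)"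
    unfolding L_def plus_blinfun.rep_eq partial_fst_def[of "partial_fst f"] partial_fst_def[of "partial_fst j"] fst_conv snd_conv
    by (intro has_derivative_add frechet_diff_works df dj)
  then have "((\<lambda>x. partial_fst (h y z) (x, t)) has_derivative
      (partial_fst (partial_fst f) (x, t) + partial_fst (partial_fst j) (x, z))) (at x)"
    by (rule has_derivative_transform_within_open[OF _ X x]) (simp add: fst_h)
  then have "partial_fst (partial_fst (h y z)) (x, t) =
      partial_fst (partial_fst f) (x, t) + partial_fst (partial_fst j) (x, z)"
    by (simp add: partial_fst_def[of "partial_fst (h y z)"] frechet_diff_eq)
  then show "partial_fst (partial_fst (h y z)) (x, t) v w =
      frechet_diff Gf (x, t) (v, 0) (w, 0) + frechet_diff Gj (x, z) (v, 0) (w, 0)"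
    using second_partials(1)[OF open_domains(1) _ f, of x t v w]
      second_partials(1)[OF open_domains(2) _ j, of x z v w] x t z
    by (simp add: blinfun.add_left)
qed

lemma singular_vector:
  assumes "(x, t) \<in> singular_set X T (h y z)" "z \<in> Z"
  obtains v where "v \<noteq> 0" "L x t z v = 0"
proof -
  have xt: "x \<in> X" "t \<in> {0<..<T}" and "\<not> invertible_blinfun (L x t z)"
    using assms partials_h(1) by (auto simp: singular_set_def)
  then show thesis
    using that invertible_of_trivial_kernel[OF L_fredholm[OF xt assms(2)]] by blast
qed

text \<open>The neighbourhood \<open>N\<close> refers to vectors \<open>v\<close> without
  normalization: the normalizing functional depends on the zero, and sets of this kind have to cover
  all zeros together.\<close>

lemma bad_parameters_locally_nowhere_dense:
  assumes x0: "x0 \<in> X" and t0: "t0 \<in> {0<..<T}" and z0: "z0 \<in> Z" and v0: "v0 \<noteq> 0"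
    and h0: "h y0 z0 (x0, t0) = 0" and L0: "L x0 t0 z0 v0 = 0"
  shows "\<exists>N B. open N \<and> ((x0, t0, v0), (y0, z0)) \<in> N \<and> closed B \<and> interior B = {} \<and>
    (\<forall>x t v y z. ((x, t, v), (y, z)) \<in> N \<longrightarrow> x \<in> X \<longrightarrow> t \<in> {0<..<T} \<longrightarrow> z \<in> Z \<longrightarrow> h y z (x, t) = 0 \<longrightarrow> L x t z v = 0 \<longrightarrow>
      \<not> (transversal_T1 (h y z) (x, t) \<and> transversal_T2 (h y z) (x, t) \<and> transversal_T3 (h y z) (x, t)) \<longrightarrow>
      (y, z) \<in> B)"
proof -
  \<comment> \<open>The coordinates are bounded linear operators, as
    \<open>has_C1_derivative_compose_linear\<close> and \<open>has_C1_derivative_apply\<close>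
    require.\<close>
  define xt :: "(('x \<times> real \<times> 'x) \<times> ('y \<times> 'z)) \<Rightarrow>\<^sub>L ('x \<times> real)"
    where "xt = (inl_blinfun o\<^sub>L fst_blinfun o\<^sub>L fst_blinfun) + (inr_blinfun o\<^sub>L fst_blinfun o\<^sub>L snd_blinfun o\<^sub>L fst_blinfun)"
  define xz :: "(('x \<times> real \<times> 'x) \<times> ('y \<times> 'z)) \<Rightarrow>\<^sub>L ('x \<times> 'z)"
    where "xz = (inl_blinfun o\<^sub>L fst_blinfun o\<^sub>L fst_blinfun) + (inr_blinfun o\<^sub>L snd_blinfun o\<^sub>L snd_blinfun)"
  define vv :: "(('x \<times> real \<times> 'x) \<times> ('y \<times> 'z)) \<Rightarrow>\<^sub>L 'x"
    where "vv = snd_blinfun o\<^sub>L snd_blinfun o\<^sub>L fst_blinfun"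
  define yy :: "(('x \<times> real \<times> 'x) \<times> ('y \<times> 'z)) \<Rightarrow>\<^sub>L 'y"
    where "yy = fst_blinfun o\<^sub>L snd_blinfun"
  have ap: "xt ((x, t, v), (y, z)) = (x, t)" "xz ((x, t, v), (y, z)) = (x, z)"
    "vv ((x, t, v), (y, z)) = v" "yy ((x, t, v), (y, z)) = y" for x t v y z
    by (simp_all add: xt_def xz_def vv_def yy_def blinfun.add_left)
  define W where "W = xt -` (X \<times> {0<..<T}) \<inter> xz -` (X \<times> Z)"
  have W: "open W"
    unfolding W_def using open_domains by (intro open_Int open_vimage continuous_intros)
  have inW: "((x, t, v), (y, z)) \<in> W \<longleftrightarrow> x \<in> X \<and> t \<in> {0<..<T} \<and> z \<in> Z" for x t v y z
    by (auto simp: W_def ap)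

  \<comment> \<open>These are the blocks of the differential at the given zero in the pattern of
    \<open>extended_system_aug_iso\<close>: \<open>B + B'\<close> is the second x-differential of
    \<open>h\<close> with \<open>v0\<close> inserted, and \<open>S\<close> the mixed second
    differential of \<open>j\<close> with \<open>v0\<close> inserted, the operator of (J2).\<close>
  define a b where "a = Gf (x0, t0) (0, 1)" and "b = frechet_diff Gf (x0, t0) (0, 1) (v0, 0)"
  define B where "B = blinfun.prod_left (v0, 0) o\<^sub>L
     ((frechet_diff Gf (x0, t0) o\<^sub>L inl_blinfun))"
  define B' where "B' = blinfun.prod_left (v0, 0) o\<^sub>L (frechet_diff Gj (x0, z0) o\<^sub>L inl_blinfun)"
  define S where "S = blinfun.prod_left (v0, 0) o\<^sub>L (frechet_diff Gj (x0, z0) o\<^sub>L inr_blinfun)"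
  define J where "J = Gj (x0, z0) o\<^sub>L inr_blinfun"
  have Lapply: "L x0 t0 z0 w = Gf (x0, t0) (w, 0) + Gj (x0, z0) (w, 0)" for w
    by (rule L_apply[OF x0 t0 z0])
  have gen: "\<exists>w z. y = L x0 t0 z0 w + S z" for y
  proof -
    obtain w z where "y = partial_fst f (x0, t0) w + partial_fst j (x0, z0) w
         + partial_snd (partial_fst j) (x0, z0) z v0"
      using surjD[OF J2[OF x0 t0 z0 v0], of y] by auto
    then show ?thesis
      using second_partials(2)[OF open_domains(2) _ j, of x0 z0 z v0] x0 z0
      by (intro exI[of _ w] exI[of _ z]) (simp add: L_def S_def blinfun.add_left blinfun.prod_left.rep_eq)
  qed
  obtain \<theta> :: "'x \<Rightarrow>\<^sub>L real" where \<theta>: "\<theta> v0 = 1" and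
    iso: "\<And>D. (\<And>x t w y z. blinfun_apply D ((x, t, w), (y, z)) =
          (L x0 t0 z0 x + t *\<^sub>R a + y + J z, (B + B') x + t *\<^sub>R b + L x0 t0 z0 w + S z, \<theta> w)) \<Longrightarrow>
       \<exists>(I :: ('y + 'y) set) p (K :: ('x + 'x) set) (\<kappa> :: 'x + 'x \<Rightarrow> ('x \<times> real \<times> 'x) \<Rightarrow>\<^sub>L real) C.
         finite I \<and> finite K \<and> card K = card I \<and> C > 0 \<and>
         aug_iso C (D o\<^sub>L inl_blinfun) I (\<lambda>i. blinfun_apply D (0, p i)) K \<kappa>"
    using extended_system_aug_iso[OF L_fredholm[OF x0 t0 z0] v0 L0 gen, of a J "B + B'" b] by blast

  have C1f: "has_C1_derivative f Gf (X \<times> {0<..<T})" "has_C1_derivative Gf (frechet_diff Gf) (X \<times> {0<..<T})"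
    and C1j: "has_C1_derivative j Gj (X \<times> Z)" "has_C1_derivative Gj (frechet_diff Gj) (X \<times> Z)"
    using f j by (simp_all add: C1_on_iff)
  have xtW: "xt w \<in> X \<times> {0<..<T}" and xzW: "xz w \<in> X \<times> Z" if "w \<in> W" for w using that by (auto simp: W_def)
  define \<Phi> where "\<Phi> w = (f (xt w) + yy w + j (xz w),
      Gf (xt w) ((inl_blinfun o\<^sub>L vv) w) + Gj (xz w) ((inl_blinfun o\<^sub>L vv) w), (\<theta> o\<^sub>L vv) w + (-1))" for w
  note row1 = has_C1_derivative_add[OF has_C1_derivative_add[OF
        has_C1_derivative_compose_linear[OF C1f(1) xtW] has_C1_derivative_linear[of yy]]
      has_C1_derivative_compose_linear[OF C1j(1) xzW]]
  note row2 = has_C1_derivative_add[OF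
      has_C1_derivative_apply[OF has_C1_derivative_compose_linear[OF C1f(2) xtW], where A="inl_blinfun o\<^sub>L vv"]
      has_C1_derivative_apply[OF has_C1_derivative_compose_linear[OF C1j(2) xzW], where A="inl_blinfun o\<^sub>L vv"]]
  note row3 = has_C1_derivative_add[OF has_C1_derivative_linear[of "\<theta> o\<^sub>L vv"] has_C1_derivative_const[of "-1"]]
  have "\<exists>D. has_C1_derivative \<Phi> D W \<and> (\<forall>w\<in>W. \<forall>d. D w d =
     (Gf (xt w) (xt d) + yy d + Gj (xz w) (xz d),
      (frechet_diff Gf (xt w) (xt d) (vv w, 0) + Gf (xt w) (vv d, 0)) +
      (frechet_diff Gj (xz w) (xz d) (vv w, 0) + Gj (xz w) (vv d, 0)), \<theta> (vv d)))"
    unfolding \<Phi>_def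
    by (intro exI conjI, rule has_C1_derivative_Pair[OF row1 has_C1_derivative_Pair[OF row2 row3]])
       (auto simp: blinfun.add_left blinfun.prod_left.rep_eq)
  then obtain D where C1: "has_C1_derivative \<Phi> D W" and D: "\<And>w d. w \<in> W \<Longrightarrow> D w d =
     (Gf (xt w) (xt d) + yy d + Gj (xz w) (xz d),
      (frechet_diff Gf (xt w) (xt d) (vv w, 0) + Gf (xt w) (vv d, 0)) +
      (frechet_diff Gj (xz w) (xz d) (vv w, 0) + Gj (xz w) (vv d, 0)), \<theta> (vv d))"
    by blast
  have split1: "blinfun_apply A (x, t) = A (x, 0) + t *\<^sub>R A (0, 1)" for A :: "('x \<times> real) \<Rightarrow>\<^sub>L 'c::real_normed_vector" and x t
    by (simp add: blinfun.scaleR_right[symmetric] blinfun.add_right[symmetric])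
  have split2: "blinfun_apply A (x, z) = A (x, 0) + A (0, z)" for A :: "('x \<times> 'z) \<Rightarrow>\<^sub>L 'c::real_normed_vector" and x z
    by (simp add: blinfun.add_right[symmetric])
  define w0 where "w0 = ((x0, t0, v0), (y0, z0))"
  have w0: "w0 \<in> W" using x0 t0 z0 by (simp add: w0_def inW)
  have "blinfun_apply (D w0) ((x, t, w), (y, z)) =
          (L x0 t0 z0 x + t *\<^sub>R a + y + J z, (B + B') x + t *\<^sub>R b + L x0 t0 z0 w + S z, \<theta> w)" for x t w y z
    unfolding D[OF w0] unfolding w0_def ap Lapply
    by (simp add: split1[of _ x t] split2[of _ x z] a_def b_def B_def B'_def S_def J_def blinfun.add_left
        blinfun.scaleR_left blinfun.prod_left.rep_eq algebra_simps)
  from iso[OF this] obtain I :: "('y + 'y) set" and p and K :: "('x + 'x) set" and \<kappa> C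
    where sys: "finite I" "finite K" "card K = card I" "C > 0"
      "aug_iso C (D w0 o\<^sub>L inl_blinfun) I (\<lambda>i. blinfun_apply (D w0) (0, p i)) K \<kappa>"
    by blast
  interpret regular_zero \<Phi> D W w0 I p K \<kappa> C
    using W w0 C1 sys by unfold_locales (auto simp: has_C1_derivative_def)
  obtain N Bad where N: "open N" "w0 \<in> N" "closed Bad" "interior Bad = {}"
    and crit: "\<And>e l. (e, l) \<in> N \<Longrightarrow> \<Phi> (e, l) = 0 \<Longrightarrow> \<not> surj (\<lambda>e'. D (e, l) (e', 0)) \<Longrightarrow> l \<in> Bad"
    by (rule critical_values_nowhere_dense) blast

  define V where "V = {w. \<theta> (vv w) \<noteq> 0}"
  have V: "open V" unfolding V_def by (intro open_Collect_neq continuous_intros)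
  \<comment> \<open>\<open>rs\<close> rescales \<open>v\<close> to \<open>\<theta> v = 1\<close>. It
    fixes \<open>w0\<close>, so the preimage of \<open>N\<close> is still a neighbourhood of
    \<open>w0\<close>.\<close>
  define rs where "rs w = ((fst (xt w), snd (xt w), (1 / \<theta> (vv w)) *\<^sub>R vv w), snd w)" for w
  have "continuous_on V rs" unfolding rs_def V_def by (intro continuous_intros) auto
  then have openN: "open (V \<inter> rs -` N)" by (rule continuous_open_preimage[OF _ V N(1)])
  have "w0 \<in> V \<inter> rs -` N" using N(2) \<theta> by (simp add: V_def rs_def w0_def ap)
  moreover have "(y, z) \<in> Bad"
    if "((x, t, v), (y, z)) \<in> V \<inter> rs -` N" and x: "x \<in> X" and t: "t \<in> {0<..<T}" and z: "z \<in> Z"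
      and hz: "h y z (x, t) = 0" and Lv: "L x t z v = 0"
      and nt: "\<not> (transversal_T1 (h y z) (x, t) \<and> transversal_T2 (h y z) (x, t) \<and> transversal_T3 (h y z) (x, t))"
    for x t v y z
  proof (rule crit)
    define v1 where "v1 = (1 / \<theta> v) *\<^sub>R v"
    have \<theta>v: "\<theta> v \<noteq> 0" and inN: "((x, t, v1), (y, z)) \<in> N"
      using that(1) by (auto simp: V_def rs_def ap v1_def)
    show "((x, t, v1), (y, z)) \<in> N" by (rule inN)
    have \<theta>1: "\<theta> v1 = 1" using \<theta>v by (simp add: v1_def blinfun.scaleR_right)
    have Lv1: "L x t z v1 = 0" using Lv by (simp add: v1_def blinfun.scaleR_right)
    have "v1 \<noteq> 0" using \<theta>1 by (auto simp: blinfun.zero_right)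
    show "\<Phi> ((x, t, v1), (y, z)) = 0"
      using hz Lv1 \<theta>1 by (simp add: \<Phi>_def ap h_def L_apply[OF x t z] zero_prod_def)
    show "\<not> surj (\<lambda>e'. D ((x, t, v1), (y, z)) (e', 0))"
    proof
      assume s: "surj (\<lambda>e'. D ((x, t, v1), (y, z)) (e', 0))"
      have W1: "((x, t, v1), (y, z)) \<in> W" using x t z by (simp add: inW)
      define B1 where "B1 = (blinfun.prod_left (v1, 0) o\<^sub>L (frechet_diff Gf (x, t) o\<^sub>L inl_blinfun)) +
         (blinfun.prod_left (v1, 0) o\<^sub>L (frechet_diff Gj (x, z) o\<^sub>L inl_blinfun))"
      have B1: "B1 u = frechet_diff Gf (x, t) (u, 0) (v1, 0) + frechet_diff Gj (x, z) (u, 0) (v1, 0)" for u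
        by (simp add: B1_def blinfun.add_left blinfun.prod_left.rep_eq)
      have formula: "D ((x, t, v1), (y, z)) ((u, r, w), 0) =
        (L x t z u + r *\<^sub>R Gf (x, t) (0, 1), B1 u + r *\<^sub>R frechet_diff Gf (x, t) (0, 1) (v1, 0) + L x t z w, \<theta> w)" for u r w
        unfolding D[OF W1] zero_prod_def ap L_apply[OF x t z] B1
        by (simp add: split1[of _ u r] blinfun.add_left blinfun.scaleR_left algebra_simps)
      have "\<exists>u r w. L x t z u + r *\<^sub>R Gf (x, t) (0, 1) = p1 \<and>
          B1 u + r *\<^sub>R frechet_diff Gf (x, t) (0, 1) (v1, 0) + L x t z w = p2 \<and> \<theta> w = s" for p1 p2 s
      proof -
        obtain u r w where "(p1, p2, s) = D ((x, t, v1), (y, z)) ((u, r, w), 0)"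
          using surjD[OF s, of "(p1, p2, s)"] by (metis prod_cases3)
        then show ?thesis unfolding formula by blast
      qed
      note tr = transversality_of_surj[OF L_fredholm[OF x t z] \<open>v1 \<noteq> 0\<close> Lv1 this]
      have "transversal_T1 (h y z) (x, t)"
        using tr(1) by (simp add: transversal_T1_def partials_h[OF x t z])
      moreover have "transversal_T2 (h y z) (x, t)"
        using tr(3) by (simp add: transversal_T2_def partials_h[OF x t z])
      moreover have "transversal_T3 (h y z) (x, t)"
        unfolding transversal_T3_def partials_h[OF x t z]
      proof (intro ballI impI)
        fix u l assume u: "u \<in> kernel (L x t z)" "u \<noteq> 0" and l: "l \<in> kernel (adjoint_blinfun (L x t z))" "l \<noteq> 0"
        obtain r where r: "u = r *\<^sub>R v1" using tr(2)[OF u(1)] by blast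
        \<comment> \<open>(T3) concerns every kernel vector, hence multiples of \<open>v1\<close>;
          both slots contribute a factor \<open>r\<close>, giving the nonzero factor
          \<open>r * r\<close>.\<close>
        have u1: "(u, 0 :: real) = r *\<^sub>R (v1, 0)" and u2: "(u, 0 :: 'z) = r *\<^sub>R (v1, 0)" by (simp_all add: r)
        have "frechet_diff Gf (x, t) (u, 0) (u, 0) + frechet_diff Gj (x, z) (u, 0) (u, 0) = (r * r) *\<^sub>R B1 v1"
          unfolding u1 u2 B1 blinfun.scaleR_right blinfun.scaleR_left scaleR_scaleR scaleR_add_right ..
        moreover have "r \<noteq> 0" using u r by auto
        ultimately show "l (frechet_diff Gf (x, t) (u, 0) (u, 0) + frechet_diff Gj (x, z) (u, 0) (u, 0)) \<noteq> 0"
          using tr(3)[OF l] by (simp add: blinfun.scaleR_right)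
      qed
      ultimately show False using nt by blast
    qed
  qed
  ultimately show ?thesis
    using openN N by (intro exI[of _ "V \<inter> rs -` N"] exI[of _ Bad]) (auto simp: w0_def)
qed

end

theorem theorem3p2:
  fixes X :: "'x::banach set"
    and Z :: "'z::banach set"
    and T :: real
    and f :: "'x \<times> real \<Rightarrow> 'y::banach"
    and j :: "'x \<times> 'z \<Rightarrow> 'y"
    and U :: "('y \<times> 'z) set"
  assumes "separable_space (euclidean :: 'x topology)"
    and "separable_space (euclidean :: 'y topology)"
    and "separable_space (euclidean :: 'z topology)"
    and "T > 0"
    and "open X" and "connected X"
    and "open Z" and "connected Z" and "0 \<in> Z"
    and "C3_on (X \<times> {0<..<T}) f"
    and "\<And>t. t \<in> {0<..<T} \<Longrightarrow> fredholm_map X (\<lambda>x. f (x, t)) 0"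
    and "C2_on (X \<times> Z) j"
    and "\<And>x. x \<in> X \<Longrightarrow> j (x, 0) = 0"
    and J1: "\<And>x t z. x \<in> X \<Longrightarrow> t \<in> {0<..<T} \<Longrightarrow> z \<in> Z \<Longrightarrow>
              fredholm (partial_fst f (x, t) + partial_fst j (x, z))"
    and J2: "\<And>x t z v. x \<in> X \<Longrightarrow> t \<in> {0<..<T} \<Longrightarrow> z \<in> Z \<Longrightarrow> v \<noteq> 0 \<Longrightarrow>
              surj (\<lambda>(v', z'). blinfun_apply (partial_fst f (x, t)) v'
                + blinfun_apply (partial_fst j (x, z)) v'
                + blinfun_apply (blinfun_apply (partial_snd (partial_fst j) (x, z)) z') v)"
    and "open U" and "U \<subseteq> UNIV \<times> Z" and "(0, 0) \<in> U"
  shows "\<exists>U\<^sub>r. U\<^sub>r \<subseteq> U \<and> residual_in (top_of_set U) U\<^sub>r \<and>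
           (\<forall>(y, z) \<in> U\<^sub>r. transversality_conditions X T (\<lambda>(x, t). f (x, t) + y + j (x, z)))"
proof -
  interpret parametrized_family X Z T f j
    using assms by unfold_locales (auto simp: C3_on_def C2_on_def)
  obtain Dx :: "'x set" where Dx: "countable Dx" "closure Dx = UNIV"
    using separable_countable_dense[OF assms(1)] by blast
  obtain Dy :: "'y set" where Dy: "countable Dy" "closure Dy = UNIV"
    using separable_countable_dense[OF assms(2)] by blast
  obtain Dz :: "'z set" where Dz: "countable Dz" "closure Dz = UNIV"
    using separable_countable_dense[OF assms(3)] by blast
  \<comment> \<open>One countable dense set for points, kernel vectors and parameters together; the
    rationals serve the variable \<open>t\<close>.\<close>
  define Q where "Q = (Dx \<times> (\<rat> :: real set) \<times> Dx) \<times> (Dy \<times> Dz)"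
  have Q: "countable Q" "closure Q = UNIV"
    using Dx Dy Dz by (auto simp: Q_def countable_rat closure_Times Rats_closure_real)
  define good where "good y z x t \<longleftrightarrow>
    transversal_T1 (h y z) (x, t) \<and> transversal_T2 (h y z) (x, t) \<and> transversal_T3 (h y z) (x, t)" for y z x t
  \<comment> \<open>All parameters and all nonzero kernel vectors are collected at once, so that one
    countable cover serves every \<open>(y, z)\<close>.\<close>
  define zeros where "zeros = {((x, t, v), (y, z)). x \<in> X \<and> t \<in> {0<..<T} \<and> z \<in> Z \<and> v \<noteq> 0 \<and> h y z (x, t) = 0 \<and> L x t z v = 0}"
  have "\<forall>w\<in>zeros. \<exists>N B. open N \<and> w \<in> N \<and> closed B \<and> interior B = {} \<and>
     (\<forall>x t v y z. ((x, t, v), (y, z)) \<in> N \<inter> zeros \<longrightarrow> \<not> good y z x t \<longrightarrow> (y, z) \<in> B)"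
  proof
    fix w assume "w \<in> zeros"
    then obtain x t v y z where w: "w = ((x, t, v), (y, z))" "x \<in> X" "t \<in> {0<..<T}" "z \<in> Z" "v \<noteq> 0"
      "h y z (x, t) = 0" "L x t z v = 0" by (auto simp: zeros_def)
    obtain N B where NB: "open N" "w \<in> N" "closed B" "interior B = {}"
      "\<And>x t v y z. ((x, t, v), (y, z)) \<in> N \<Longrightarrow> x \<in> X \<Longrightarrow> t \<in> {0<..<T} \<Longrightarrow> z \<in> Z \<Longrightarrow> h y z (x, t) = 0 \<Longrightarrow>
         L x t z v = 0 \<Longrightarrow> \<not> good y z x t \<Longrightarrow> (y, z) \<in> B"
      using bad_parameters_locally_nowhere_dense[OF w(2-7)] unfolding w(1) good_def by metis
    show "\<exists>N B. open N \<and> w \<in> N \<and> closed B \<and> interior B = {} \<and>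
     (\<forall>x t v y z. ((x, t, v), (y, z)) \<in> N \<inter> zeros \<longrightarrow> \<not> good y z x t \<longrightarrow> (y, z) \<in> B)"
      using NB by (intro exI[of _ N] exI[of _ B]) (auto simp: zeros_def)
  qed
  then obtain N B where N: "\<And>w. w \<in> zeros \<Longrightarrow> open (N w) \<and> w \<in> N w"
    and B: "\<And>w. w \<in> zeros \<Longrightarrow> closed (B w)" "\<And>w. w \<in> zeros \<Longrightarrow> interior (B w) = {}"
    and NB: "\<And>w x t v y z. w \<in> zeros \<Longrightarrow> ((x, t, v), (y, z)) \<in> N w \<inter> zeros \<Longrightarrow> \<not> good y z x t \<Longrightarrow> (y, z) \<in> B w"
    by metis
  obtain M0 where M0: "countable M0" "M0 \<subseteq> zeros" "zeros \<subseteq> (\<Union>w\<in>M0. N w)"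
    using countable_dense_subcover[OF Q N] by blast
  define Ur where "Ur = {(y, z) \<in> U. transversality_conditions X T (h y z)}"
  have "U - Ur \<subseteq> (\<Union>w\<in>M0. U \<inter> B w)"
  proof
    fix l assume l: "l \<in> U - Ur"
    obtain y z where yz: "l = (y, z)" by (cases l)
    have z: "z \<in> Z" using l yz assms(17) by auto
    have "\<not> transversality_conditions X T (h y z)" using l yz by (auto simp: Ur_def)
    then obtain x t where xt: "(x, t) \<in> singular_set X T (h y z)" and bad: "\<not> good y z x t"
      by (auto simp: transversality_conditions_def good_def)
    obtain v where v: "v \<noteq> 0" "L x t z v = 0" by (rule singular_vector[OF xt z])
    have "((x, t, v), (y, z)) \<in> zeros" using xt v z by (auto simp: zeros_def singular_set_def)
    moreover from this obtain w where "w \<in> M0" "((x, t, v), (y, z)) \<in> N w" using M0 by blast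
    ultimately have "(y, z) \<in> B w" using NB bad M0(2) by blast
    then show "l \<in> (\<Union>w\<in>M0. U \<inter> B w)" using l yz \<open>w \<in> M0\<close> by auto
  qed
  moreover have "nowhere_dense_in (top_of_set U) (U \<inter> B w)" if "w \<in> M0" for w
  proof -
    have "w \<in> zeros" using that M0(2) by blast
    then show ?thesis by (intro nowhere_dense_in_open[OF assms(16)] B)
  qed
  ultimately have "meagre_in (top_of_set U) (U - Ur)"
    unfolding meagre_in_def using M0(1) by (intro exI[of _ "(\<lambda>w. U \<inter> B w) ` M0"]) auto
  then have "residual_in (top_of_set U) Ur" by (auto simp: residual_in_def Ur_def)
  then show ?thesis
    by (intro exI[of _ Ur]) (auto simp: Ur_def h_def)
qed


end
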